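(* Let $E$ be a locally convex topological vector space with Borel $\sigma$-algebra $\mathcal{B}$ (with $(E,\mathcal{B})$ Lusin measurable), let $K\subset E$ be countable with $\sum_{k\in K}|l(k)|^2<\infty$ for all $l\in E'$, let $b=(b_k)_{k\in K}$ be a family of $\mathcal{B}$-measurable functions, and let $m\in\mathcal{G}^b$ be a Gibbs state associated with $b$, with corresponding Dirichlet form $(\mathcal{E}_m,D(\mathcal{E}_m))$ on $L^2(E,m)$. The following assertions are equivalent. (i) The form $\mathcal{E}_m$ is irreducible. (ii) $\mathcal{G}^b_{m,ac}=\{m\}$. (iii) The measure $m$ is extremal in $\mathcal{G}^b_{m,ac}$. (iv) The measure $m$ is extremal in $\mathcal{G}^b$.
   Context: $E'$ is the topological dual of $E$ and $\mathcal{F}C_b^\infty=\{f(l_1,\dots,l_n):n\in\mathbb{N},f\in C_b^\infty(\mathbb{R}^n),l_1,\dots,l_n\in E'\}$; for $k\in E$, $\frac{\partial u}{\partial k}(z)=\frac{d}{ds}u(z+sk)|_{s=0}$. $\mathcal{G}^b$ (Gibbs states associated with $b$) is the set of all probability measures $\mu$ on $(E,\mathcal{B})$ such that $b_k\in L^2(E,\mu)$ and $\int\frac{\partial u}{\partial k}\,d\mu=-\int u\,b_k\,d\mu$ for all $u\in\mathcal{F}C_b^\infty$ and $k\in K$. $\mathcal{G}^b_{m,ac}$ is the set of $\mu\in\mathcal{G}^b$ absolutely continuous with respect to $m$. For $k\in K$, $(\mathcal{E}_{m,k},D(\mathcal{E}_{m,k}))$ is the closure on $L^2(E,m)$ of $\mathcal{E}_{m,k}(u,v)=\int\frac{\partial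 u}{\partial k}\frac{\partial v}{\partial k}\,dm$, $u,v\in\mathcal{F}C_b^\infty$ (which is closable). The Dirichlet form $\mathcal{E}_m$ is $D(\mathcal{E}_m)=\{u\in\bigcap_{k\in K}D(\mathcal{E}_{m,k}):\sum_{k}\mathcal{E}_{m,k}(u,u)<\infty\}$, $\mathcal{E}_m(u,v)=\frac12\sum_{k}\mathcal{E}_{m,k}(u,v)$. Its $L^2(E,m)$-resolvent is realized as a sub-Markovian resolvent of kernels $(U_\alpha)_{\alpha>0}$ on $(E,\mathcal{B})$; put $U=\sup_\alpha U_\alpha$. $\mathcal{E}_m$ is irreducible if every $A\in\mathcal{B}$ with $U(1_{E\setminus A})=0$ $m$-a.e. on $A$ satisfies $m(A)=0$ or $m(E\setminus A)=0$. $m$ is extremal in a convex set $\mathcal{C}$ of probability measures containing $m$ if $m=tm_1+(1-t)m_2$ with $m_1,m_2\in\mathcal{C}$ and $t\in(0,1)$ implies $m_1=m_2=m$. *)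

theory Defs
  imports "HOL-Probability.Probability"
begin

section \<open>Locally convex spaces, the topological dual, Lusin measurable spaces\<close>

text \<open>No separation axiom is included: it is implied by \<open>lusin_measurable\<close> below, since in
  a Lusin measurable space all singletons are measurable.\<close>

class locally_convex_space = real_vector + topological_ab_group_add +
  assumes tendsto_scaleR_nhds:
    "LIM x (nhds r \<times>\<^sub>F nhds a). fst x *\<^sub>R snd x :> nhds (r *\<^sub>R a)"
  and locally_convex_zero:
    "\<lbrakk>open W; 0 \<in> W\<rbrakk> \<Longrightarrow> \<exists>V. open V \<and> 0 \<in> V \<and> V \<subseteq> W \<and>
      (\<forall>x\<in>V. \<forall>y\<in>V. \<forall>t\<ge>0. t \<le> 1 \<longrightarrow> (1 - t) *\<^sub>R x + t *\<^sub>R y \<in> V)"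

definition top_dual :: "('a::locally_convex_space \<Rightarrow> real) set" where
  "top_dual = {l. linear l \<and> continuous_on UNIV l}"

text \<open>A measurable space is Lusin if it is measurably isomorphic to a Borel subset of a compact
  metric space. Compact metric spaces have at most the cardinality of the continuum, so it is no
  restriction that the points of the compact metrizable space \<open>X\<close> are labelled by reals; its
  topology is arbitrary and unrelated to the topology of the real line.\<close>

definition lusin_measurable :: "'a measure \<Rightarrow> bool" where
  "lusin_measurable M \<longleftrightarrow>
    (\<exists>(X :: real topology) S g h.
      compact_space X \<and> metrizable_space X \<and>
      (let B = sigma (topspace X) {W. openin X W} in
        S \<in> sets B \<and>
        g \<in> M \<rightarrow>\<^sub>M restrict_space B S \<and> h \<in> restrict_space B S \<rightarrow>\<^sub>M M \<and>
        (\<forall>x\<in>space M. h (g x) = x) \<and> (\<forall>y\<in>S. g (h y) = y)))"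


section \<open>Smooth cylinder functions\<close>

text \<open>A function on \<open>\<real>\<^sup>n\<close> is represented by a function of real sequences that depends only on
  the coordinates \<open>0, \<dots>, n - 1\<close>. Continuity refers to the product topology on sequences, which for
  such functions amounts to continuity on \<open>\<real>\<^sup>n\<close>.\<close>

definition partial_deriv :: "nat \<Rightarrow> ((nat \<Rightarrow> real) \<Rightarrow> real) \<Rightarrow> (nat \<Rightarrow> real) \<Rightarrow> real" where
  "partial_deriv i f x = deriv (\<lambda>t. f (x(i := t))) (x i)"

primrec iter_partial_deriv ::
    "nat list \<Rightarrow> ((nat \<Rightarrow> real) \<Rightarrow> real) \<Rightarrow> (nat \<Rightarrow> real) \<Rightarrow> real" where
  "iter_partial_deriv [] f = f"
| "iter_partial_deriv (i # is) f = partial_deriv i (iter_partial_deriv is f)"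

definition Cb_infty :: "nat \<Rightarrow> ((nat \<Rightarrow> real) \<Rightarrow> real) set" where
  "Cb_infty n = {f.
     (\<forall>x y. (\<forall>i<n. x i = y i) \<longrightarrow> f x = f y) \<and>
     (\<forall>is. set is \<subseteq> {..<n} \<longrightarrow>
        continuous_on UNIV (iter_partial_deriv is f) \<and>
        bounded (range (iter_partial_deriv is f)) \<and>
        (\<forall>i<n. \<forall>x. (\<lambda>t. iter_partial_deriv is f (x(i := t))) differentiable (at (x i))))}"

definition FCb :: "('a::locally_convex_space \<Rightarrow> real) set" where
  "FCb = {u. \<exists>n f l. f \<in> Cb_infty n \<and> (\<forall>i<n. l i \<in> top_dual) \<and> u = (\<lambda>z. f (\<lambda>i. l i z))}"

definition dir_deriv :: "'a::real_vector \<Rightarrow> ('a \<Rightarrow> real) \<Rightarrow> 'a \<Rightarrow> real" where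
  "dir_deriv k u z = deriv (\<lambda>s. u (z + s *\<^sub>R k)) 0"


section \<open>Gibbs states and extremality\<close>

text \<open>Elements of \<open>L\<^sup>2(M)\<close> are represented by measurable functions; they are not identified when
  they agree almost everywhere.\<close>

definition L2 :: "'a measure \<Rightarrow> ('a \<Rightarrow> real) set" where
  "L2 M = {f \<in> borel_measurable M. integrable M (\<lambda>x. (f x)\<^sup>2)}"

definition gibbs ::
    "'a::locally_convex_space set \<Rightarrow> ('a \<Rightarrow> 'a \<Rightarrow> real) \<Rightarrow> 'a measure set" where
  "gibbs K b = {\<mu>. prob_space \<mu> \<and> sets \<mu> = sets borel \<and>
     (\<forall>k\<in>K. b k \<in> L2 \<mu>) \<and>
     (\<forall>u\<in>FCb. \<forall>k\<in>K. (\<integral>z. dir_deriv k u z \<partial>\<mu>) = - (\<integral>z. u z * b k z \<partial>\<mu>))}"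

definition gibbs_ac ::
    "'a::locally_convex_space set \<Rightarrow> ('a \<Rightarrow> 'a \<Rightarrow> real) \<Rightarrow> 'a measure \<Rightarrow> 'a measure set" where
  "gibbs_ac K b m = {\<mu> \<in> gibbs K b. absolutely_continuous m \<mu>}"

definition extremal_in :: "'a measure \<Rightarrow> 'a measure set \<Rightarrow> bool" where
  "extremal_in m C \<longleftrightarrow> m \<in> C \<and>
     (\<forall>m1\<in>C. \<forall>m2\<in>C. \<forall>t::real. 0 < t \<and> t < 1 \<and>
        (\<forall>A\<in>sets m. measure m A = t * measure m1 A + (1 - t) * measure m2 A) \<longrightarrow>
        m1 = m \<and> m2 = m)"


section \<open>Closure of a bilinear form on \<open>L\<^sup>2\<close>\<close>

text \<open>\<open>Q\<close> is a form with domain \<open>D\<close>. An approximating sequence for \<open>u\<close> is a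
  \<open>Q\<close>-Cauchy sequence in \<open>D\<close> that converges to \<open>u\<close> in \<open>L\<^sup>2(M)\<close>. If the form is
  closable, then \<open>closure_form\<close> does not depend on the choice of these sequences.\<close>

definition approx_seq ::
    "'a measure \<Rightarrow> ('a \<Rightarrow> real) set \<Rightarrow> (('a \<Rightarrow> real) \<Rightarrow> ('a \<Rightarrow> real) \<Rightarrow> real) \<Rightarrow>
     (nat \<Rightarrow> 'a \<Rightarrow> real) \<Rightarrow> ('a \<Rightarrow> real) \<Rightarrow> bool" where
  "approx_seq M D Q f u \<longleftrightarrow>
     (\<forall>n. f n \<in> D) \<and>
     (\<lambda>n. \<integral>x. (f n x - u x)\<^sup>2 \<partial>M) \<longlonglongrightarrow> 0 \<and>
     (\<forall>e>0. \<exists>N. \<forall>i\<ge>N. \<forall>j\<ge>N. Q (\<lambda>x. f i x - f j x) (\<lambda>x. f i x - f j x) < e)"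

definition closure_dom ::
    "'a measure \<Rightarrow> ('a \<Rightarrow> real) set \<Rightarrow> (('a \<Rightarrow> real) \<Rightarrow> ('a \<Rightarrow> real) \<Rightarrow> real) \<Rightarrow>
     ('a \<Rightarrow> real) set" where
  "closure_dom M D Q = {u \<in> L2 M. \<exists>f. approx_seq M D Q f u}"

definition closure_form ::
    "'a measure \<Rightarrow> ('a \<Rightarrow> real) set \<Rightarrow> (('a \<Rightarrow> real) \<Rightarrow> ('a \<Rightarrow> real) \<Rightarrow> real) \<Rightarrow>
     ('a \<Rightarrow> real) \<Rightarrow> ('a \<Rightarrow> real) \<Rightarrow> real" where
  "closure_form M D Q u v =
     (THE c. \<forall>f g. approx_seq M D Q f u \<longrightarrow> approx_seq M D Q g v \<longrightarrow>
        (\<lambda>n. Q (f n) (g n)) \<longlonglongrightarrow> c)"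


section \<open>The Dirichlet form \<open>\<E>\<^sub>m\<close>\<close>

definition pre_form ::
    "'a::locally_convex_space measure \<Rightarrow> 'a \<Rightarrow> ('a \<Rightarrow> real) \<Rightarrow> ('a \<Rightarrow> real) \<Rightarrow> real" where
  "pre_form m k u v = (\<integral>z. dir_deriv k u z * dir_deriv k v z \<partial>m)"

definition partial_dom ::
    "'a::locally_convex_space measure \<Rightarrow> 'a \<Rightarrow> ('a \<Rightarrow> real) set" where
  "partial_dom m k = closure_dom m FCb (pre_form m k)"

definition partial_form ::
    "'a::locally_convex_space measure \<Rightarrow> 'a \<Rightarrow> ('a \<Rightarrow> real) \<Rightarrow> ('a \<Rightarrow> real) \<Rightarrow> real" where
  "partial_form m k = closure_form m FCb (pre_form m k)"

definition dirichlet_dom ::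
    "'a::locally_convex_space set \<Rightarrow> 'a measure \<Rightarrow> ('a \<Rightarrow> real) set" where
  "dirichlet_dom K m =
     {u \<in> L2 m. (\<forall>k\<in>K. u \<in> partial_dom m k) \<and> (\<lambda>k. partial_form m k u u) summable_on K}"

definition dirichlet_form ::
    "'a::locally_convex_space set \<Rightarrow> 'a measure \<Rightarrow> ('a \<Rightarrow> real) \<Rightarrow> ('a \<Rightarrow> real) \<Rightarrow> real" where
  "dirichlet_form K m u v = 1 / 2 * (\<Sum>\<^sub>\<infinity>k\<in>K. partial_form m k u v)"


section \<open>Resolvents of kernels and irreducibility\<close>

text \<open>\<open>U \<alpha> x\<close> is the measure \<open>U\<^sub>\<alpha>(x, \<cdot>)\<close>. By sub-Markovianity these measures are
  finite, so that the resolvent equation can be stated with real-valued integrals.\<close>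

definition submarkov_resolvent :: "'a measure \<Rightarrow> (real \<Rightarrow> 'a \<Rightarrow> 'a measure) \<Rightarrow> bool" where
  "submarkov_resolvent M U \<longleftrightarrow>
     (\<forall>\<alpha>>0. \<forall>x\<in>space M. sets (U \<alpha> x) = sets M) \<and>
     (\<forall>\<alpha>>0. \<forall>A\<in>sets M. (\<lambda>x. emeasure (U \<alpha> x) A) \<in> borel_measurable M) \<and>
     (\<forall>\<alpha>>0. \<forall>x\<in>space M. ennreal \<alpha> * emeasure (U \<alpha> x) (space M) \<le> 1) \<and>
     (\<forall>\<alpha>>0. \<forall>\<beta>>0. \<forall>x\<in>space M. \<forall>A\<in>sets M.
        measure (U \<alpha> x) A - measure (U \<beta> x) A =
          (\<beta> - \<alpha>) * (\<integral>y. measure (U \<beta> y) A \<partial>U \<alpha> x))"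

text \<open>\<open>G\<close> is the strongly continuous resolvent on \<open>L\<^sup>2(M)\<close> associated with the
  form \<open>Q\<close> with domain \<open>D\<close>: \<open>G\<^sub>\<alpha>f \<in> D\<close> and
  \<open>Q(G\<^sub>\<alpha>f, v) + \<alpha>(G\<^sub>\<alpha>f, v) = (f, v)\<close> for \<open>v \<in> D\<close>, which determines \<open>G\<^sub>\<alpha>f\<close> up to
  null sets.\<close>

definition L2_resolvent_of_form ::
    "'a measure \<Rightarrow> ('a \<Rightarrow> real) set \<Rightarrow> (('a \<Rightarrow> real) \<Rightarrow> ('a \<Rightarrow> real) \<Rightarrow> real) \<Rightarrow>
     (real \<Rightarrow> ('a \<Rightarrow> real) \<Rightarrow> 'a \<Rightarrow> real) \<Rightarrow> bool" where
  "L2_resolvent_of_form M D Q G \<longleftrightarrow>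
     (\<forall>\<alpha>>0. \<forall>f\<in>L2 M. G \<alpha> f \<in> D \<and>
        (\<forall>v\<in>D. Q (G \<alpha> f) v + \<alpha> * (\<integral>x. G \<alpha> f x * v x \<partial>M) = (\<integral>x. f x * v x \<partial>M))) \<and>
     (\<forall>f\<in>L2 M. ((\<lambda>\<alpha>. \<integral>x. (\<alpha> * G \<alpha> f x - f x)\<^sup>2 \<partial>M) \<longlongrightarrow> 0) at_top)"

definition realizes_dirichlet_resolvent ::
    "'a::locally_convex_space set \<Rightarrow> 'a measure \<Rightarrow> (real \<Rightarrow> 'a \<Rightarrow> 'a measure) \<Rightarrow> bool" where
  "realizes_dirichlet_resolvent K m U \<longleftrightarrow>
     submarkov_resolvent borel U \<and>
     L2_resolvent_of_form m (dirichlet_dom K m) (dirichlet_form K m)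
       (\<lambda>\<alpha> f x. \<integral>y. f y \<partial>U \<alpha> x)"

definition potential_kernel :: "(real \<Rightarrow> 'a \<Rightarrow> 'a measure) \<Rightarrow> 'a \<Rightarrow> 'a set \<Rightarrow> ennreal" where
  "potential_kernel U x A = (SUP \<alpha>\<in>{0<..}. emeasure (U \<alpha> x) A)"

text \<open>Irreducibility of a form, expressed through a resolvent of kernels \<open>U\<close> realizing its
  \<open>L\<^sup>2(m)\<close>-resolvent; it does not depend on the choice of the realization.\<close>

definition irreducible_resolvent :: "'a measure \<Rightarrow> (real \<Rightarrow> 'a \<Rightarrow> 'a measure) \<Rightarrow> bool" where
  "irreducible_resolvent m U \<longleftrightarrow>
     (\<forall>A\<in>sets m. (AE x in m. x \<in> A \<longrightarrow> potential_kernel U x (space m - A) = 0) \<longrightarrow>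
        emeasure m A = 0 \<or> emeasure m (space m - A) = 0)"

end

theory Submission
  imports Defs "HOL-Real_Asymp.Real_Asymp"
begin

text \<open>If \<open>\<mu> = \<rho> m\<close> is another Gibbs state, then the signed measure \<open>\<nu> = (\<rho> - c) m\<close> satisfies
  \<open>\<partial>\<^sub>k \<nu> = b\<^sub>k \<nu>\<close>. This property passes to positive parts and hence to \<open>1\<^sub>A m\<close> with \<open>A = {\<rho> > c}\<close>. Shifting
  \<open>1\<^sub>A m\<close> by \<open>t k\<close> moves only mass \<open>o(t\<^sup>2)\<close> into the complement of \<open>A\<close>, because the derivative of this
  mass \<open>\<phi>(t)\<close> is at most \<open>\<phi>(t)\<^sup>1\<^sup>/\<^sup>2\<close> times a small constant (here \<open>b\<^sub>k \<in> L\<^sup>2\<close> is used). Therefore the averages of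
  \<open>1\<^sub>A\<close> along segments of direction \<open>k\<close> approximate \<open>1\<^sub>A\<close> with energy tending to \<open>0\<close>, so \<open>1\<^sub>A\<close> lies in
  the domain of the minimal form and has energy \<open>0\<close>. Indicators of energy \<open>0\<close> correspond, on the one hand, to the
  sets that are invariant under the resolvent and, on the other hand, to the decompositions of \<open>m\<close>
  into normalized restrictions that are again Gibbs states.

  Everything happens on the \<open>\<sigma>\<close>-algebra generated by \<open>E'\<close>, which is sufficient because the strong continuity of
  the resolvent makes \<open>\<F>C\<^sub>b\<^sup>\<infinity>\<close> dense in \<open>L\<^sup>2(m)\<close>; no Hahn--Banach argument is needed.\<close>

section \<open>Calculus of smooth cylinder functions\<close>

text \<open>The form is a closure, so energy 0 of 1_A asks for strong approximation by cylinder
  functions, whereas the Gibbs property is a weak identity. The derivative of a segment average is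
  the difference quotient of 1_A, whose squared norm is t^-2 times the mass that crosses the
  boundary of A. The rate O(t), which integration by parts yields at once, is therefore too weak,
  and o(t^2) is exactly what is required. It comes from a self-improvement: the flux at time t is an
  integral of b_k over the very set whose mass is being estimated, and b_k^2 has small integral over
  that set because translations are continuous in the mean.

  An indicator cannot be differentiated, and a shift acts on functions rather than on classes modulo
  null sets. Identities are therefore proved for trigonometric cylinder functions, a class
  containing its own shifts, products and segment averages, and are carried to indicators by bounded
  pointwise limits of functions that are defined everywhere.\<close>

lemma Cb_inftyD:
  assumes "f \<in> Cb_infty n" "set is \<subseteq> {..<n}"
  shows "continuous_on UNIV (iter_partial_deriv is f)"
    and "bounded (range (iter_partial_deriv is f))"
    and "\<And>i x. i < n \<Longrightarrow> (\<lambda>t. iter_partial_deriv is f (x(i := t))) differentiable (at (x i))"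
  using assms unfolding Cb_infty_def by blast+

lemma Cb_infty_continuous: "f \<in> Cb_infty n \<Longrightarrow> continuous_on UNIV f"
  using Cb_inftyD(1)[of f n "[]"] by simp

lemma Cb_infty_bounded: "f \<in> Cb_infty n \<Longrightarrow> bounded (range f)"
  using Cb_inftyD(2)[of f n "[]"] by simp

lemma Cb_infty_cong_coords: "f \<in> Cb_infty n \<Longrightarrow> (\<And>i. i < n \<Longrightarrow> x i = y i) \<Longrightarrow> f x = f y"
  unfolding Cb_infty_def by blast

text \<open>The head of the list acts last, so a derivative of \<open>f\<close> itself enters at the
  end of the list.\<close>

lemma iter_partial_deriv_snoc:
  "iter_partial_deriv (is @ [i]) f = iter_partial_deriv is (partial_deriv i f)"
  by (induction "is") auto

lemma partial_deriv_cong_coords: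
  assumes "\<And>x y. (\<And>i. i < n \<Longrightarrow> x i = y i) \<Longrightarrow> f x = f y" "i < n"
    and "\<And>i. i < n \<Longrightarrow> x i = y i"
  shows "partial_deriv i f x = partial_deriv i f y"
proof -
  have "(\<lambda>t. f (x(i := t))) = (\<lambda>t. f (y(i := t)))"
    by (intro ext assms(1)) (simp add: assms(3))
  then show ?thesis
    unfolding partial_deriv_def using assms(2,3) by simp
qed

lemma Cb_infty_partial_deriv:
  assumes "f \<in> Cb_infty n" "i < n"
  shows "partial_deriv i f \<in> Cb_infty n"
proof -
  have "iter_partial_deriv is (partial_deriv i f) = iter_partial_deriv (is @ [i]) f" for "is"
    by (simp add: iter_partial_deriv_snoc)
  moreover have "partial_deriv i f x = partial_deriv i f y" if "\<forall>i<n. x i = y i" for x y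
    using assms that by (intro partial_deriv_cong_coords[where n = n]) (auto intro: Cb_infty_cong_coords)
  moreover have "set (is @ [i]) \<subseteq> {..<n}" if "set is \<subseteq> {..<n}" for "is"
    using that assms(2) by auto
  ultimately show ?thesis
    using assms unfolding Cb_infty_def by fastforce
qed

lemma Cb_infty_has_partial_deriv:
  assumes "f \<in> Cb_infty n" "i < n"
  shows "((\<lambda>t. f (x(i := t))) has_real_derivative partial_deriv i f (x(i := s))) (at s)"
proof -
  have "(\<lambda>t. f (x(i := t))) differentiable (at s)"
    using Cb_inftyD(3)[OF assms(1), of "[]" i "x(i := s)"] assms(2) by simp
  then have "((\<lambda>t. f (x(i := t))) has_real_derivative deriv (\<lambda>t. f (x(i := t))) s) (at s)"
    using DERIV_deriv_iff_real_differentiable by blast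
  then show ?thesis
    unfolding partial_deriv_def by simp
qed

lemma partial_deriv_eqI:
  assumes "((\<lambda>t. f (x(i := t))) has_real_derivative D) (at (x i))"
  shows "partial_deriv i f x = D"
  unfolding partial_deriv_def using assms by (rule DERIV_imp_deriv)

text \<open>Coinduction: a class of bounded continuous functions that contains the partial
  derivatives of its members contains all iterated ones. Smoothness is then shown by exhibiting such
  a class, without a formula for higher derivatives.\<close>

lemma Cb_infty_coinduct:
  assumes X: "f \<in> X"
    and cont: "\<And>f. f \<in> X \<Longrightarrow> continuous_on UNIV f"
    and bdd: "\<And>f. f \<in> X \<Longrightarrow> bounded (range f)"
    and coords: "\<And>f x y. f \<in> X \<Longrightarrow> (\<And>i. i < n \<Longrightarrow> x i = y i) \<Longrightarrow> f x = f y"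
    and deriv: "\<And>f i. f \<in> X \<Longrightarrow> i < n \<Longrightarrow>
      \<exists>g\<in>X. \<forall>x. ((\<lambda>t. f (x(i := t))) has_real_derivative g x) (at (x i))"
  shows "f \<in> Cb_infty n"
proof -
  have iter: "iter_partial_deriv is f \<in> X" if "set is \<subseteq> {..<n}" for "is"
    using that
  proof (induction "is")
    case (Cons i "is")
    then obtain g where g: "g \<in> X"
      "\<forall>x. ((\<lambda>t. iter_partial_deriv is f (x(i := t))) has_real_derivative g x) (at (x i))"
      using deriv[of "iter_partial_deriv is f" i] by auto
    then have "partial_deriv i (iter_partial_deriv is f) = g"
      by (intro ext partial_deriv_eqI) auto
    with g show ?case by simp
  qed (use X in simp)
  have "(\<lambda>t. iter_partial_deriv is f (x(i := t))) differentiable (at (x i))"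
    if "set is \<subseteq> {..<n}" "i < n" for "is" i x
    using deriv[OF iter[OF that(1)] that(2)] real_differentiable_def by blast
  then show ?thesis
    using cont[OF iter] bdd[OF iter] coords[OF X] unfolding Cb_infty_def by blast
qed

text \<open>The product rule turns a product into a sum of products, so sums and products must be
  adjoined together before the class is closed under partial derivatives.\<close>

inductive_set Cb_alg :: "nat \<Rightarrow> ((nat \<Rightarrow> real) \<Rightarrow> real) set" for n where
  base: "f \<in> Cb_infty n \<Longrightarrow> f \<in> Cb_alg n"
| const: "(\<lambda>_. c) \<in> Cb_alg n"
| add: "f \<in> Cb_alg n \<Longrightarrow> g \<in> Cb_alg n \<Longrightarrow> (\<lambda>x. f x + g x) \<in> Cb_alg n"
| mult: "f \<in> Cb_alg n \<Longrightarrow> g \<in> Cb_alg n \<Longrightarrow> (\<lambda>x. f x * g x) \<in> Cb_alg n"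

lemma Cb_alg_subset: "Cb_alg n \<subseteq> Cb_infty n"
proof
  fix f assume "f \<in> Cb_alg n"
  then show "f \<in> Cb_infty n"
  proof (rule Cb_infty_coinduct[where X = "Cb_alg n"])
    fix f assume "f \<in> Cb_alg n"
    then show "continuous_on UNIV f"
      by induction (auto intro: Cb_infty_continuous continuous_intros)
  next
    fix f assume "f \<in> Cb_alg n"
    then show "bounded (range f)"
    proof induction
      case (mult f g)
      then obtain a b where "\<And>x. \<bar>f x\<bar> \<le> a" "\<And>x. \<bar>g x\<bar> \<le> b"
        by (auto simp: bounded_iff)
      then have "\<bar>f x * g x\<bar> \<le> a * b" for x
        unfolding abs_mult by (intro mult_mono) (auto intro: order_trans[OF abs_ge_zero])
      then show ?case by (auto simp: bounded_iff)
    qed (auto intro: Cb_infty_bounded bounded_plus_comp)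
  next
    fix f and x y :: "nat \<Rightarrow> real"
    assume "f \<in> Cb_alg n" "\<And>i. i < n \<Longrightarrow> x i = y i"
    then show "f x = f y"
    proof induction
      case (base f)
      then show ?case using Cb_infty_cong_coords by blast
    qed auto
  next
    fix f i assume "f \<in> Cb_alg n" and i: "i < n"
    then show "\<exists>g\<in>Cb_alg n. \<forall>x. ((\<lambda>t. f (x(i := t))) has_real_derivative g x) (at (x i))"
    proof induction
      case (base f)
      then show ?case
        using Cb_infty_has_partial_deriv[OF base(1) i, of x "x i" for x] Cb_infty_partial_deriv[OF base(1) i]
        by (intro bexI[of _ "partial_deriv i f"]) (simp_all add: Cb_alg.base del: fun_upd_apply)
    next
      case (const c)
      then show ?case by (intro bexI[of _ "\<lambda>_. 0"]) (auto intro: Cb_alg.const)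
    next
      case (add f g)
      then obtain f' g' where fg: "f' \<in> Cb_alg n" "g' \<in> Cb_alg n"
        "\<And>x. ((\<lambda>t. f (x(i := t))) has_real_derivative f' x) (at (x i))"
        "\<And>x. ((\<lambda>t. g (x(i := t))) has_real_derivative g' x) (at (x i))"
        by (auto simp del: fun_upd_apply)
      then show ?case
        by (intro bexI[of _ "\<lambda>x. f' x + g' x"] allI DERIV_add Cb_alg.add) (auto simp del: fun_upd_apply)
    next
      case (mult f g)
      then obtain f' g' where fg: "f' \<in> Cb_alg n" "g' \<in> Cb_alg n"
        "\<And>x. ((\<lambda>t. f (x(i := t))) has_real_derivative f' x) (at (x i))"
        "\<And>x. ((\<lambda>t. g (x(i := t))) has_real_derivative g' x) (at (x i))"
        by (auto simp del: fun_upd_apply)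
      have "((\<lambda>t. f (x(i := t)) * g (x(i := t))) has_real_derivative f' x * g x + g' x * f x) (at (x i))" for x
        using DERIV_mult[OF fg(3)[of x] fg(4)[of x]] by simp
      then show ?case
        using fg mult
        by (intro bexI[of _ "\<lambda>x. f' x * g x + g' x * f x"] Cb_alg.add Cb_alg.mult) (auto simp del: fun_upd_apply)
    qed
  qed
qed

lemma Cb_infty_const: "(\<lambda>_. c) \<in> Cb_infty n"
  using Cb_alg_subset Cb_alg.const by blast

lemma Cb_infty_add: "f \<in> Cb_infty n \<Longrightarrow> g \<in> Cb_infty n \<Longrightarrow> (\<lambda>x. f x + g x) \<in> Cb_infty n"
  by (rule subsetD[OF Cb_alg_subset], intro Cb_alg.add Cb_alg.base)

lemma Cb_infty_mult: "f \<in> Cb_infty n \<Longrightarrow> g \<in> Cb_infty n \<Longrightarrow> (\<lambda>x. f x * g x) \<in> Cb_infty n"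
  by (rule subsetD[OF Cb_alg_subset], intro Cb_alg.mult Cb_alg.base)

lemma Cb_infty_sum:
  "finite I \<Longrightarrow> (\<And>i. i \<in> I \<Longrightarrow> f i \<in> Cb_infty n) \<Longrightarrow> (\<lambda>x. \<Sum>i\<in>I. f i x) \<in> Cb_infty n"
  by (induction rule: finite_induct) (auto intro: Cb_infty_const Cb_infty_add)

text \<open>Renaming variables lets two cylinder functions be written over one common list of
  functionals.\<close>

lemma Cb_infty_reindex:
  assumes f: "f \<in> Cb_infty n" and inj: "inj \<sigma>" and \<sigma>: "\<And>i. i < n \<Longrightarrow> \<sigma> i < N"
  shows "(\<lambda>x. f (\<lambda>i. x (\<sigma> i))) \<in> Cb_infty N"
proof -
  \<comment> \<open>The zero function is the derivative in a coordinate that \<open>\<sigma>\<close>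
    does not hit from below \<open>n\<close>.\<close>
  define X where "X = insert (\<lambda>_. 0) ((\<lambda>f x. f (\<lambda>i. x (\<sigma> i))) ` Cb_infty n)"
  have cont: "continuous_on UNIV (\<lambda>x::nat \<Rightarrow> real. (\<lambda>i. x (\<sigma> i)))"
    by (intro continuous_on_coordinatewise_then_product continuous_on_product_coordinates)
  show ?thesis
  proof (rule Cb_infty_coinduct[where X = X])
    show "(\<lambda>x. f (\<lambda>i. x (\<sigma> i))) \<in> X"
      using f by (auto simp: X_def)
  next
    fix h assume "h \<in> X"
    then show "continuous_on UNIV h"
      using continuous_on_compose2[OF Cb_infty_continuous cont] by (auto simp: X_def)
  next
    fix h assume "h \<in> X"
    then show "bounded (range h)"
      by (auto simp: X_def intro: bounded_subset[OF Cb_infty_bounded])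
  next
    fix h and x y :: "nat \<Rightarrow> real" assume "h \<in> X" "\<And>i. i < N \<Longrightarrow> x i = y i"
    then show "h x = h y"
      using \<sigma> by (auto simp: X_def intro: Cb_infty_cong_coords)
  next
    fix h j assume h: "h \<in> X" and "j < N"
    consider "h = (\<lambda>_. 0)" | g where "g \<in> Cb_infty n" "h = (\<lambda>x. g (\<lambda>i. x (\<sigma> i)))"
      using h unfolding X_def by auto
    then show "\<exists>g\<in>X. \<forall>x. ((\<lambda>t. h (x(j := t))) has_real_derivative g x) (at (x j))"
    proof cases
      case 1
      then show ?thesis by (auto simp: X_def intro!: bexI[of _ "\<lambda>_. 0"])
    next
      case (2 g)
      show ?thesis
      proof (cases "\<exists>i<n. j = \<sigma> i")
        case True
        then obtain i where i: "i < n" "j = \<sigma> i" by blast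
        \<comment> \<open>Injectivity: changing coordinate \<open>\<sigma> i\<close> changes the
          \<open>i\<close>-th argument only.\<close>
        have eq: "(\<lambda>l. (x(j := t)) (\<sigma> l)) = (\<lambda>l. x (\<sigma> l))(i := t)" for x :: "nat \<Rightarrow> real" and t
          using i inj by (auto simp: fun_eq_iff inj_eq)
        have "((\<lambda>t. h (x(j := t))) has_real_derivative partial_deriv i g (\<lambda>l. x (\<sigma> l))) (at (x j))" for x
          using Cb_infty_has_partial_deriv[OF 2(1) i(1), of "\<lambda>l. x (\<sigma> l)" "x j"]
          unfolding 2(2) eq by (simp add: i fun_upd_idem)
        moreover have "(\<lambda>x. partial_deriv i g (\<lambda>l. x (\<sigma> l))) \<in> X"
          using Cb_infty_partial_deriv[OF 2(1) i(1)] by (auto simp: X_def)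
        ultimately show ?thesis
          by (intro bexI[of _ "\<lambda>x. partial_deriv i g (\<lambda>l. x (\<sigma> l))"]) auto
      next
        case False
        have "h (x(j := t)) = h x" for x t
          unfolding 2(2) using False by (intro Cb_infty_cong_coords[OF 2(1)]) auto
        then show ?thesis by (auto simp: X_def intro!: bexI[of _ "\<lambda>_. 0"])
      qed
    qed
  qed
qed

text \<open>Chain rule by induction on the number \<open>j\<close> of moved coordinates. A function
  of two variables is differentiable if one partial derivative exists at the point and the other is
  continuous there, so the newly moved coordinate is split off as the second variable.\<close>

lemma Cb_infty_line_deriv_0:
  assumes f: "f \<in> Cb_infty n"
  shows "j \<le> n \<Longrightarrow> ((\<lambda>s. f (\<lambda>i. p i + s * (if i < j then q i else 0))) has_real_derivative
    (\<Sum>i<j. q i * partial_deriv i f p)) (at 0)"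
proof (induction j)
  case (Suc j)
  \<comment> \<open>\<open>P s t\<close> moves the coordinates below \<open>j\<close> by
    \<open>s\<close> and coordinate \<open>j\<close> by \<open>t\<close>; on the diagonal the first
    \<open>Suc j\<close> coordinates move.\<close>
  define P where "P s t = (\<lambda>i. p i + s * (if i < j then q i else 0) + (if i = j then t * q j else 0))"
    for s t
  define D where "D = (\<Sum>i<j. q i * partial_deriv i f p)"
  define G where "G s t = (q j * partial_deriv j f (P s t)) *\<^sub>R (id_blinfun :: real \<Rightarrow>\<^sub>L real)" for s t
  have jn: "j < n" using Suc by simp
  have P0: "P s 0 = (\<lambda>i. p i + s * (if i < j then q i else 0))" for s
    by (auto simp: P_def)
  have P00: "P 0 0 = p" by (auto simp: P_def)
  have fx: "((\<lambda>s. f (P s 0)) has_derivative (\<lambda>h. D * h)) (at 0)"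
    using Suc unfolding P0 D_def has_field_derivative_def by simp
  have fy: "((\<lambda>t. f (P s t)) has_derivative blinfun_apply (G s t)) (at t)" for s t
  proof -
    have eq: "P s t = (P s 0)(j := p j + t * q j)" for t
      by (auto simp: P_def)
    have "((\<lambda>t. f ((P s 0)(j := p j + t * q j))) has_real_derivative
        partial_deriv j f ((P s 0)(j := p j + t * q j)) * q j) (at t)"
      by (rule DERIV_chain2[OF Cb_infty_has_partial_deriv[OF f jn]])
         (auto intro!: derivative_eq_intros)
    then show ?thesis
      unfolding has_field_derivative_def G_def blinfun.scaleR_left id_blinfun.rep_eq
      by (subst (1 2) eq) (simp add: mult.commute real_scaleR_def[abs_def])
  qed
  have Pcont: "continuous_on UNIV (\<lambda>z. P (fst z) (snd z))"
    unfolding P_def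
  proof (intro continuous_on_coordinatewise_then_product continuous_on_add)
    show "continuous_on UNIV (\<lambda>x::real \<times> real. if i = j then snd x * q j else 0)" for i
      by (cases "i = j") (auto intro!: continuous_intros)
  qed (auto intro!: continuous_intros)
  have "continuous_on UNIV (\<lambda>z. partial_deriv j f (P (fst z) (snd z)))"
    by (rule continuous_on_compose2[OF Cb_infty_continuous[OF Cb_infty_partial_deriv[OF f jn]] Pcont]) auto
  then have "continuous (at (0, 0)) (\<lambda>(s, t). G s t)"
    unfolding G_def case_prod_beta
    by (intro continuous_intros) (simp add: continuous_on_eq_continuous_at)
  then have "((\<lambda>(s, t). f (P s t)) has_derivative (\<lambda>(a, c). D * a + G 0 0 c)) (at (0, 0) within UNIV \<times> UNIV)"
    using fx fy by (intro has_derivative_partialsI) auto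
  then have "((\<lambda>(s, t). f (P s t)) has_derivative (\<lambda>(a, c). D * a + G 0 0 c)) (at ((\<lambda>s. (s, s)) 0))"
    by simp
  moreover have "((\<lambda>s::real. (s, s)) has_derivative (\<lambda>s. (s, s))) (at 0)"
    by (auto intro!: derivative_eq_intros)
  ultimately have "((\<lambda>s. f (P s s)) has_derivative (\<lambda>a. D * a + G 0 0 a)) (at 0)"
    using diff_chain_at[of "\<lambda>s::real. (s, s)" "\<lambda>s. (s, s)" 0 "\<lambda>(s, t). f (P s t)"
        "\<lambda>(a, c). D * a + G 0 0 c"] by (simp add: o_def)
  moreover have "(\<lambda>i. p i + s * (if i < Suc j then q i else 0)) = P s s" for s
    by (auto simp: P_def less_Suc_eq)
  moreover have "(\<lambda>a. D * a + G 0 0 a) = (*) (\<Sum>i<Suc j. q i * partial_deriv i f p)"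
    by (auto simp: G_def P00 D_def blinfun.scaleR_left algebra_simps)
  ultimately show ?case
    unfolding has_field_derivative_def by simp
qed simp

lemma Cb_infty_line_deriv:
  assumes f: "f \<in> Cb_infty n"
  shows "((\<lambda>s. f (\<lambda>i. p i + s * q i)) has_real_derivative
    (\<Sum>i<n. q i * partial_deriv i f (\<lambda>i. p i + s * q i))) (at s)"
proof -
  \<comment> \<open>Moving the base point to time \<open>s\<close> leaves a derivative at 0.\<close>
  define p' where "p' = (\<lambda>i. p i + s * q i)"
  have "f (\<lambda>i. p' i + r * (if i < n then q i else 0)) = f (\<lambda>i. p i + (r + s) * q i)" for r
    by (rule Cb_infty_cong_coords[OF f]) (simp add: p'_def algebra_simps)
  then have "((\<lambda>r. f (\<lambda>i. p i + (r + s) * q i)) has_real_derivative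
      (\<Sum>i<n. q i * partial_deriv i f p')) (at 0)"
    using Cb_infty_line_deriv_0[OF f, of n p' q] by simp
  then show ?thesis
    using DERIV_shift[of "\<lambda>r. f (\<lambda>i. p i + r * q i)" _ 0 s] unfolding p'_def by simp
qed

section \<open>Cylinder functions and their directional derivatives\<close>

lemma top_dual_zero: "(\<lambda>_. 0) \<in> top_dual"
  by (simp add: top_dual_def linear_iff)

lemma top_dual_add: "l \<in> top_dual \<Longrightarrow> l' \<in> top_dual \<Longrightarrow> (\<lambda>z. l z + l' z) \<in> top_dual"
  by (auto simp: top_dual_def intro: continuous_intros linear_compose_add)

lemma top_dual_scale: "l \<in> top_dual \<Longrightarrow> (\<lambda>z. c * l z) \<in> top_dual"
  by (auto simp: top_dual_def linear_iff algebra_simps intro!: continuous_intros)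

lemma top_dual_line: "l \<in> top_dual \<Longrightarrow> l (z + s *\<^sub>R k) = l z + s * l k"
  by (simp add: top_dual_def linear_iff)

lemma top_dual_measurable: "l \<in> top_dual \<Longrightarrow> l \<in> borel_measurable borel"
  by (simp add: top_dual_def borel_measurable_continuous_onI)

lemma FCbI: "f \<in> Cb_infty n \<Longrightarrow> (\<And>i. i < n \<Longrightarrow> l i \<in> top_dual) \<Longrightarrow> (\<lambda>z. f (\<lambda>i. l i z)) \<in> FCb"
  unfolding FCb_def by blast

lemma FCb_const: "(\<lambda>_. c) \<in> FCb"
  using FCbI[OF Cb_infty_const[of c 0]] by simp

lemma FCb_common:
  assumes "u \<in> FCb" "v \<in> FCb"
  obtains n f g l where "f \<in> Cb_infty n" "g \<in> Cb_infty n" "\<And>i. l i \<in> top_dual"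
    "u = (\<lambda>z. f (\<lambda>i. l i z))" "v = (\<lambda>z. g (\<lambda>i. l i z))"
proof -
  from assms obtain n1 f1 l1 n2 f2 l2 where
    1: "f1 \<in> Cb_infty n1" "\<forall>i<n1. l1 i \<in> top_dual" "u = (\<lambda>z. f1 (\<lambda>i. l1 i z))" and
    2: "f2 \<in> Cb_infty n2" "\<forall>i<n2. l2 i \<in> top_dual" "v = (\<lambda>z. f2 (\<lambda>i. l2 i z))"
    unfolding FCb_def by blast
  \<comment> \<open>The functionals of \<open>v\<close> follow those of \<open>u\<close>; the zero
    functional fills the remaining places, so that every \<open>l i\<close> is in the dual.\<close>
  define l where "l i = (if i < n1 then l1 i else if i < n1 + n2 then l2 (i - n1) else (\<lambda>_. 0))" for i
  show thesis
  proof
    show "(\<lambda>x. f1 (\<lambda>i. x i)) \<in> Cb_infty (n1 + n2)"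
      using Cb_infty_reindex[OF 1(1), of "\<lambda>i. i" "n1 + n2"] by auto
    show "(\<lambda>x. f2 (\<lambda>i. x (i + n1))) \<in> Cb_infty (n1 + n2)"
      using Cb_infty_reindex[OF 2(1), of "\<lambda>i. i + n1" "n1 + n2"] by auto
    show "l i \<in> top_dual" for i
      using 1 2 by (auto simp: l_def top_dual_zero)
    show "u = (\<lambda>z. f1 (\<lambda>i. l i z))"
      unfolding 1(3) by (intro ext Cb_infty_cong_coords[OF 1(1)]) (simp add: l_def)
    show "v = (\<lambda>z. f2 (\<lambda>i. l (i + n1) z))"
      unfolding 2(3) by (intro ext Cb_infty_cong_coords[OF 2(1)]) (simp add: l_def)
  qed
qed

lemma FCb_repr:
  assumes "u \<in> FCb"
  obtains n f l where "f \<in> Cb_infty n" "\<And>i. l i \<in> top_dual" "u = (\<lambda>z. f (\<lambda>i. l i z))"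
  using FCb_common[OF assms assms] by metis

lemma FCb_add: "u \<in> FCb \<Longrightarrow> v \<in> FCb \<Longrightarrow> (\<lambda>z. u z + v z) \<in> FCb"
  by (erule (1) FCb_common) (auto intro: FCbI[OF Cb_infty_add])

lemma FCb_mult: "u \<in> FCb \<Longrightarrow> v \<in> FCb \<Longrightarrow> (\<lambda>z. u z * v z) \<in> FCb"
  by (erule (1) FCb_common) (auto intro: FCbI[OF Cb_infty_mult])

lemma FCb_scale: "u \<in> FCb \<Longrightarrow> (\<lambda>z. c * u z) \<in> FCb"
  by (intro FCb_mult FCb_const)

lemma FCb_diff: "u \<in> FCb \<Longrightarrow> v \<in> FCb \<Longrightarrow> (\<lambda>z. u z - v z) \<in> FCb"
  using FCb_add[of u "\<lambda>z. (-1) * v z"] FCb_scale[of v "-1"] by simp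

lemma FCb_bounded:
  assumes "u \<in> FCb" obtains C where "\<And>z. \<bar>u z\<bar> \<le> C"
proof -
  from assms obtain n f l where f: "f \<in> Cb_infty n" "u = (\<lambda>z. f (\<lambda>i. l i z))"
    by (rule FCb_repr)
  then show ?thesis
    using Cb_infty_bounded[OF f(1)] that by (auto simp: bounded_iff)
qed

text \<open>The chain rule gives the sum of \<open>l i k\<close> times the partial derivatives,
  again a cylinder function of the same functionals. The derivative is stated at every point of the
  line, as the fundamental theorem of calculus requires.\<close>

lemma
  assumes "u \<in> FCb"
  shows FCb_dir_deriv: "dir_deriv k u \<in> FCb"
    and FCb_DERIV: "\<And>z s. ((\<lambda>s. u (z + s *\<^sub>R k)) has_real_derivative dir_deriv k u (z + s *\<^sub>R k)) (at s)"
proof -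
  from assms obtain n f l where f: "f \<in> Cb_infty n" and l: "\<And>i. l i \<in> top_dual"
    and u: "u = (\<lambda>z. f (\<lambda>i. l i z))"
    by (rule FCb_repr) blast
  define g where "g x = (\<Sum>i<n. l i k * partial_deriv i f x)" for x
  have g: "g \<in> Cb_infty n"
    unfolding g_def by (intro Cb_infty_sum Cb_infty_mult Cb_infty_const Cb_infty_partial_deriv[OF f]) auto
  have *: "((\<lambda>s. u (z + s *\<^sub>R k)) has_real_derivative g (\<lambda>i. l i (z + s *\<^sub>R k))) (at s)" for z s
    using Cb_infty_line_deriv[OF f, of "\<lambda>i. l i z" "\<lambda>i. l i k" s]
    unfolding u g_def by (simp add: top_dual_line[OF l])
  have dd: "dir_deriv k u = (\<lambda>z. g (\<lambda>i. l i z))"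
    unfolding dir_deriv_def using DERIV_imp_deriv[OF *[of _ 0]] by simp
  show "dir_deriv k u \<in> FCb"
    unfolding dd using g l by (rule FCbI)
  show "((\<lambda>s. u (z + s *\<^sub>R k)) has_real_derivative dir_deriv k u (z + s *\<^sub>R k)) (at s)" for z s
    unfolding dd by (rule *)
qed

lemma FCb_DERIV_0:
  "u \<in> FCb \<Longrightarrow> ((\<lambda>s. u (z + s *\<^sub>R k)) has_real_derivative dir_deriv k u z) (at 0)"
  using FCb_DERIV[of u z k 0] by simp

lemma dir_deriv_eqI: "((\<lambda>s. u (z + s *\<^sub>R k)) has_real_derivative D) (at 0) \<Longrightarrow> dir_deriv k u z = D"
  unfolding dir_deriv_def by (rule DERIV_imp_deriv)

lemma dir_deriv_add:
  "u \<in> FCb \<Longrightarrow> v \<in> FCb \<Longrightarrow> dir_deriv k (\<lambda>z. u z + v z) = (\<lambda>z. dir_deriv k u z + dir_deriv k v z)"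
  by (intro ext dir_deriv_eqI derivative_intros FCb_DERIV_0)

lemma dir_deriv_diff:
  "u \<in> FCb \<Longrightarrow> v \<in> FCb \<Longrightarrow> dir_deriv k (\<lambda>z. u z - v z) = (\<lambda>z. dir_deriv k u z - dir_deriv k v z)"
  by (intro ext dir_deriv_eqI derivative_intros FCb_DERIV_0)

lemma dir_deriv_scale: "u \<in> FCb \<Longrightarrow> dir_deriv k (\<lambda>z. c * u z) = (\<lambda>z. c * dir_deriv k u z)"
  by (intro ext dir_deriv_eqI DERIV_cmult FCb_DERIV_0)

lemma dir_deriv_const: "dir_deriv k (\<lambda>_. c) = (\<lambda>_. 0)"
  by (intro ext dir_deriv_eqI) simp

lemma dir_deriv_mult:
  assumes "u \<in> FCb" "v \<in> FCb"
  shows "dir_deriv k (\<lambda>z. u z * v z) = (\<lambda>z. dir_deriv k u z * v z + dir_deriv k v z * u z)"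
proof (intro ext dir_deriv_eqI)
  fix z
  show "((\<lambda>s. u (z + s *\<^sub>R k) * v (z + s *\<^sub>R k)) has_real_derivative
      dir_deriv k u z * v z + dir_deriv k v z * u z) (at 0)"
    using DERIV_mult[OF FCb_DERIV_0[OF assms(1), of z k] FCb_DERIV_0[OF assms(2), of z k]] by simp
qed

section \<open>Trigonometric cylinder functions and bounded limits\<close>

text \<open>Real trigonometric polynomials. Along \<open>k\<close> each term is constant or has an
  explicit antiderivative of the same type, so segment averages stay in the class without
  differentiation under an integral. The functional 0 provides the constants.\<close>

inductive_set trig :: "('a::locally_convex_space \<Rightarrow> real) set" where
  base: "l \<in> top_dual \<Longrightarrow> (\<lambda>z. a * cos (l z) + b * sin (l z)) \<in> trig"
| add: "u \<in> trig \<Longrightarrow> v \<in> trig \<Longrightarrow> (\<lambda>z. u z + v z) \<in> trig"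

lemma Cb_infty_trig: "(\<lambda>x. a * cos (x 0) + b * sin (x 0)) \<in> Cb_infty (Suc 0)"
proof -
  define X where "X = {\<lambda>x::nat \<Rightarrow> real. a * cos (x 0) + b * sin (x 0) | a b. True}"
  show ?thesis
  proof (rule Cb_infty_coinduct[where X = X])
    fix f assume "f \<in> X"
    then obtain a b where f: "f = (\<lambda>x. a * cos (x 0) + b * sin (x 0))"
      by (auto simp: X_def)
    show "continuous_on UNIV f"
      unfolding f by (intro continuous_intros continuous_on_product_coordinates)
    have "\<bar>f x\<bar> \<le> \<bar>a\<bar> + \<bar>b\<bar>" for x
      unfolding f
      by (rule order_trans[OF abs_triangle_ineq])
         (auto simp: abs_mult intro!: add_mono mult_left_le abs_cos_le_one abs_sin_le_one)
    then show "bounded (range f)"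
      by (auto simp: bounded_iff)
  next
    fix f i assume "f \<in> X" "i < Suc 0"
    then obtain a b where f: "f = (\<lambda>x. a * cos (x 0) + b * sin (x 0))"
      by (auto simp: X_def)
    have "((\<lambda>t. f (x(i := t))) has_real_derivative b * cos (x 0) + (- a) * sin (x 0)) (at (x i))" for x
      using \<open>i < Suc 0\<close> unfolding f by (auto intro!: derivative_eq_intros)
    moreover have "(\<lambda>x. b * cos (x 0) + (- a) * sin (x 0)) \<in> X"
      unfolding X_def by blast
    ultimately show "\<exists>g\<in>X. \<forall>x. ((\<lambda>t. f (x(i := t))) has_real_derivative g x) (at (x i))"
      by (intro bexI[of _ "\<lambda>x. b * cos (x 0) + (- a) * sin (x 0)"]) auto
  qed (auto simp: X_def)
qed

lemma trig_subset_FCb: "u \<in> trig \<Longrightarrow> u \<in> FCb"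
proof (induction rule: trig.induct)
  case (base l a b)
  then show ?case
    using FCbI[OF Cb_infty_trig[of a b], of "\<lambda>_. l"] by simp
qed (rule FCb_add)

lemma trig_const: "(\<lambda>_. c) \<in> trig"
  using trig.base[OF top_dual_zero, of c 0] by simp

lemma trig_scale: "u \<in> trig \<Longrightarrow> (\<lambda>z. c * u z) \<in> trig"
proof (induction rule: trig.induct)
  case (base l a b)
  then show ?case
    using trig.base[OF base, of "c * a" "c * b"] by (simp add: algebra_simps)
next
  case (add u v)
  then show ?case using trig.add[of "\<lambda>z. c * u z" "\<lambda>z. c * v z"] by (simp add: algebra_simps)
qed

lemma trig_diff: "u \<in> trig \<Longrightarrow> v \<in> trig \<Longrightarrow> (\<lambda>z. u z - v z) \<in> trig"
  using trig.add[of u "\<lambda>z. (-1) * v z"] trig_scale[of v "-1"] by simp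

text \<open>Product-to-sum formulas: frequencies \<open>l\<close> and \<open>l'\<close> combine to
  their difference and their sum, which lie in the dual again.\<close>

lemma trig_mult:
  assumes "u \<in> trig" "v \<in> trig"
  shows "(\<lambda>z. u z * v z) \<in> trig"
  using assms
proof (induction rule: trig.induct)
  case (base l a b)
  from base(2,1) show ?case
  proof (induction rule: trig.induct)
    case (base l' a' b')
    note s = top_dual_add[OF \<open>l \<in> top_dual\<close> \<open>l' \<in> top_dual\<close>]
    note d = top_dual_add[OF \<open>l \<in> top_dual\<close> top_dual_scale[OF \<open>l' \<in> top_dual\<close>, of "- 1"]]
    have "(\<lambda>z. ((a * a' + b * b') / 2 * cos (l z + (- 1) * l' z) + (b * a' - a * b') / 2 * sin (l z + (- 1) * l' z))
      + ((a * a' - b * b') / 2 * cos (l z + l' z) + (a * b' + b * a') / 2 * sin (l z + l' z))) \<in> trig"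
      by (intro trig.add trig.base d s)
    also have "(\<lambda>z. ((a * a' + b * b') / 2 * cos (l z + (- 1) * l' z) + (b * a' - a * b') / 2 * sin (l z + (- 1) * l' z))
      + ((a * a' - b * b') / 2 * cos (l z + l' z) + (a * b' + b * a') / 2 * sin (l z + l' z)))
      = (\<lambda>z. (a * cos (l z) + b * sin (l z)) * (a' * cos (l' z) + b' * sin (l' z)))"
      by (auto simp: cos_add sin_add cos_diff sin_diff field_simps)
    finally show ?case .
  next
    case (add u v)
    then show ?case
      using trig.add[of "\<lambda>z. (a * cos (l z) + b * sin (l z)) * u z" "\<lambda>z. (a * cos (l z) + b * sin (l z)) * v z"]
      by (simp add: algebra_simps)
  qed
next
  case (add u u')
  then show ?case
    using trig.add[of "\<lambda>z. u z * v z" "\<lambda>z. u' z * v z"] by (simp add: algebra_simps)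
qed

lemma trig_shift: "u \<in> trig \<Longrightarrow> (\<lambda>z. u (z + t *\<^sub>R k)) \<in> trig"
proof (induction rule: trig.induct)
  case (base l a b)
  show ?case
    using trig.base[OF base, of "a * cos (t * l k) + b * sin (t * l k)" "b * cos (t * l k) - a * sin (t * l k)"]
    by (simp add: top_dual_line[OF base] cos_add sin_add algebra_simps)
qed (rule trig.add)

lemma dir_deriv_trig_base:
  assumes "l \<in> top_dual"
  shows "dir_deriv k (\<lambda>z. a * cos (l z) + b * sin (l z)) = (\<lambda>z. (b * l k) * cos (l z) + (- a * l k) * sin (l z))"
  by (intro ext dir_deriv_eqI) (auto simp: top_dual_line[OF assms] intro!: derivative_eq_intros)

lemma trig_dir_deriv: "u \<in> trig \<Longrightarrow> dir_deriv k u \<in> trig"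
proof (induction rule: trig.induct)
  case (base l a b)
  then show ?case
    unfolding dir_deriv_trig_base[OF base] by (rule trig.base)
next
  case (add u v)
  then show ?case
    by (simp add: dir_deriv_add trig_subset_FCb trig.add)
qed

lemma dir_deriv_shift: "dir_deriv k (\<lambda>z. u (z + t *\<^sub>R k')) z = dir_deriv k u (z + t *\<^sub>R k')"
  by (simp add: dir_deriv_def algebra_simps)

section \<open>Averages along segments\<close>

definition unif :: "real measure" where
  "unif = density lborel (\<lambda>s. ennreal (indicator {0..1} s))"

lemma sets_unif [measurable_cong, simp]: "sets unif = sets borel"
  by (simp add: unif_def)

lemma space_unif [simp]: "space unif = UNIV"
  by (simp add: unif_def)

lemma AE_unif: "AE s in unif. 0 \<le> s \<and> s \<le> 1"
  unfolding unif_def by (subst AE_density) (auto simp: indicator_def)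

interpretation unif: prob_space unif
proof
  show "emeasure unif (space unif) = 1"
    by (simp add: unif_def emeasure_density ennreal_indicator)
qed

lemma integral_unif:
  fixes f :: "real \<Rightarrow> real"
  assumes "f \<in> borel_measurable borel"
  shows "integral\<^sup>L unif f = (\<integral>s. indicator {0..1} s *\<^sub>R f s \<partial>lborel)"
  unfolding unif_def using assms by (subst integral_density) auto

lemma unif_FTC:
  assumes "\<And>s. (F has_real_derivative f s) (at s)" "continuous_on UNIV f"
  shows "(\<integral>s. f s \<partial>unif) = F 1 - F 0"
proof -
  have "(\<integral>s. indicator {0..1} s *\<^sub>R f s \<partial>lborel) = F 1 - F 0"
    using assms
    by (intro integral_FTC_atLeastAtMost)
       (auto intro: continuous_on_subset has_vector_derivative_at_within simp: has_real_derivative_iff_has_vector_derivative)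
  then show ?thesis
    using integral_unif borel_measurable_continuous_onI[OF assms(2)] by simp
qed

lemma FCb_line_integral:
  assumes u: "u \<in> FCb"
  shows "u (z + t *\<^sub>R k) - u z = t * (\<integral>s. dir_deriv k u (z + (t * s) *\<^sub>R k) \<partial>unif)"
proof -
  have "((\<lambda>s. u (z + (t * s) *\<^sub>R k)) has_real_derivative t * dir_deriv k u (z + (t * s) *\<^sub>R k)) (at s)" for s
    using DERIV_chain2[where f = "\<lambda>s. u (z + s *\<^sub>R k)" and g = "\<lambda>s. t * s" and x = s and s = UNIV,
        OF FCb_DERIV[OF u, of z k "t * s"] DERIV_cmult_Id[of t]]
    by (simp only: mult.commute)
  moreover have "continuous_on UNIV (\<lambda>s. t * dir_deriv k u (z + (t * s) *\<^sub>R k))"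
  proof -
    have "continuous_on UNIV (\<lambda>s. dir_deriv k u (z + s *\<^sub>R k))"
      using FCb_DERIV[OF FCb_dir_deriv[OF u]] by (meson DERIV_continuous_on DERIV_subset subset_UNIV)
    from continuous_on_compose2[OF this, of UNIV "\<lambda>s. t * s"] show ?thesis
      by (intro continuous_on_mult_left) (auto intro: continuous_intros)
  qed
  ultimately have "(\<integral>s. t * dir_deriv k u (z + (t * s) *\<^sub>R k) \<partial>unif) = u (z + (t * 1) *\<^sub>R k) - u (z + (t * 0) *\<^sub>R k)"
    by (rule unif_FTC)
  then show ?thesis by simp
qed

text \<open>If \<open>W\<close> is an antiderivative of \<open>u\<close> along \<open>k\<close>, the
  average of \<open>u\<close> over the segment is (W(z + t k) - W(z)) / t, hence trigonometric, and
  its derivative is the difference quotient of \<open>u\<close>.\<close>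

lemma trig_average:
  assumes "t \<noteq> 0"
  shows "u \<in> trig \<Longrightarrow> \<exists>v\<in>trig. (\<forall>z. v z = (\<integral>s. u (z + (t * s) *\<^sub>R k) \<partial>unif)) \<and>
    (\<forall>z. dir_deriv k v z = (u (z + t *\<^sub>R k) - u z) / t)"
proof (induction rule: trig.induct)
  case (base l a b)
  define u where "u = (\<lambda>z. a * cos (l z) + b * sin (l z))"
  have u: "u \<in> trig" unfolding u_def using base by (rule trig.base)
  have "\<exists>v\<in>trig. (\<forall>z. v z = (\<integral>s. u (z + (t * s) *\<^sub>R k) \<partial>unif)) \<and>
    (\<forall>z. dir_deriv k v z = (u (z + t *\<^sub>R k) - u z) / t)"
  \<comment> \<open>For \<open>l k = 0\<close> the division by \<open>l k\<close> in
    \<open>W\<close> fails, but then \<open>u\<close> is constant along \<open>k\<close> and is its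
    own average.\<close>
  proof (cases "l k = 0")
    case True
    have "dir_deriv k u = (\<lambda>_. 0)"
      unfolding u_def dir_deriv_trig_base[OF base] True by simp
    moreover have "u (z + r *\<^sub>R k) = u z" for z r
      by (simp add: u_def top_dual_line[OF base] True)
    ultimately have "(\<forall>z. u z = (\<integral>s. u (z + (t * s) *\<^sub>R k) \<partial>unif)) \<and>
        (\<forall>z. dir_deriv k u z = (u (z + t *\<^sub>R k) - u z) / t)"
      by (simp add: unif.prob_space[simplified])
    with u show ?thesis by blast
  next
    case False
    define W where "W = (\<lambda>z. (- b / l k) * cos (l z) + (a / l k) * sin (l z))"
    have W: "W \<in> trig" unfolding W_def using base by (rule trig.base)
    have dW: "dir_deriv k W = u"
      unfolding W_def dir_deriv_trig_base[OF base] u_def using False by simp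
    define v where "v = (\<lambda>z. (1 / t) * (W (z + t *\<^sub>R k) - W z))"
    have v: "v \<in> trig"
      unfolding v_def by (intro trig_scale trig_diff trig_shift W)
    have "dir_deriv k v z = (u (z + t *\<^sub>R k) - u z) / t" for z
      unfolding v_def using W
      by (subst dir_deriv_scale dir_deriv_diff;
          (intro FCb_diff trig_subset_FCb trig_shift W)?)+ (simp add: dir_deriv_shift dW)
    moreover have "v z = (\<integral>s. u (z + (t * s) *\<^sub>R k) \<partial>unif)" for z
      using FCb_line_integral[OF trig_subset_FCb[OF W], of z t k] assms by (simp add: v_def dW)
    ultimately show ?thesis using v by blast
  qed
  then show ?case unfolding u_def .
next
  case (add u u')
  then obtain v v' where v: "v \<in> trig" "v' \<in> trig"
    "\<And>z. v z = (\<integral>s. u (z + (t * s) *\<^sub>R k) \<partial>unif)" "\<And>z. v' z = (\<integral>s. u' (z + (t * s) *\<^sub>R k) \<partial>unif)"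
    "\<And>z. dir_deriv k v z = (u (z + t *\<^sub>R k) - u z) / t"
    "\<And>z. dir_deriv k v' z = (u' (z + t *\<^sub>R k) - u' z) / t" by auto
  have int: "integrable unif (\<lambda>s. w (z + (t * s) *\<^sub>R k))" if "w \<in> trig" for w :: "'a \<Rightarrow> real" and z
  proof -
    have w: "w \<in> FCb" using that by (rule trig_subset_FCb)
    have "continuous_on UNIV (\<lambda>s. w (z + s *\<^sub>R k))"
      using FCb_DERIV[OF w] by (meson DERIV_continuous_on DERIV_subset subset_UNIV)
    from continuous_on_compose2[OF this, of UNIV "\<lambda>s. t * s"]
    have "continuous_on UNIV (\<lambda>s. w (z + (t * s) *\<^sub>R k))"
      by (auto intro: continuous_intros)
    moreover obtain C where "\<And>z. \<bar>w z\<bar> \<le> C" using FCb_bounded[OF w] by blast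
    ultimately show ?thesis
      by (intro unif.integrable_const_bound[of _ C])
         (auto simp: measurable_cong_sets[OF sets_unif refl] intro: borel_measurable_continuous_onI)
  qed
  show ?case
  proof (intro bexI conjI allI)
    show "v z + v' z = (\<integral>s. u (z + (t * s) *\<^sub>R k) + u' (z + (t * s) *\<^sub>R k) \<partial>unif)" for z
      using int[OF add(1)] int[OF add(2)] by (simp add: v(3,4))
    show "dir_deriv k (\<lambda>z. v z + v' z) z = (u (z + t *\<^sub>R k) + u' (z + t *\<^sub>R k) - (u z + u' z)) / t" for z
      using v(1,2) by (simp add: dir_deriv_add trig_subset_FCb v(5,6) diff_divide_distrib add_divide_distrib)
    show "(\<lambda>z. v z + v' z) \<in> trig" using v(1,2) by (rule trig.add)
  qed
qed

section \<open>Bounded pointwise limits of an algebra of functions\<close>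

inductive_set bdd_limits :: "('a \<Rightarrow> real) set \<Rightarrow> ('a \<Rightarrow> real) set" for T where
  base: "u \<in> T \<Longrightarrow> u \<in> bdd_limits T"
| lim: "(\<And>n::nat. h n \<in> bdd_limits T) \<Longrightarrow> (\<And>n z. \<bar>h n z\<bar> \<le> C) \<Longrightarrow> (\<And>z. (\<lambda>n. h n z) \<longlonglongrightarrow> g z) \<Longrightarrow>
    g \<in> bdd_limits T"

text \<open>The closure is inductive, so limits of limits are included: whatever holds on
  \<open>T\<close> and survives dominated convergence holds on \<open>bdd_limits T\<close>. The
  algebra operations are what brings indicators into this closure.\<close>

locale bounded_algebra =
  fixes T :: "('a \<Rightarrow> real) set"
  assumes T_bounded: "u \<in> T \<Longrightarrow> \<exists>C. \<forall>z. \<bar>u z\<bar> \<le> C"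
    and T_const: "(\<lambda>_. c) \<in> T"
    and T_add: "u \<in> T \<Longrightarrow> v \<in> T \<Longrightarrow> (\<lambda>z. u z + v z) \<in> T"
    and T_mult: "u \<in> T \<Longrightarrow> v \<in> T \<Longrightarrow> (\<lambda>z. u z * v z) \<in> T"
begin

lemma bounded: "h \<in> bdd_limits T \<Longrightarrow> \<exists>C. \<forall>z. \<bar>h z\<bar> \<le> C"
proof (induction rule: bdd_limits.induct)
  case (lim h C g)
  have "\<bar>g z\<bar> \<le> C" for z
    using LIMSEQ_le_const2[OF tendsto_rabs[OF lim(3)[of z]]] lim(2) by blast
  then show ?case by blast
qed (rule T_bounded)

lemma const: "(\<lambda>_. c) \<in> bdd_limits T"
  by (intro bdd_limits.base T_const)

text \<open>Sums and products take two inductions: here one operand is still in \<open>T\<close>;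
  afterwards it runs through the closure as well.\<close>

lemma add_base: "h \<in> bdd_limits T \<Longrightarrow> u \<in> T \<Longrightarrow> (\<lambda>z. h z + u z) \<in> bdd_limits T"
proof (induction rule: bdd_limits.induct)
  case (base v)
  then show ?case by (intro bdd_limits.base T_add)
next
  case (lim h C g)
  from lim obtain D where D: "\<And>z. \<bar>u z\<bar> \<le> D" using T_bounded by blast
  show ?case
  proof (rule bdd_limits.lim)
    show "(\<lambda>z. h n z + u z) \<in> bdd_limits T" for n using lim by blast
    show "\<bar>h n z + u z\<bar> \<le> C + D" for n z
      using lim(2)[of n z] D[of z] by linarith
    show "(\<lambda>n. h n z + u z) \<longlonglongrightarrow> g z + u z" for z
      using lim(3) by (intro tendsto_intros)
  qed
qed

lemma add:
  assumes h: "h \<in> bdd_limits T" and "k \<in> bdd_limits T"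
  shows "(\<lambda>z. h z + k z) \<in> bdd_limits T"
  using assms(2)
proof (induction rule: bdd_limits.induct)
  case (base v)
  then show ?case using add_base[OF h] by simp
next
  case (lim k C g)
  obtain D where D: "\<And>z. \<bar>h z\<bar> \<le> D" using bounded[OF h] by blast
  show ?case
  proof (rule bdd_limits.lim)
    show "(\<lambda>z. h z + k n z) \<in> bdd_limits T" for n using lim by blast
    show "\<bar>h z + k n z\<bar> \<le> D + C" for n z
      using lim(2)[of n z] D[of z] by linarith
    show "(\<lambda>n. h z + k n z) \<longlonglongrightarrow> h z + g z" for z
      using lim(3) by (intro tendsto_intros)
  qed
qed

lemma mult_base: "h \<in> bdd_limits T \<Longrightarrow> u \<in> T \<Longrightarrow> (\<lambda>z. h z * u z) \<in> bdd_limits T"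
proof (induction rule: bdd_limits.induct)
  case (base v)
  then show ?case by (intro bdd_limits.base T_mult)
next
  case (lim h C g)
  from lim obtain D where D: "\<And>z. \<bar>u z\<bar> \<le> D" using T_bounded by blast
  show ?case
  proof (rule bdd_limits.lim)
    show "(\<lambda>z. h n z * u z) \<in> bdd_limits T" for n using lim by blast
    show "\<bar>h n z * u z\<bar> \<le> C * D" for n z
      unfolding abs_mult using lim(2)[of n z] D[of z] by (intro mult_mono) auto
    show "(\<lambda>n. h n z * u z) \<longlonglongrightarrow> g z * u z" for z
      using lim(3) by (intro tendsto_intros)
  qed
qed

lemma mult:
  assumes h: "h \<in> bdd_limits T" and "k \<in> bdd_limits T"
  shows "(\<lambda>z. h z * k z) \<in> bdd_limits T"
  using assms(2)
proof (induction rule: bdd_limits.induct)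
  case (base v)
  then show ?case using mult_base[OF h] by simp
next
  case (lim k C g)
  obtain D where D: "\<And>z. \<bar>h z\<bar> \<le> D" using bounded[OF h] by blast
  show ?case
  proof (rule bdd_limits.lim)
    show "(\<lambda>z. h z * k n z) \<in> bdd_limits T" for n using lim by blast
    show "\<bar>h z * k n z\<bar> \<le> D * C" for n z
      unfolding abs_mult using lim(2)[of n z] D[of z]
      by (intro mult_mono) (auto intro: order_trans[OF abs_ge_zero])
    show "(\<lambda>n. h z * k n z) \<longlonglongrightarrow> h z * g z" for z
      using lim(3) by (intro tendsto_intros)
  qed
qed

lemma scale: "h \<in> bdd_limits T \<Longrightarrow> (\<lambda>z. c * h z) \<in> bdd_limits T"
  by (intro mult const)

lemma diff: "h \<in> bdd_limits T \<Longrightarrow> k \<in> bdd_limits T \<Longrightarrow> (\<lambda>z. h z - k z) \<in> bdd_limits T"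
  using add[of h "\<lambda>z. (-1) * k z"] scale[of k "-1"] by simp

text \<open>The partial sums of the exponential series belong to the closure and are bounded by
  \<open>exp C\<close>.\<close>

lemma exp:
  assumes h: "h \<in> bdd_limits T"
  shows "(\<lambda>z. exp (h z)) \<in> bdd_limits T"
proof -
  obtain C where C: "\<And>z. \<bar>h z\<bar> \<le> C" using bounded[OF h] by blast
  show ?thesis
  proof (rule bdd_limits.lim)
    have pow: "(\<lambda>z. h z ^ i) \<in> bdd_limits T" for i
      by (induction i) (auto intro: const mult h)
    show "(\<lambda>z. \<Sum>i<n. inverse (fact i) * h z ^ i) \<in> bdd_limits T" for n
    proof (induction n)
      case (Suc n)
      from add[OF Suc scale[OF pow]] show ?case by simp
    qed (simp add: const)
    show "\<bar>\<Sum>i<n. inverse (fact i) * h z ^ i\<bar> \<le> exp C" for n z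
    proof -
      have "\<bar>\<Sum>i<n. inverse (fact i) * h z ^ i\<bar> \<le> (\<Sum>i<n. \<bar>inverse (fact i) * h z ^ i\<bar>)"
        by (rule sum_abs)
      also have "\<dots> \<le> (\<Sum>i<n. C ^ i /\<^sub>R fact i)"
        using C[of z] by (intro sum_mono) (auto simp: abs_mult power_abs intro!: mult_left_mono power_mono)
      also have "\<dots> \<le> exp C"
        using sums_unique[OF exp_converges[of C]] sums_summable[OF exp_converges[of C]]
          order_trans[OF abs_ge_zero C[of z]]
        by (metis (no_types, lifting) inverse_nonnegative_iff_nonnegative fact_ge_zero scaleR_nonneg_nonneg sum_le_suminf
            finite_lessThan zero_le_power)
      finally show ?thesis .
    qed
    show "(\<lambda>n. \<Sum>i<n. inverse (fact i) * h z ^ i) \<longlonglongrightarrow> exp (h z)" for z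
      using exp_converges[of "h z"] by (simp add: sums_def)
  qed
qed

lemma indicator_greater_zero:
  assumes h: "h \<in> bdd_limits T"
  shows "indicator {z. 0 < h z} \<in> bdd_limits T"
proof (rule bdd_limits.lim)
  \<comment> \<open>The double exponential tends to 1 for \<open>h z > 0\<close> and to 0 for
    \<open>h z < 0\<close>. At \<open>h z = 0\<close> the outer factor \<open>n\<close> turns it
    into \<open>exp (- n)\<close>, so the zero set falls outside.\<close>
  show "(\<lambda>z. exp (- real n * exp (- real n * h z))) \<in> bdd_limits T" for n
    by (intro exp scale h)
  show "\<bar>exp (- real n * exp (- real n * h z))\<bar> \<le> 1" for n z
    by simp
  show "(\<lambda>n. exp (- real n * exp (- real n * h z))) \<longlonglongrightarrow> indicator {z. 0 < h z} z" for z
  proof -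
    consider "h z > 0" | "h z = 0" | "h z < 0" by linarith
    then show ?thesis
    proof cases
      case 1
      then have "(\<lambda>n. exp (- real n * exp (- real n * h z))) \<longlonglongrightarrow> 1" by real_asymp
      then show ?thesis using 1 by simp
    next
      case 2
      have "(\<lambda>n. exp (- real n)) \<longlonglongrightarrow> 0" by real_asymp
      then show ?thesis using 2 by simp
    next
      case 3
      then have "(\<lambda>n. exp (- real n * exp (- real n * h z))) \<longlonglongrightarrow> 0" by real_asymp
      then show ?thesis using 3 by simp
    qed
  qed
qed

lemma sigma_algebra_indicators: "sigma_algebra UNIV {A. indicator A \<in> bdd_limits T}"
  unfolding sigma_algebra_iff2
proof (intro conjI ballI allI impI)
  show "{} \<in> {A. indicator A \<in> bdd_limits T}"
    using const[of 0] by (simp add: indicator_def[abs_def])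
next
  fix A assume "A \<in> {A. indicator A \<in> bdd_limits T}"
  then have "(\<lambda>z. 1 - indicator A z) \<in> bdd_limits T"
    by (intro diff const) auto
  also have "(\<lambda>z. 1 - indicator A z) = (indicator (UNIV - A) :: 'a \<Rightarrow> real)"
    by (auto simp: indicator_def)
  finally show "UNIV - A \<in> {A. indicator A \<in> bdd_limits T}" by simp
next
  fix A :: "nat \<Rightarrow> 'a set" assume A: "range A \<subseteq> {A. indicator A \<in> bdd_limits T}"
  have "indicator (\<Union>i. A i) \<in> bdd_limits T"
  proof (rule bdd_limits.lim)
    \<comment> \<open>De Morgan: a finite union is the complement of a product of complementary
      indicators.\<close>
    show "(\<lambda>z. 1 - (\<Prod>i<n. 1 - indicator (A i) z)) \<in> bdd_limits T" for n
    proof (intro diff const)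
      show "(\<lambda>z. \<Prod>i<n. 1 - indicator (A i) z) \<in> bdd_limits T"
        using A by (induction n) (auto intro!: const mult diff)
    qed
    have *: "(\<Prod>i<n. 1 - indicator (A i) z) = (indicator {z. \<forall>i<n. z \<notin> A i} z :: real)" for n z
      by (induction n) (auto simp: indicator_def less_Suc_eq)
    show "\<bar>1 - (\<Prod>i<n. 1 - indicator (A i) z)\<bar> \<le> (1::real)" for n z
      unfolding * by (auto simp: indicator_def)
    show "(\<lambda>n. 1 - (\<Prod>i<n. 1 - indicator (A i) z)) \<longlonglongrightarrow> (indicator (\<Union>i. A i) z :: real)" for z
    proof (cases "z \<in> (\<Union>i. A i)")
      case True
      then obtain j where "z \<in> A j" by blast
      then have "\<forall>\<^sub>F n in sequentially. 1 - (\<Prod>i<n. 1 - indicator (A i) z) = (indicator (\<Union>i. A i) z :: real)"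
        by (intro eventually_mono[OF eventually_gt_at_top[of j]]) (auto simp: * indicator_def)
      then show ?thesis by (rule tendsto_eventually)
    next
      case False
      then show ?thesis by (simp add: indicator_def)
    qed
  qed
  then show "(\<Union>i. A i) \<in> {A. indicator A \<in> bdd_limits T}" by simp
qed simp

lemma measurable_indicators:
  assumes "u \<in> T"
  shows "u \<in> borel_measurable (sigma UNIV {A. indicator A \<in> bdd_limits T})"
  unfolding borel_measurable_iff_greater
proof
  fix c
  have "indicator {z. 0 < u z - c} \<in> bdd_limits T"
    using assms by (intro indicator_greater_zero diff const bdd_limits.base)
  then show "{w \<in> space (sigma UNIV {A. indicator A \<in> bdd_limits T}). c < u w}
      \<in> sets (sigma UNIV {A. indicator A \<in> bdd_limits T})"
    by (simp add: sigma_algebra.sets_measure_of_eq[OF sigma_algebra_indicators] space_measure_of_conv)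
qed

end

section \<open>The \<sigma>-algebra generated by the dual\<close>

definition dual_sigma :: "'a::locally_convex_space measure" where
  "dual_sigma = sigma UNIV {l -` B | l B. l \<in> top_dual \<and> B \<in> sets (borel :: real measure)}"

lemma space_dual_sigma [simp]: "space dual_sigma = UNIV"
  by (simp add: dual_sigma_def space_measure_of_conv)

lemma top_dual_measurable_dual_sigma [measurable]: "l \<in> top_dual \<Longrightarrow> l \<in> borel_measurable dual_sigma"
  by (rule measurableI) (auto simp: dual_sigma_def sets_measure_of)

lemma measurable_dual_sigmaI:
  fixes f :: "'b \<Rightarrow> 'a::locally_convex_space"
  assumes "\<And>l. l \<in> top_dual \<Longrightarrow> (\<lambda>x. l (f x)) \<in> borel_measurable M"
  shows "f \<in> M \<rightarrow>\<^sub>M dual_sigma"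
  unfolding dual_sigma_def
proof (rule measurable_measure_of)
  fix y :: "'a set" assume "y \<in> {l -` B | l B. l \<in> top_dual \<and> B \<in> sets (borel :: real measure)}"
  then obtain l B where y: "l \<in> top_dual" "B \<in> sets (borel :: real measure)" "y = l -` B" by blast
  from measurable_sets[OF assms[OF y(1)] y(2)] show "f -` y \<inter> space M \<in> sets M"
    by (simp add: y(3) vimage_def)
qed auto

lemma id_measurable_dual_sigma: "(\<lambda>z. z) \<in> borel \<rightarrow>\<^sub>M dual_sigma"
  by (rule measurable_dual_sigmaI) (rule top_dual_measurable)

lemma dual_sigma_imp_borel: "f \<in> borel_measurable dual_sigma \<Longrightarrow> f \<in> borel_measurable borel"
  using measurable_compose[OF id_measurable_dual_sigma] by blast

lemma sets_dual_sigma_imp_borel: "A \<in> sets dual_sigma \<Longrightarrow> A \<in> sets borel"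
  using measurable_sets[OF id_measurable_dual_sigma] by auto

text \<open>Measurability into \<open>dual_sigma\<close> is tested on functionals, where the map
  reads \<open>l z + t * s * l k\<close>. Fubini for segment averages needs this joint measurability
  in \<open>(z, s)\<close>, and the choice of target makes it immediate.\<close>

lemma shift_measurable:
  assumes "sets M = sets (borel :: 'a::locally_convex_space measure)" "sets N = sets borel"
  shows "(\<lambda>(z, s). z + (t * s) *\<^sub>R k) \<in> M \<Otimes>\<^sub>M N \<rightarrow>\<^sub>M dual_sigma"
proof (rule measurable_dual_sigmaI)
  fix l :: "'a \<Rightarrow> real" assume l: "l \<in> top_dual"
  note [measurable_cong] = assms
  note [measurable] = top_dual_measurable[OF l]
  show "(\<lambda>x. l (case x of (z, s) \<Rightarrow> z + (t * s) *\<^sub>R k)) \<in> borel_measurable (M \<Otimes>\<^sub>M N)"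
    unfolding case_prod_beta top_dual_line[OF l] by measurable
qed

lemma FCb_measurable_dual_sigma:
  assumes "u \<in> FCb"
  shows "u \<in> borel_measurable dual_sigma"
proof -
  from assms obtain n f l where f: "f \<in> Cb_infty n" and l: "\<And>i. l i \<in> top_dual"
    and u: "u = (\<lambda>z. f (\<lambda>i. l i z))"
    by (rule FCb_repr) blast
  have "(\<lambda>z i. l i z) \<in> borel_measurable dual_sigma"
    using l by (intro measurable_coordinatewise_then_product) auto
  then show ?thesis
    unfolding u using measurable_compose borel_measurable_continuous_onI[OF Cb_infty_continuous[OF f]] by blast
qed

interpretation trig_alg: bounded_algebra "trig :: ('a::locally_convex_space \<Rightarrow> real) set"
proof
  fix u :: "'a \<Rightarrow> real" assume "u \<in> trig"
  then show "\<exists>C. \<forall>z. \<bar>u z\<bar> \<le> C"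
    using FCb_bounded[OF trig_subset_FCb] by metis
qed (auto intro: trig_const trig.add trig_mult)

abbreviation trig_limits :: "('a::locally_convex_space \<Rightarrow> real) set" where
  "trig_limits \<equiv> bdd_limits trig"

lemma trig_limits_measurable_dual_sigma: "h \<in> trig_limits \<Longrightarrow> h \<in> borel_measurable dual_sigma"
proof (induction rule: bdd_limits.induct)
  case (base u)
  then show ?case by (intro FCb_measurable_dual_sigma trig_subset_FCb)
next
  case (lim h C g)
  then show ?case by (intro borel_measurable_LIMSEQ_real[of dual_sigma h g]) auto
qed

text \<open>Monotone class argument: the sets with indicator in the closure form a \<sigma>-algebra,
  so it remains to see that each functional is measurable for it.\<close>

lemma indicator_trig_limits:
  assumes "A \<in> sets (dual_sigma :: 'a::locally_convex_space measure)"
  shows "indicator A \<in> trig_limits"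
proof -
  define S where "S = {A :: 'a set. indicator A \<in> trig_limits}"
  have S: "sigma_algebra UNIV S"
    unfolding S_def by (rule trig_alg.sigma_algebra_indicators)
  have "l \<in> borel_measurable (sigma UNIV S)" if l: "l \<in> top_dual" for l :: "'a \<Rightarrow> real"
  proof (rule borel_measurable_LIMSEQ_real)
    fix n :: nat
    \<comment> \<open>A nonzero \<open>l\<close> is unbounded, hence outside the closure. The
      functions N sin(l / N) with \<open>N = Suc n\<close> are in \<open>trig\<close> and converge
      to \<open>l\<close>, which is enough for measurability.\<close>
    have "(\<lambda>z. 0 * cos (inverse (Suc n) * l z) + Suc n * sin (inverse (Suc n) * l z)) \<in> trig"
      by (intro trig.base top_dual_scale l)
    then show "(\<lambda>z. Suc n * sin (inverse (Suc n) * l z)) \<in> borel_measurable (sigma UNIV S)"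
      unfolding S_def using trig_alg.measurable_indicators by fastforce
  next
    fix z
    show "(\<lambda>n. Suc n * sin (inverse (Suc n) * l z)) \<longlonglongrightarrow> l z"
      by real_asymp
  qed
  then have "l -` B \<in> S" if "l \<in> top_dual" "B \<in> sets borel" for l B
    using measurable_sets[of l "sigma UNIV S" borel B] that
    by (simp add: sigma_algebra.sets_measure_of_eq[OF S] space_measure_of_conv)
  then have "sigma_sets UNIV {l -` B | l B. l \<in> top_dual \<and> B \<in> sets (borel :: real measure)} \<subseteq> S"
    by (intro sigma_algebra.sigma_sets_subset[OF S]) auto
  moreover have "A \<in> sigma_sets UNIV {l -` B | l B. l \<in> top_dual \<and> B \<in> sets (borel :: real measure)}"
    using assms unfolding dual_sigma_def by (simp add: sets_measure_of)
  ultimately show ?thesis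
    by (auto simp: S_def)
qed

section \<open>Integration by parts and shifts\<close>

lemma unif_average_close:
  fixes f :: "real \<Rightarrow> real"
  assumes f: "f \<in> borel_measurable borel" and close: "\<And>s. 0 \<le> s \<Longrightarrow> s \<le> 1 \<Longrightarrow> \<bar>f s - c\<bar> \<le> e"
  shows "\<bar>(\<integral>s. f s \<partial>unif) - c\<bar> \<le> e"
proof -
  have ae: "AE s in unif. \<bar>f s - c\<bar> \<le> e"
    using AE_unif by eventually_elim (simp add: close)
  have "AE s in unif. norm (f s) \<le> e + \<bar>c\<bar>"
    using ae by eventually_elim auto
  then have int: "integrable unif f"
    using f by (intro unif.integrable_const_bound) (simp_all add: unif_def)
  have "(\<integral>s. f s \<partial>unif) - c = (\<integral>s. f s - c \<partial>unif)"
    using int by (simp add: unif.prob_space[simplified])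
  also have "\<bar>\<dots>\<bar> \<le> (\<integral>s. \<bar>f s - c\<bar> \<partial>unif)"
    by (rule integral_abs_bound)
  also have "\<dots> \<le> (\<integral>s. e \<partial>unif)"
    using ae int by (intro integral_mono_AE) auto
  also have "\<dots> = e" by (simp add: unif.prob_space[simplified])
  finally show ?thesis .
qed

lemma integrable_bounded_mult:
  fixes f h :: "'a \<Rightarrow> real"
  assumes "integrable M f" "h \<in> borel_measurable M" "\<And>z. \<bar>h z\<bar> \<le> C"
  shows "integrable M (\<lambda>z. h z * f z)"
proof (rule Bochner_Integration.integrable_bound)
  show "integrable M (\<lambda>z. C * \<bar>f z\<bar>)" using assms by simp
  show "(\<lambda>z. h z * f z) \<in> borel_measurable M" using assms by measurable
  have "\<bar>h z\<bar> * \<bar>f z\<bar> \<le> \<bar>C\<bar> * \<bar>f z\<bar>" for z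
    using assms(3)[of z] by (intro mult_right_mono) auto
  then show "AE z in M. norm (h z * f z) \<le> norm (C * \<bar>f z\<bar>)"
    by (simp add: abs_mult)
qed

lemma integral_bounded_mult_le:
  fixes f h :: "'a \<Rightarrow> real"
  assumes "integrable M f" "h \<in> borel_measurable M" "\<And>z. \<bar>h z\<bar> \<le> C"
  shows "\<bar>\<integral>z. h z * f z \<partial>M\<bar> \<le> C * (\<integral>z. \<bar>f z\<bar> \<partial>M)"
proof -
  have "\<bar>\<integral>z. h z * f z \<partial>M\<bar> \<le> (\<integral>z. \<bar>h z * f z\<bar> \<partial>M)"
    by (rule integral_abs_bound)
  also have "\<dots> \<le> (\<integral>z. C * \<bar>f z\<bar> \<partial>M)"
    using assms(1,3) integrable_abs[OF integrable_bounded_mult[OF assms]]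
    by (intro integral_mono) (auto simp: abs_mult intro!: mult_right_mono)
  finally show ?thesis by simp
qed

lemma integral_dominated_limit:
  fixes f :: "'a \<Rightarrow> real" and h :: "nat \<Rightarrow> 'a \<Rightarrow> real"
  assumes "integrable M f" "\<And>n. h n \<in> borel_measurable M" "\<And>n z. \<bar>h n z\<bar> \<le> C"
    and lim: "\<And>z. (\<lambda>n. h n z) \<longlonglongrightarrow> g z"
  shows "(\<lambda>n. \<integral>z. h n z * f z \<partial>M) \<longlonglongrightarrow> (\<integral>z. g z * f z \<partial>M)"
proof (rule integral_dominated_convergence[where w = "\<lambda>z. C * \<bar>f z\<bar>"])
  have [measurable]: "g \<in> borel_measurable M"
    using assms by (intro borel_measurable_LIMSEQ_real[of M h g]) auto
  show "(\<lambda>z. g z * f z) \<in> borel_measurable M" using assms(1) by measurable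
  show "(\<lambda>z. h n z * f z) \<in> borel_measurable M" for n using assms(1,2) by measurable
  show "integrable M (\<lambda>z. C * \<bar>f z\<bar>)" using assms by simp
  show "AE z in M. (\<lambda>n. h n z * f z) \<longlonglongrightarrow> g z * f z"
    by (intro AE_I2 tendsto_intros lim)
  show "AE z in M. norm (h n z * f z) \<le> C * \<bar>f z\<bar>" for n
    using assms(3) by (auto simp: abs_mult intro!: mult_right_mono)
qed

section \<open>The seminorm of L2 and limits of inner products\<close>

definition L2_norm :: "'a measure \<Rightarrow> ('a \<Rightarrow> real) \<Rightarrow> real" where
  "L2_norm M f = sqrt (\<integral>x. (f x)\<^sup>2 \<partial>M)"

lemma L2_norm_nonneg [simp]: "0 \<le> L2_norm M f"
  by (simp add: L2_norm_def)

lemma L2_norm_square: "(L2_norm M f)\<^sup>2 = (\<integral>x. (f x)\<^sup>2 \<partial>M)"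
  by (simp add: L2_norm_def)

lemma L2_mult_integrable:
  assumes "f \<in> L2 M" "g \<in> L2 M"
  shows "integrable M (\<lambda>x. f x * g x)"
proof (rule Bochner_Integration.integrable_bound)
  show "integrable M (\<lambda>x. (f x)\<^sup>2 + (g x)\<^sup>2)" using assms by (simp add: L2_def)
  show "(\<lambda>x. f x * g x) \<in> borel_measurable M"
    using assms by (auto simp: L2_def intro: borel_measurable_times)
  have "\<bar>a * b\<bar> \<le> a\<^sup>2 + b\<^sup>2" for a b :: real
  proof -
    have "2 * (\<bar>a\<bar> * \<bar>b\<bar>) \<le> a\<^sup>2 + b\<^sup>2" using sum_squares_bound[of "\<bar>a\<bar>" "\<bar>b\<bar>"] by simp
    then show ?thesis using mult_nonneg_nonneg[of "\<bar>a\<bar>" "\<bar>b\<bar>"] unfolding abs_mult by linarith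
  qed
  then show "AE x in M. norm (f x * g x) \<le> norm ((f x)\<^sup>2 + (g x)\<^sup>2)" by simp
qed

lemma L2_lin:
  assumes "f \<in> L2 M" "g \<in> L2 M"
  shows "(\<lambda>x. f x + c * g x) \<in> L2 M"
proof -
  have "integrable M (\<lambda>x. (f x)\<^sup>2 + 2 * c * (f x * g x) + c\<^sup>2 * (g x)\<^sup>2)"
    using assms L2_mult_integrable[OF assms] by (simp add: L2_def)
  also have "(\<lambda>x. (f x)\<^sup>2 + 2 * c * (f x * g x) + c\<^sup>2 * (g x)\<^sup>2) = (\<lambda>x. (f x + c * g x)\<^sup>2)"
    by (simp add: power2_eq_square algebra_simps)
  finally show ?thesis
    using assms by (auto simp: L2_def intro!: borel_measurable_times borel_measurable_add)
qed

lemma L2_diff: "f \<in> L2 M \<Longrightarrow> g \<in> L2 M \<Longrightarrow> (\<lambda>x. f x - g x) \<in> L2 M"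
  using L2_lin[of f M g "- 1"] by simp

lemma L2_add: "f \<in> L2 M \<Longrightarrow> g \<in> L2 M \<Longrightarrow> (\<lambda>x. f x + g x) \<in> L2 M"
  using L2_lin[of f M g 1] by simp

lemma L2_scale: "f \<in> L2 M \<Longrightarrow> (\<lambda>x. c * f x) \<in> L2 M"
  by (auto simp: L2_def power_mult_distrib)

lemma L2_norm_scale: "L2_norm M (\<lambda>x. c * f x) = \<bar>c\<bar> * L2_norm M f"
  by (simp add: L2_norm_def power_mult_distrib real_sqrt_mult)

lemma L2_Cauchy_Schwarz:
  assumes "f \<in> L2 M" "g \<in> L2 M"
  shows "\<bar>\<integral>x. f x * g x \<partial>M\<bar> \<le> L2_norm M f * L2_norm M g"
proof -
  define a b c where "a = (\<integral>x. (f x)\<^sup>2 \<partial>M)" and "b = (\<integral>x. (g x)\<^sup>2 \<partial>M)" and "c = (\<integral>x. f x * g x \<partial>M)"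
  have nn: "0 \<le> a" "0 \<le> b" by (auto simp: a_def b_def)
  have q: "0 \<le> a + r * (2 * c) + r\<^sup>2 * b" for r
  proof -
    have "0 \<le> (\<integral>x. (f x + r * g x)\<^sup>2 \<partial>M)" by simp
    also have "\<dots> = (\<integral>x. (f x)\<^sup>2 + r * (2 * (f x * g x)) + r\<^sup>2 * (g x)\<^sup>2 \<partial>M)"
      by (simp add: power2_eq_square algebra_simps)
    also have "\<dots> = a + r * (2 * c) + r\<^sup>2 * b"
      using assms L2_mult_integrable[OF assms] by (simp add: L2_def a_def b_def c_def)
    finally show ?thesis .
  qed
  have "c\<^sup>2 \<le> a * b"
  proof (cases "b = 0")
    case True
    have "c = 0"
    proof (rule ccontr)
      assume "c \<noteq> 0"
      \<comment> \<open>At this \<open>r\<close> the quadratic equals \<open>a - (a + 1)\<close>,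
        that is -1.\<close>
      then show False using q[of "- (a + 1) / (2 * c)"] True by simp
    qed
    then show ?thesis using True by simp
  next
    case False
    then have "0 < b" using nn by simp
    \<comment> \<open>\<open>- c / b\<close> is the minimum point of the quadratic.\<close>
    then show ?thesis using q[of "- c / b"] by (simp add: field_simps power2_eq_square)
  qed
  then have "sqrt (c\<^sup>2) \<le> sqrt (a * b)" by (rule real_sqrt_le_mono)
  then show ?thesis by (simp add: L2_norm_def real_sqrt_mult a_def b_def c_def)
qed

lemma L2_norm_triangle:
  assumes "f \<in> L2 M" "g \<in> L2 M"
  shows "L2_norm M (\<lambda>x. f x + g x) \<le> L2_norm M f + L2_norm M g"
proof -
  have "(L2_norm M (\<lambda>x. f x + g x))\<^sup>2 = (\<integral>x. (f x)\<^sup>2 + 2 * (f x * g x) + (g x)\<^sup>2 \<partial>M)"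
    unfolding L2_norm_square by (simp add: power2_eq_square algebra_simps)
  also have "\<dots> = (L2_norm M f)\<^sup>2 + 2 * (\<integral>x. f x * g x \<partial>M) + (L2_norm M g)\<^sup>2"
    using assms L2_mult_integrable[OF assms] by (simp add: L2_def L2_norm_square)
  also have "\<dots> \<le> (L2_norm M f + L2_norm M g)\<^sup>2"
    using L2_Cauchy_Schwarz[OF assms] by (simp add: power2_sum)
  finally show ?thesis by (rule power2_le_imp_le) simp
qed

lemma tendsto_L2_norm_iff:
  "(\<lambda>n. L2_norm M (f n)) \<longlonglongrightarrow> 0 \<longleftrightarrow> (\<lambda>n. \<integral>x. (f n x)\<^sup>2 \<partial>M) \<longlonglongrightarrow> 0"
proof
  assume "(\<lambda>n. L2_norm M (f n)) \<longlonglongrightarrow> 0"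
  from tendsto_power[OF this, of 2] show "(\<lambda>n. \<integral>x. (f n x)\<^sup>2 \<partial>M) \<longlonglongrightarrow> 0"
    by (simp add: L2_norm_square)
next
  assume "(\<lambda>n. \<integral>x. (f n x)\<^sup>2 \<partial>M) \<longlonglongrightarrow> 0"
  from tendsto_real_sqrt[OF this] show "(\<lambda>n. L2_norm M (f n)) \<longlonglongrightarrow> 0"
    by (simp add: L2_norm_def)
qed

text \<open>Stands for an L2 limit that is not constructed: the closed forms only involve limits of
  inner products, and those are Cauchy sequences of real numbers.\<close>

definition L2_Cauchy :: "'a measure \<Rightarrow> (nat \<Rightarrow> 'a \<Rightarrow> real) \<Rightarrow> bool" where
  "L2_Cauchy M F \<longleftrightarrow> (\<forall>n. F n \<in> L2 M) \<and>
    (\<forall>e>0. \<exists>N. \<forall>i\<ge>N. \<forall>j\<ge>N. L2_norm M (\<lambda>x. F i x - F j x) < e)"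

lemma L2_CauchyD: "L2_Cauchy M F \<Longrightarrow> F n \<in> L2 M"
  by (simp add: L2_Cauchy_def)

lemma L2_Cauchy_bounded:
  assumes "L2_Cauchy M F"
  obtains B N where "0 < B" "\<And>n. N \<le> n \<Longrightarrow> L2_norm M (F n) \<le> B"
proof -
  obtain N where N: "\<And>i j. N \<le> i \<Longrightarrow> N \<le> j \<Longrightarrow> L2_norm M (\<lambda>x. F i x - F j x) < 1"
    using assms unfolding L2_Cauchy_def by (meson zero_less_one)
  have "L2_norm M (F n) \<le> L2_norm M (F N) + 1" if "N \<le> n" for n
    using L2_norm_triangle[OF L2_diff[OF L2_CauchyD[OF assms, of n] L2_CauchyD[OF assms, of N]]
        L2_CauchyD[OF assms, of N]] N[OF that order_refl] by simp
  then show thesis using that[of "L2_norm M (F N) + 1" N] by (simp add: add_nonneg_pos)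
qed

lemma L2_Cauchy_inner_tendsto_0:
  assumes F: "L2_Cauchy M F" and H: "\<And>n. H n \<in> L2 M" "(\<lambda>n. L2_norm M (H n)) \<longlonglongrightarrow> 0"
  shows "(\<lambda>n. \<integral>x. F n x * H n x \<partial>M) \<longlonglongrightarrow> 0"
proof -
  obtain B N where B: "0 < B" "\<And>n. N \<le> n \<Longrightarrow> L2_norm M (F n) \<le> B"
    using L2_Cauchy_bounded[OF F] by blast
  show ?thesis
  proof (rule Lim_null_comparison)
    have "\<bar>\<integral>x. F n x * H n x \<partial>M\<bar> \<le> B * L2_norm M (H n)" if "N \<le> n" for n
      using L2_Cauchy_Schwarz[OF L2_CauchyD[OF F, of n] H(1)[of n]] mult_right_mono[OF B(2)[OF that], of "L2_norm M (H n)"]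
      by simp
    then show "\<forall>\<^sub>F n in sequentially. norm (\<integral>x. F n x * H n x \<partial>M) \<le> B * L2_norm M (H n)"
      by (intro eventually_mono[OF eventually_ge_at_top[of N]]) simp
    show "(\<lambda>n. B * L2_norm M (H n)) \<longlonglongrightarrow> 0" using tendsto_mult_right_zero[OF H(2)] by simp
  qed
qed

lemma L2_Cauchy_inner_convergent:
  assumes F: "L2_Cauchy M F" and G: "L2_Cauchy M G"
  shows "convergent (\<lambda>n. \<integral>x. F n x * G n x \<partial>M)"
proof -
  obtain B N where B: "0 < B" "\<And>n. N \<le> n \<Longrightarrow> L2_norm M (F n) \<le> B"
    using L2_Cauchy_bounded[OF F] by blast
  obtain C N' where C: "0 < C" "\<And>n. N' \<le> n \<Longrightarrow> L2_norm M (G n) \<le> C"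
    using L2_Cauchy_bounded[OF G] by blast
  have "Cauchy (\<lambda>n. \<integral>x. F n x * G n x \<partial>M)"
  proof (rule CauchyI)
    fix e :: real assume e: "0 < e"
    obtain M1 where M1: "\<And>i j. M1 \<le> i \<Longrightarrow> M1 \<le> j \<Longrightarrow> L2_norm M (\<lambda>x. G i x - G j x) < e / (2 * B)"
      using G e B(1) unfolding L2_Cauchy_def by (metis divide_pos_pos mult_pos_pos zero_less_numeral)
    obtain M2 where M2: "\<And>i j. M2 \<le> i \<Longrightarrow> M2 \<le> j \<Longrightarrow> L2_norm M (\<lambda>x. F i x - F j x) < e / (2 * C)"
      using F e C(1) unfolding L2_Cauchy_def by (metis divide_pos_pos mult_pos_pos zero_less_numeral)
    show "\<exists>R. \<forall>i\<ge>R. \<forall>j\<ge>R. norm ((\<integral>x. F i x * G i x \<partial>M) - (\<integral>x. F j x * G j x \<partial>M)) < e"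
    proof (intro exI[of _ "max (max N N') (max M1 M2)"] allI impI)
      fix i j assume ij: "max (max N N') (max M1 M2) \<le> i" "max (max N N') (max M1 M2) \<le> j"
      note L = L2_CauchyD[OF F] L2_CauchyD[OF G]
      have "(\<integral>x. F i x * G i x \<partial>M) - (\<integral>x. F j x * G j x \<partial>M) =
          (\<integral>x. F i x * (G i x - G j x) + (F i x - F j x) * G j x \<partial>M)"
        using L2_mult_integrable[OF L] by (simp add: algebra_simps flip: Bochner_Integration.integral_diff)
      also have "\<dots> = (\<integral>x. F i x * (G i x - G j x) \<partial>M) + (\<integral>x. (F i x - F j x) * G j x \<partial>M)"
        by (intro Bochner_Integration.integral_add L2_mult_integrable L2_diff L)
      also have "\<bar>\<dots>\<bar> \<le> B * L2_norm M (\<lambda>x. G i x - G j x) + L2_norm M (\<lambda>x. F i x - F j x) * C"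
      proof -
        have "\<bar>\<integral>x. F i x * (G i x - G j x) \<partial>M\<bar> \<le> L2_norm M (F i) * L2_norm M (\<lambda>x. G i x - G j x)"
          by (intro L2_Cauchy_Schwarz L2_diff L)
        also have "\<dots> \<le> B * L2_norm M (\<lambda>x. G i x - G j x)"
          using B(2)[of i] ij by (intro mult_right_mono) auto
        finally have 1: "\<bar>\<integral>x. F i x * (G i x - G j x) \<partial>M\<bar> \<le> B * L2_norm M (\<lambda>x. G i x - G j x)" .
        have "\<bar>\<integral>x. (F i x - F j x) * G j x \<partial>M\<bar> \<le> L2_norm M (\<lambda>x. F i x - F j x) * L2_norm M (G j)"
          by (intro L2_Cauchy_Schwarz L2_diff L)
        also have "\<dots> \<le> L2_norm M (\<lambda>x. F i x - F j x) * C"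
          using C(2)[of j] ij by (intro mult_left_mono) auto
        finally show ?thesis using 1 by linarith
      qed
      also have "\<dots> < B * (e / (2 * B)) + (e / (2 * C)) * C"
        using M1[of i j] M2[of i j] ij B(1) C(1)
        by (intro add_strict_mono mult_strict_left_mono mult_strict_right_mono) auto
      also have "\<dots> = e" using B(1) C(1) by simp
      finally show "norm ((\<integral>x. F i x * G i x \<partial>M) - (\<integral>x. F j x * G j x \<partial>M)) < e" by simp
    qed
  qed
  then show ?thesis by (rule Cauchy_convergent)
qed

lemma L2_norm_triangle_diff:
  assumes "f \<in> L2 M" "g \<in> L2 M" "h \<in> L2 M"
  shows "L2_norm M (\<lambda>x. f x - h x) \<le> L2_norm M (\<lambda>x. f x - g x) + L2_norm M (\<lambda>x. g x - h x)"
  using L2_norm_triangle[OF L2_diff[OF assms(1,2)] L2_diff[OF assms(2,3)]] by simp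

lemma (in prob_space) L2_bounded:
  fixes f :: "'a \<Rightarrow> real"
  assumes f: "f \<in> borel_measurable M" and B: "\<And>x. \<bar>f x\<bar> \<le> B"
  shows "f \<in> L2 M" "L2_norm M f \<le> B"
proof -
  have B0: "0 \<le> B" using B abs_ge_zero order_trans by blast
  have sq: "(f x)\<^sup>2 \<le> B\<^sup>2" for x using power_mono[OF B abs_ge_zero, of x 2] by simp
  have i: "integrable M (\<lambda>x. (f x)\<^sup>2)"
    using f sq by (intro integrable_const_bound[where B = "B\<^sup>2"]) auto
  then show "f \<in> L2 M" using f by (simp add: L2_def)
  have "(\<integral>x. (f x)\<^sup>2 \<partial>M) \<le> (\<integral>x. B\<^sup>2 \<partial>M)" by (intro integral_mono i sq) simp
  then have "sqrt (\<integral>x. (f x)\<^sup>2 \<partial>M) \<le> sqrt (B\<^sup>2)" by (intro real_sqrt_le_mono) (simp add: prob_space)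
  then show "L2_norm M f \<le> B" using B0 by (simp add: L2_norm_def)
qed

lemma (in prob_space) L2_norm_tendsto_bounded:
  fixes R :: "nat \<Rightarrow> 'a \<Rightarrow> real"
  assumes R: "\<And>n. R n \<in> borel_measurable M" "\<And>n x. \<bar>R n x\<bar> \<le> B" and lim: "\<And>x. (\<lambda>n. R n x) \<longlonglongrightarrow> r x"
  shows "(\<lambda>n. L2_norm M (\<lambda>x. R n x - r x)) \<longlonglongrightarrow> 0"
  unfolding tendsto_L2_norm_iff
proof -
  have r: "r \<in> borel_measurable M" using borel_measurable_LIMSEQ_real[OF lim R(1)] .
  have rB: "\<bar>r x\<bar> \<le> B" for x using LIMSEQ_le_const2[OF tendsto_rabs[OF lim[of x]]] R(2) by blast
  have "(\<lambda>n. \<integral>x. (R n x - r x)\<^sup>2 * 1 \<partial>M) \<longlonglongrightarrow> (\<integral>x. 0 * 1 \<partial>M)"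
  proof (rule integral_dominated_limit)
    show "\<bar>(R n x - r x)\<^sup>2\<bar> \<le> (2 * B)\<^sup>2" for n x
    proof -
      have "\<bar>R n x - r x\<bar> \<le> 2 * B" using R(2)[of n x] rB[of x] by linarith
      from power_mono[OF this abs_ge_zero, of 2] show ?thesis by simp
    qed
    show "(\<lambda>n. (R n x - r x)\<^sup>2) \<longlonglongrightarrow> 0" for x
      using tendsto_power[OF tendsto_diff[OF lim[of x] tendsto_const[of "r x"]], of 2] by simp
  qed (use R(1) r in auto)
  then show "(\<lambda>n. \<integral>x. (R n x - r x)\<^sup>2 \<partial>M) \<longlonglongrightarrow> 0" by simp
qed

section \<open>Measures with a logarithmic derivative in one direction\<close>

locale log_deriv = prob_space m for m :: "'a::locally_convex_space measure" +
  fixes k :: 'a and \<beta> :: "'a \<Rightarrow> real"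
  assumes sets_m [measurable_cong]: "sets m = sets borel"
    and \<beta>_L2: "\<beta> \<in> L2 m"
    and ibp_FCb: "u \<in> FCb \<Longrightarrow> (\<integral>z. dir_deriv k u z \<partial>m) = - (\<integral>z. u z * \<beta> z \<partial>m)"
begin

lemma space_m [simp]: "space m = UNIV"
  using sets_eq_imp_space_eq[OF sets_m] by simp

lemma prob_UNIV [simp]: "prob UNIV = 1"
  using prob_space by simp

lemma \<beta>_measurable [measurable]: "\<beta> \<in> borel_measurable m"
  and \<beta>_square: "integrable m (\<lambda>z. (\<beta> z)\<^sup>2)"
  using \<beta>_L2 by (auto simp: L2_def)

lemma \<beta>_integrable: "integrable m \<beta>"
proof (rule Bochner_Integration.integrable_bound)
  show "integrable m (\<lambda>z. 1 + (\<beta> z)\<^sup>2)" using \<beta>_square by simp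
  have "\<bar>x\<bar> \<le> 1 + x\<^sup>2" for x :: real
    using abs_ge_zero[of x] sum_squares_bound[of "\<bar>x\<bar>" 1] by (simp add: power2_eq_square) 
  then show "AE z in m. norm (\<beta> z) \<le> norm (1 + (\<beta> z)\<^sup>2)" by simp
qed simp

lemma m_measurable: "h \<in> borel_measurable dual_sigma \<Longrightarrow> h \<in> borel_measurable m"
  using dual_sigma_imp_borel sets_m by (metis measurable_cong_sets)

lemma m_measurable_shift:
  fixes h :: "'a \<Rightarrow> real"
  assumes "h \<in> borel_measurable dual_sigma"
  shows "(\<lambda>z. h (z + t *\<^sub>R k)) \<in> borel_measurable m"
proof -
  have "(\<lambda>z. z + t *\<^sub>R k) \<in> m \<rightarrow>\<^sub>M dual_sigma"
  proof (rule measurable_dual_sigmaI)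
    fix l :: "'a \<Rightarrow> real" assume l: "l \<in> top_dual"
    show "(\<lambda>x. l (x + t *\<^sub>R k)) \<in> borel_measurable m"
      unfolding top_dual_line[OF l] using m_measurable[OF top_dual_measurable_dual_sigma[OF l]] by measurable
  qed
  from measurable_compose[OF this assms] show ?thesis .
qed

lemma pair_measurable_shift:
  fixes h :: "'a \<Rightarrow> real"
  assumes "h \<in> borel_measurable dual_sigma"
  shows "(\<lambda>(z, s). h (z + (t * s) *\<^sub>R k)) \<in> borel_measurable (m \<Otimes>\<^sub>M unif)"
  using measurable_compose[OF shift_measurable[OF sets_m sets_unif, of t k] assms]
  by (simp add: case_prod_beta)

sublocale unif_pair: pair_prob_space m unif ..

lemma integrable_pair_shift:
  fixes h f :: "'a \<Rightarrow> real"
  assumes h: "h \<in> borel_measurable dual_sigma" "\<And>z. \<bar>h z\<bar> \<le> C" and f: "integrable m f"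
  shows "integrable (m \<Otimes>\<^sub>M unif) (\<lambda>(z, s). h (z + (t * s) *\<^sub>R k) * f z)"
proof -
  have "integrable (m \<Otimes>\<^sub>M unif) (\<lambda>x. (case x of (z, s) \<Rightarrow> h (z + (t * s) *\<^sub>R k)) * (case x of (z, s) \<Rightarrow> f z))"
  proof (rule integrable_bounded_mult)
    show "integrable (m \<Otimes>\<^sub>M unif) (\<lambda>(z, s). f z)"
      using f by (intro unif_pair.Fubini_integrable) (auto simp: unif.prob_space[simplified])
  qed (use pair_measurable_shift[OF h(1)] h(2) in auto)
  then show ?thesis by (simp add: case_prod_unfold)
qed

lemma shift_average_measurable:
  fixes h f :: "'a \<Rightarrow> real"
  assumes h: "h \<in> borel_measurable dual_sigma" and f: "f \<in> borel_measurable m"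
  shows "(\<lambda>s. \<integral>z. h (z + (t * s) *\<^sub>R k) * f z \<partial>m) \<in> borel_measurable borel"
proof -
  have "(\<lambda>(z, s). h (z + (t * s) *\<^sub>R k) * f z) \<in> borel_measurable (m \<Otimes>\<^sub>M unif)"
    using pair_measurable_shift[OF h] f by (simp add: case_prod_beta)
  from measurable_pair_swap[OF this]
  have "(\<lambda>s. \<integral>z. h (z + (t * s) *\<^sub>R k) * f z \<partial>m) \<in> borel_measurable unif"
    by (intro borel_measurable_lebesgue_integral) (simp add: case_prod_beta)
  then show ?thesis by (simp add: measurable_cong_sets[OF sets_unif refl])
qed

lemma line_average_measurable:
  fixes h :: "'a \<Rightarrow> real"
  assumes h: "h \<in> borel_measurable dual_sigma"
  shows "(\<lambda>z. \<integral>s. h (z + (t * s) *\<^sub>R k) \<partial>unif) \<in> borel_measurable m"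
  using pair_measurable_shift[OF h] by (intro unif.borel_measurable_lebesgue_integral)

lemma line_measurable:
  fixes h :: "'a \<Rightarrow> real"
  assumes "h \<in> borel_measurable dual_sigma"
  shows "(\<lambda>s. h (z + (t * s) *\<^sub>R k)) \<in> borel_measurable borel"
  using measurable_Pair2[OF pair_measurable_shift[OF assms, of t], of z]
  by (simp add: measurable_cong_sets[OF sets_unif refl])

lemma shift_Fubini:
  fixes h f :: "'a \<Rightarrow> real"
  assumes h: "h \<in> borel_measurable dual_sigma" "\<And>z. \<bar>h z\<bar> \<le> C" and f: "integrable m f"
  shows "(\<integral>z. (\<integral>s. h (z + (t * s) *\<^sub>R k) \<partial>unif) * f z \<partial>m) =
    (\<integral>s. (\<integral>z. h (z + (t * s) *\<^sub>R k) * f z \<partial>m) \<partial>unif)"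
  using unif_pair.Fubini_integral[OF integrable_pair_shift[OF assms, of t]] by simp

text \<open>Here \<open>\<beta>\<close> is the density of the \<open>k\<close>-derivative of
  \<open>m\<close> with respect to \<open>m\<close>, so the product rule reads d_k(f m) = (d_k f +
  \<beta> f) m. The condition therefore says that \<open>f\<close> has weak derivative 0 along
  \<open>k\<close>. Tests from \<open>trig\<close> suffice to reach indicators through
  \<open>shift_formula\<close>.\<close>

definition ibp :: "('a \<Rightarrow> real) \<Rightarrow> bool" where
  "ibp f \<longleftrightarrow> integrable m f \<and> integrable m (\<lambda>z. \<beta> z * f z) \<and>
    (\<forall>u\<in>trig. (\<integral>z. dir_deriv k u z * f z \<partial>m) = - (\<integral>z. u z * (\<beta> z * f z) \<partial>m))"

lemma ibp_one: "ibp (\<lambda>_. 1)"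
  using \<beta>_integrable ibp_FCb by (simp add: ibp_def trig_subset_FCb)

lemma trig_bounded_measurable:
  assumes "u \<in> trig"
  obtains C where "\<And>z. \<bar>u z\<bar> \<le> C" "u \<in> borel_measurable m"
  using FCb_bounded[OF trig_subset_FCb[OF assms]]
    m_measurable[OF FCb_measurable_dual_sigma[OF trig_subset_FCb[OF assms]]] by blast

lemma trig_integrable_mult: "u \<in> trig \<Longrightarrow> integrable m f \<Longrightarrow> integrable m (\<lambda>z. u z * f z)"
  by (metis trig_bounded_measurable integrable_bounded_mult)

lemma ibp_add:
  assumes "ibp f" "ibp g"
  shows "ibp (\<lambda>z. a * f z + c * g z)"
proof -
  have "(\<integral>z. dir_deriv k u z * (a * f z + c * g z) \<partial>m) = - (\<integral>z. u z * (\<beta> z * (a * f z + c * g z)) \<partial>m)"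
    if u: "u \<in> trig" for u
  proof -
    note int = trig_integrable_mult[OF trig_dir_deriv[OF u]] trig_integrable_mult[OF u]
    have "(\<integral>z. dir_deriv k u z * (a * f z + c * g z) \<partial>m) =
        (\<integral>z. a * (dir_deriv k u z * f z) + c * (dir_deriv k u z * g z) \<partial>m)"
      by (simp add: algebra_simps)
    also have "\<dots> = a * (\<integral>z. dir_deriv k u z * f z \<partial>m) + c * (\<integral>z. dir_deriv k u z * g z \<partial>m)"
      using assms int by (simp add: ibp_def)
    also have "\<dots> = - (a * (\<integral>z. u z * (\<beta> z * f z) \<partial>m) + c * (\<integral>z. u z * (\<beta> z * g z) \<partial>m))"
      using assms u by (simp add: ibp_def)
    also have "a * (\<integral>z. u z * (\<beta> z * f z) \<partial>m) + c * (\<integral>z. u z * (\<beta> z * g z) \<partial>m) =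
        (\<integral>z. a * (u z * (\<beta> z * f z)) + c * (u z * (\<beta> z * g z)) \<partial>m)"
      using assms int by (simp add: ibp_def)
    finally show ?thesis by (simp add: algebra_simps)
  qed
  moreover have "integrable m (\<lambda>z. \<beta> z * (a * f z + c * g z))"
  proof -
    have "integrable m (\<lambda>z. a * (\<beta> z * f z) + c * (\<beta> z * g z))"
      using assms by (simp add: ibp_def)
    then show ?thesis by (simp add: algebra_simps)
  qed
  ultimately show ?thesis using assms by (simp add: ibp_def)
qed

lemma ibp_limit:
  assumes f: "\<And>n. ibp (f n)" "\<And>n z. \<bar>f n z\<bar> \<le> 1" and lim: "\<And>z. (\<lambda>n. f n z) \<longlonglongrightarrow> g z"
  shows "ibp g"
proof -
  have fm: "f n \<in> borel_measurable m" for n using f(1) by (auto simp: ibp_def)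
  have gm: "g \<in> borel_measurable m"
    using lim fm by (intro borel_measurable_LIMSEQ_real[of m f g]) auto
  have gb: "\<bar>g z\<bar> \<le> 1" for z
    using LIMSEQ_le_const2[OF tendsto_rabs[OF lim[of z]]] f(2) by blast
  have "integrable m g"
    using gm gb by (intro integrable_const_bound[of _ 1]) auto
  moreover have "integrable m (\<lambda>z. \<beta> z * g z)"
    using integrable_bounded_mult[OF \<beta>_integrable gm gb] by (simp add: mult.commute)
  moreover have "(\<integral>z. dir_deriv k u z * g z \<partial>m) = - (\<integral>z. u z * (\<beta> z * g z) \<partial>m)" if u: "u \<in> trig" for u
  proof (rule LIMSEQ_unique)
    have "integrable m (\<lambda>z. dir_deriv k u z * 1)" "integrable m (\<lambda>z. u z * \<beta> z)"
      by (intro trig_integrable_mult trig_dir_deriv u \<beta>_integrable; simp)+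
    note int = integral_dominated_limit[OF _ fm f(2) lim, OF this(1)]
      integral_dominated_limit[OF _ fm f(2) lim, OF this(2)]
    show "(\<lambda>n. \<integral>z. dir_deriv k u z * f n z \<partial>m) \<longlonglongrightarrow> (\<integral>z. dir_deriv k u z * g z \<partial>m)"
      using int(1) by (simp add: mult.commute)
    have "(\<lambda>n. - (\<integral>z. u z * (\<beta> z * f n z) \<partial>m)) \<longlonglongrightarrow> - (\<integral>z. u z * (\<beta> z * g z) \<partial>m)"
      using tendsto_minus[OF int(2)] by (simp add: ac_simps)
    then show "(\<lambda>n. \<integral>z. dir_deriv k u z * f n z \<partial>m) \<longlonglongrightarrow> - (\<integral>z. u z * (\<beta> z * g z) \<partial>m)"
      using f(1) u by (simp add: ibp_def)
  qed
  ultimately show ?thesis by (simp add: ibp_def)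
qed

lemma trig_shift_increment:
  assumes u: "u \<in> trig" and f: "integrable m f"
  shows "(\<integral>z. u (z + t *\<^sub>R k) * f z \<partial>m) - (\<integral>z. u z * f z \<partial>m) =
    t * (\<integral>s. (\<integral>z. dir_deriv k u (z + (t * s) *\<^sub>R k) * f z \<partial>m) \<partial>unif)"
proof -
  obtain C where C: "\<And>z. \<bar>dir_deriv k u z\<bar> \<le> C"
    using FCb_bounded[OF trig_subset_FCb[OF trig_dir_deriv[OF u]]] by blast
  have "(\<integral>z. u (z + t *\<^sub>R k) * f z \<partial>m) - (\<integral>z. u z * f z \<partial>m) =
      (\<integral>z. u (z + t *\<^sub>R k) * f z - u z * f z \<partial>m)"
    by (intro Bochner_Integration.integral_diff[symmetric] trig_integrable_mult trig_shift u f)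
  also have "\<dots> = (\<integral>z. t * ((\<integral>s. dir_deriv k u (z + (t * s) *\<^sub>R k) \<partial>unif) * f z) \<partial>m)"
    using FCb_line_integral[OF trig_subset_FCb[OF u], of _ t k]
    by (intro Bochner_Integration.integral_cong) (auto simp: left_diff_distrib[symmetric] mult.assoc)
  also have "\<dots> = t * (\<integral>s. (\<integral>z. dir_deriv k u (z + (t * s) *\<^sub>R k) * f z \<partial>m) \<partial>unif)"
    using shift_Fubini[of "dir_deriv k u" C f t] C f
      FCb_measurable_dual_sigma[OF trig_subset_FCb[OF trig_dir_deriv[OF u]]] by simp
  finally show ?thesis .
qed

text \<open>Integrated form of the identity: in \<open>t\<close>, the integral of h(z + t k) f has
  derivative minus the integral of h(z + t k) \<beta> f. No derivative of \<open>h\<close> occurs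
  and both sides survive bounded limits, so \<open>h\<close> may be an indicator.\<close>

lemma shift_formula:
  assumes f: "ibp f" and "h \<in> trig_limits"
  shows "(\<integral>z. h (z + t *\<^sub>R k) * f z \<partial>m) - (\<integral>z. h z * f z \<partial>m) =
    - t * (\<integral>s. (\<integral>z. h (z + (t * s) *\<^sub>R k) * (\<beta> z * f z) \<partial>m) \<partial>unif)"
  using assms(2)
proof (induction rule: bdd_limits.induct)
  case (base u)
  have "(\<integral>z. dir_deriv k u (z + r *\<^sub>R k) * f z \<partial>m) = - (\<integral>z. u (z + r *\<^sub>R k) * (\<beta> z * f z) \<partial>m)" for r
  proof -
    have "dir_deriv k (\<lambda>z. u (z + r *\<^sub>R k)) = (\<lambda>z. dir_deriv k u (z + r *\<^sub>R k))"
      by (intro ext dir_deriv_shift)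
    then show ?thesis using f trig_shift[OF base, of r k] by (auto simp: ibp_def)
  qed
  then show ?case
    using trig_shift_increment[OF base, of f t] f by (simp add: ibp_def)
next
  case (lim h C g)
  have fi: "integrable m f" "integrable m (\<lambda>z. \<beta> z * f z)" using f by (auto simp: ibp_def)
  have hm: "h n \<in> borel_measurable dual_sigma" for n
    using lim(1) by (rule trig_limits_measurable_dual_sigma)
  define \<psi> where "\<psi> n s = (\<integral>z. h n (z + (t * s) *\<^sub>R k) * (\<beta> z * f z) \<partial>m)" for n s
  define \<psi>' where "\<psi>' s = (\<integral>z. g (z + (t * s) *\<^sub>R k) * (\<beta> z * f z) \<partial>m)" for s
  have \<psi>: "(\<lambda>n. \<psi> n s) \<longlonglongrightarrow> \<psi>' s" for s
    unfolding \<psi>_def \<psi>'_def using lim(2,3) m_measurable_shift[OF hm]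
    by (intro integral_dominated_limit fi) auto
  have \<psi>m: "\<psi> n \<in> borel_measurable borel" for n
    unfolding \<psi>_def using fi by (intro shift_average_measurable hm) auto
  have "(\<lambda>n. \<integral>s. \<psi> n s * 1 \<partial>unif) \<longlonglongrightarrow> (\<integral>s. \<psi>' s * 1 \<partial>unif)"
  proof (rule integral_dominated_limit)
    show "\<bar>\<psi> n s\<bar> \<le> C * (\<integral>z. \<bar>\<beta> z * f z\<bar> \<partial>m)" for n s
      unfolding \<psi>_def using lim(2) m_measurable_shift[OF hm] fi
      by (intro integral_bounded_mult_le) auto
  qed (use \<psi> \<psi>m in auto)
  then have 1: "(\<lambda>n. - t * (\<integral>s. \<psi> n s \<partial>unif)) \<longlonglongrightarrow> - t * (\<integral>s. \<psi>' s \<partial>unif)"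
    by (intro tendsto_intros) simp
  have 2: "(\<lambda>n. (\<integral>z. h n (z + t *\<^sub>R k) * f z \<partial>m) - (\<integral>z. h n z * f z \<partial>m)) \<longlonglongrightarrow>
      (\<integral>z. g (z + t *\<^sub>R k) * f z \<partial>m) - (\<integral>z. g z * f z \<partial>m)"
    using lim(2,3) m_measurable_shift[OF hm] m_measurable[OF hm]
    by (intro tendsto_diff integral_dominated_limit fi) auto
  have "(\<integral>z. h n (z + t *\<^sub>R k) * f z \<partial>m) - (\<integral>z. h n z * f z \<partial>m) = - t * (\<integral>s. \<psi> n s \<partial>unif)" for n
    using lim(4) by (simp add: \<psi>_def)
  with 2 have "(\<lambda>n. - t * (\<integral>s. \<psi> n s \<partial>unif)) \<longlonglongrightarrow>
      (\<integral>z. g (z + t *\<^sub>R k) * f z \<partial>m) - (\<integral>z. g z * f z \<partial>m)" by simp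
  from LIMSEQ_unique[OF this 1] show ?case by (simp add: \<psi>'_def)
qed

section \<open>Continuity of translations\<close>

lemma trig_limits_boundedE:
  assumes "h \<in> trig_limits"
  obtains C where "0 < C" "\<And>z. \<bar>h z\<bar> \<le> C"
proof -
  obtain C where "\<And>z. \<bar>h z\<bar> \<le> C" using trig_alg.bounded[OF assms] by blast
  then have "\<bar>h z\<bar> \<le> \<bar>C\<bar> + 1" for z using abs_ge_self[of C] by (meson add_increasing2 order_trans zero_le_one)
  then show thesis using that[of "\<bar>C\<bar> + 1"] by simp
qed

lemmas trig_limits_m = m_measurable[OF trig_limits_measurable_dual_sigma]
lemmas trig_limits_m_shift = m_measurable_shift[OF trig_limits_measurable_dual_sigma]

lemma trig_limits_integrable: "h \<in> trig_limits \<Longrightarrow> integrable m h"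
  by (metis trig_limits_boundedE integrable_const_bound[of h] trig_limits_m AE_I2 real_norm_def)

text \<open>No bound on a density of the shifted measure is available. The shift formula with
  \<open>f = 1\<close> still controls shifted integrals for small \<open>t\<close>, uniformly over
  functions with a common bound, and this lets translation continuity pass to limits.\<close>

lemma shift_integral_le:
  assumes h: "h \<in> trig_limits" "\<And>z. \<bar>h z\<bar> \<le> C"
  shows "(\<integral>z. h (z + t *\<^sub>R k) \<partial>m) \<le> (\<integral>z. h z \<partial>m) + \<bar>t\<bar> * (C * (\<integral>z. \<bar>\<beta> z\<bar> \<partial>m))"
proof -
  have "\<bar>(\<integral>s. (\<integral>z. h (z + (t * s) *\<^sub>R k) * \<beta> z \<partial>m) \<partial>unif) - 0\<bar> \<le> C * (\<integral>z. \<bar>\<beta> z\<bar> \<partial>m)"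
  proof (rule unif_average_close)
    show "(\<lambda>s. \<integral>z. h (z + (t * s) *\<^sub>R k) * \<beta> z \<partial>m) \<in> borel_measurable borel"
      using h by (intro shift_average_measurable trig_limits_measurable_dual_sigma) auto
    show "\<bar>(\<integral>z. h (z + (t * s) *\<^sub>R k) * \<beta> z \<partial>m) - 0\<bar> \<le> C * (\<integral>z. \<bar>\<beta> z\<bar> \<partial>m)" for s
      using integral_bounded_mult_le[OF \<beta>_integrable trig_limits_m_shift[OF h(1)] h(2)] by simp
  qed
  then have "\<bar>t * (\<integral>s. (\<integral>z. h (z + (t * s) *\<^sub>R k) * \<beta> z \<partial>m) \<partial>unif)\<bar> \<le> \<bar>t\<bar> * (C * (\<integral>z. \<bar>\<beta> z\<bar> \<partial>m))"
    unfolding abs_mult by (intro mult_left_mono) auto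
  then show ?thesis
    using shift_formula[OF ibp_one h(1), of t] by simp
qed

text \<open>On \<open>trig\<close> translation is Lipschitz; a bounded limit is compared with one
  member of its sequence, before and after the shift.\<close>

lemma shift_continuous_L2:
  assumes "h \<in> trig_limits"
  shows "0 < \<epsilon> \<Longrightarrow> \<exists>\<delta>>0. \<forall>t. \<bar>t\<bar> < \<delta> \<longrightarrow> L2_norm m (\<lambda>z. h (z + t *\<^sub>R k) - h z) < \<epsilon>"
  using assms
proof (induction arbitrary: \<epsilon> rule: bdd_limits.induct)
  case (base u)
  have u: "u \<in> FCb" using base(1) by (rule trig_subset_FCb)
  obtain L where L: "\<And>z. \<bar>dir_deriv k u z\<bar> \<le> L" using FCb_bounded[OF FCb_dir_deriv[OF u]] by blast
  have lip: "\<bar>u (z + t *\<^sub>R k) - u z\<bar> \<le> \<bar>t\<bar> * L" for z t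
  proof -
    have "\<bar>(\<integral>s. dir_deriv k u (z + (t * s) *\<^sub>R k) \<partial>unif) - 0\<bar> \<le> L"
      using L by (intro unif_average_close line_measurable FCb_measurable_dual_sigma FCb_dir_deriv u) auto
    then show ?thesis
      unfolding FCb_line_integral[OF u] abs_mult by (intro mult_left_mono) auto
  qed
  have L0: "0 \<le> L" using L abs_ge_zero order_trans by blast
  have d: "(\<lambda>z. u (z + t *\<^sub>R k) - u z) \<in> trig" for t by (intro trig_diff trig_shift base)
  show ?case
  proof (intro exI[of _ "\<epsilon> / (L + 1)"] conjI allI impI)
    show "0 < \<epsilon> / (L + 1)" using base(2) L0 by simp
    fix t assume t: "\<bar>t\<bar> < \<epsilon> / (L + 1)"
    have "L2_norm m (\<lambda>z. u (z + t *\<^sub>R k) - u z) \<le> \<bar>t\<bar> * L"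
      by (rule L2_bounded(2)[OF trig_limits_m[OF bdd_limits.base[OF d]] lip])
    also have "\<dots> \<le> \<bar>t\<bar> * (L + 1)" by (simp add: algebra_simps)
    also have "\<dots> < \<epsilon>" using t L0 by (simp add: field_simps)
    finally show "L2_norm m (\<lambda>z. u (z + t *\<^sub>R k) - u z) < \<epsilon>" .
  qed
next
  case (lim h C g)
  have g: "g \<in> trig_limits" using lim(1-3) by (rule bdd_limits.lim)
  have gb: "\<bar>g z\<bar> \<le> C" for z
    using LIMSEQ_le_const2[OF tendsto_rabs[OF lim(3)[of z]]] lim(2) by blast
  have "(\<lambda>n. L2_norm m (\<lambda>z. h n z - g z)) \<longlonglongrightarrow> 0"
    by (rule L2_norm_tendsto_bounded[OF trig_limits_m[OF lim(1)] lim(2) lim(3)])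
  then obtain n where n: "L2_norm m (\<lambda>z. h n z - g z) < \<epsilon> / 4"
    using order_tendstoD(2)[of _ 0 sequentially "\<epsilon> / 4"] \<open>0 < \<epsilon>\<close> eventually_happens'[OF sequentially_bot]
    by fastforce
  \<comment> \<open>The squared distance after the shift is the shifted integral of
    \<open>D\<close>, and \<open>D\<close> is in the closure again, so
    \<open>shift_integral_le\<close> applies to it.\<close>
  define D where "D z = (h n z - g z)\<^sup>2" for z
  have D: "D \<in> trig_limits"
    unfolding D_def power2_eq_square by (intro trig_alg.mult trig_alg.diff g lim(1))
  have Db: "\<bar>D z\<bar> \<le> (2 * C)\<^sup>2" for z
  proof -
    have "\<bar>h n z - g z\<bar> \<le> 2 * C" using gb[of z] lim(2)[of n z] by linarith
    from power_mono[OF this abs_ge_zero, of 2] show ?thesis unfolding D_def by simp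
  qed
  define B where "B = (2 * C)\<^sup>2 * (\<integral>z. \<bar>\<beta> z\<bar> \<partial>m)"
  have B: "0 \<le> B" by (simp add: B_def)
  obtain \<delta> where \<delta>: "0 < \<delta>" "\<And>t. \<bar>t\<bar> < \<delta> \<Longrightarrow> L2_norm m (\<lambda>z. h n (z + t *\<^sub>R k) - h n z) < \<epsilon> / 4"
    using lim(4)[of "\<epsilon> / 4" n] \<open>0 < \<epsilon>\<close> by auto
  note hL = L2_bounded(1)[OF trig_limits_m[OF lim(1)] lim(2)] L2_bounded(1)[OF trig_limits_m_shift[OF lim(1)] lim(2)]
  note gL = L2_bounded(1)[OF trig_limits_m[OF g] gb] L2_bounded(1)[OF trig_limits_m_shift[OF g] gb]
  show ?case
  \<comment> \<open>The second bound keeps |t| B below (\<epsilon>/4)^2, so the shifted error is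
    below \<epsilon>/2; the other two terms take \<epsilon>/4 each. \<open>B + 1\<close> avoids a
    division by 0.\<close>
  proof (intro exI[of _ "min \<delta> ((\<epsilon> / 4)\<^sup>2 / (B + 1))"] conjI allI impI)
    show "0 < min \<delta> ((\<epsilon> / 4)\<^sup>2 / (B + 1))" using \<delta>(1) \<open>0 < \<epsilon>\<close> B by simp
    fix t assume t: "\<bar>t\<bar> < min \<delta> ((\<epsilon> / 4)\<^sup>2 / (B + 1))"
    have "\<bar>t\<bar> * B \<le> \<bar>t\<bar> * (B + 1)" by (simp add: algebra_simps)
    also have "\<dots> \<le> (\<epsilon> / 4)\<^sup>2" using t B by (simp add: pos_less_divide_eq less_imp_le)
    finally have tB: "\<bar>t\<bar> * B \<le> (\<epsilon> / 4)\<^sup>2" .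
    have "(L2_norm m (\<lambda>z. g (z + t *\<^sub>R k) - h n (z + t *\<^sub>R k)))\<^sup>2 = (\<integral>z. D (z + t *\<^sub>R k) \<partial>m)"
      by (simp add: L2_norm_square D_def power2_commute)
    also have "\<dots> \<le> (\<integral>z. D z \<partial>m) + (\<epsilon> / 4)\<^sup>2"
      using shift_integral_le[OF D Db, of t] tB unfolding B_def[symmetric] by linarith
    also have "\<dots> < (\<epsilon> / 4)\<^sup>2 + (\<epsilon> / 4)\<^sup>2"
      using power_strict_mono[OF n L2_norm_nonneg, of 2] by (simp add: L2_norm_square D_def)
    also have "(\<epsilon> / 4)\<^sup>2 + (\<epsilon> / 4)\<^sup>2 \<le> (\<epsilon> / 2)\<^sup>2" by (simp add: power2_eq_square)
    finally have "L2_norm m (\<lambda>z. g (z + t *\<^sub>R k) - h n (z + t *\<^sub>R k)) < \<epsilon> / 2"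
      using \<open>0 < \<epsilon>\<close> by (rule power2_less_imp_less[OF _ less_imp_le[OF half_gt_zero]])
    then show "L2_norm m (\<lambda>z. g (z + t *\<^sub>R k) - g z) < \<epsilon>"
      using L2_norm_triangle_diff[OF gL(2) hL(2) gL(1), of t n t] L2_norm_triangle_diff[OF hL(2) hL(1) gL(1), of n t n]
        \<delta>(2)[of t] t n by linarith
  qed
qed

text \<open>A weight that is only integrable is truncated at level \<open>N\<close>: the tail
  \<open>R N\<close> has small integral, and below the level the L2 statement applies.\<close>

lemma shift_continuous_weighted:
  assumes h: "h \<in> trig_limits" and w: "integrable m w" and \<epsilon>: "0 < \<epsilon>"
  shows "\<exists>\<delta>>0. \<forall>t. \<bar>t\<bar> < \<delta> \<longrightarrow> (\<integral>z. \<bar>h (z + t *\<^sub>R k) - h z\<bar> * \<bar>w z\<bar> \<partial>m) < \<epsilon>"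
proof -
  obtain C where C: "0 < C" "\<And>z. \<bar>h z\<bar> \<le> C" using trig_limits_boundedE[OF h] by blast
  define R where "R N z = max 0 (\<bar>w z\<bar> - real N)" for N z
  have wm [measurable]: "w \<in> borel_measurable m" using w by simp
  have Rm [measurable]: "R N \<in> borel_measurable m" for N unfolding R_def by measurable
  have Ri: "integrable m (R N)" for N
    by (rule Bochner_Integration.integrable_bound[OF w]) (auto simp: R_def)
  have "(\<lambda>N. \<integral>z. R N z \<partial>m) \<longlonglongrightarrow> (\<integral>z. 0 \<partial>m)"
  proof (rule integral_dominated_convergence[where w = "\<lambda>z. \<bar>w z\<bar>"])
    show "AE z in m. (\<lambda>N. R N z) \<longlonglongrightarrow> 0"
    proof (rule AE_I2)
      fix z
      obtain N where "\<bar>w z\<bar> \<le> real N" using real_arch_simple by blast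
      then show "(\<lambda>N. R N z) \<longlonglongrightarrow> 0"
        by (intro tendsto_eventually eventually_mono[OF eventually_ge_at_top[of N]]) (auto simp: R_def)
    qed
  qed (use w in \<open>auto simp: R_def\<close>)
  then have "\<forall>\<^sub>F N in sequentially. (\<integral>z. R N z \<partial>m) < \<epsilon> / (4 * C)"
    using order_tendstoD(2)[of _ 0 sequentially "\<epsilon> / (4 * C)"] \<epsilon> C(1) by simp
  then obtain N where N: "(\<integral>z. R N z \<partial>m) < \<epsilon> / (4 * C)"
    using eventually_happens'[OF sequentially_bot] by blast
  define \<eta> where "\<eta> = \<epsilon> / (4 * (real N + 1))"
  have \<eta>: "0 < \<eta>" using \<epsilon> by (simp add: \<eta>_def)
  obtain \<delta> where \<delta>: "0 < \<delta>" "\<And>t. \<bar>t\<bar> < \<delta> \<Longrightarrow> L2_norm m (\<lambda>z. h (z + t *\<^sub>R k) - h z) < \<eta>"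
    using shift_continuous_L2[OF h \<eta>] by blast
  show ?thesis
  proof (intro exI[of _ \<delta>] conjI allI impI \<delta>(1))
    fix t assume t: "\<bar>t\<bar> < \<delta>"
    define d where "d z = \<bar>h (z + t *\<^sub>R k) - h z\<bar>" for z
    have dm [measurable]: "d \<in> borel_measurable m"
      unfolding d_def using trig_limits_m_shift[OF h] trig_limits_m[OF h] by measurable
    have db: "d z \<le> 2 * C" "0 \<le> d z" for z
      using C(2)[of z] C(2)[of "z + t *\<^sub>R k"] unfolding d_def by linarith+
    have d2: "integrable m (\<lambda>z. (d z)\<^sup>2)"
      using L2_bounded(1)[OF dm, of "2 * C"] db by (simp add: L2_def)
    \<comment> \<open>\<open>d z \<le> (d z)\<^sup>2 / \<eta> + \<eta>\<close> trades the first
      power for the square that is controlled in L2. With \<eta> = \<epsilon> / (4 (N + 1)) the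
      truncated part costs at most \<epsilon>/2, and the tail costs less than \<epsilon>/2.\<close>
    have pt: "d z * \<bar>w z\<bar> \<le> 2 * C * R N z + real N * ((d z)\<^sup>2 / \<eta> + \<eta>)" for z
    proof -
      have "d z \<le> (d z)\<^sup>2 / \<eta> + \<eta>"
      proof (cases "d z \<le> \<eta>")
        case True
        then show ?thesis using \<eta> by (simp add: add_increasing)
      next
        case False
        then have "d z \<le> (d z)\<^sup>2 / \<eta>"
          using \<eta> by (simp add: field_simps power2_eq_square)
        then show ?thesis using \<eta> by simp
      qed
      then have 1: "real N * d z \<le> real N * ((d z)\<^sup>2 / \<eta> + \<eta>)" by (intro mult_left_mono) auto
      have "d z * \<bar>w z\<bar> \<le> d z * (R N z + real N)"
        using db by (intro mult_left_mono) (auto simp: R_def)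
      also have "\<dots> \<le> 2 * C * R N z + real N * d z"
        using mult_right_mono[OF db(1)[of z], of "R N z"] by (simp add: R_def algebra_simps)
      finally show ?thesis using 1 by linarith
    qed
    have i: "integrable m (\<lambda>z. 2 * C * R N z + real N * ((d z)\<^sup>2 / \<eta> + \<eta>))"
      using Ri d2 by simp
    have "(\<integral>z. d z * \<bar>w z\<bar> \<partial>m) \<le> (\<integral>z. 2 * C * R N z + real N * ((d z)\<^sup>2 / \<eta> + \<eta>) \<partial>m)"
      using db by (intro integral_mono i pt integrable_bounded_mult[of m "\<lambda>z. \<bar>w z\<bar>" d "2 * C"]) (auto simp: w)
    also have "\<dots> = 2 * C * (\<integral>z. R N z \<partial>m) + real N * ((\<integral>z. (d z)\<^sup>2 \<partial>m) / \<eta> + \<eta>)"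
      using Ri d2 by simp
    also have "\<dots> < \<epsilon>"
    proof -
      have "2 * C * (\<integral>z. R N z \<partial>m) < \<epsilon> / 2"
        using N C(1) by (simp add: field_simps)
      moreover have "(\<integral>z. (d z)\<^sup>2 \<partial>m) \<le> \<eta>\<^sup>2"
        using power_strict_mono[OF \<delta>(2)[OF t] L2_norm_nonneg, of 2] by (simp add: d_def L2_norm_square)
      then have "(\<integral>z. (d z)\<^sup>2 \<partial>m) / \<eta> \<le> \<eta>" using \<eta> by (simp add: pos_divide_le_eq power2_eq_square)
      then have "real N * ((\<integral>z. (d z)\<^sup>2 \<partial>m) / \<eta> + \<eta>) \<le> (real N + 1) * (\<eta> + \<eta>)"
        using \<eta> by (intro mult_mono) (auto intro!: add_nonneg_nonneg divide_nonneg_pos)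
      moreover have "(real N + 1) * (\<eta> + \<eta>) = \<epsilon> / 2"
      proof -
        have "real N + 1 \<noteq> 0" by linarith
        then show ?thesis unfolding \<eta>_def by (simp add: divide_simps)
      qed
      ultimately show ?thesis by linarith
    qed
    finally show "(\<integral>z. \<bar>h (z + t *\<^sub>R k) - h z\<bar> * \<bar>w z\<bar> \<partial>m) < \<epsilon>" by (simp add: d_def)
  qed
qed

text \<open>The average over the segment involves only shifts of size at most |t|.\<close>

lemma shift_integral_continuous:
  assumes h: "h \<in> trig_limits" and w: "integrable m w" and \<epsilon>: "0 < \<epsilon>"
  shows "\<exists>\<delta>>0. \<forall>t. \<bar>t\<bar> < \<delta> \<longrightarrow>
    \<bar>(\<integral>s. (\<integral>z. h (z + (t * s) *\<^sub>R k) * w z \<partial>m) \<partial>unif) - (\<integral>z. h z * w z \<partial>m)\<bar> \<le> \<epsilon>"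
proof -
  obtain C where C: "0 < C" "\<And>z. \<bar>h z\<bar> \<le> C" using trig_limits_boundedE[OF h] by blast
  note m1 = trig_limits_m_shift[OF h] and m2 = trig_limits_m[OF h]
  obtain \<delta> where \<delta>: "0 < \<delta>" "\<And>t. \<bar>t\<bar> < \<delta> \<Longrightarrow> (\<integral>z. \<bar>h (z + t *\<^sub>R k) - h z\<bar> * \<bar>w z\<bar> \<partial>m) < \<epsilon>"
    using shift_continuous_weighted[OF assms] by blast
  have close: "\<bar>(\<integral>z. h (z + r *\<^sub>R k) * w z \<partial>m) - (\<integral>z. h z * w z \<partial>m)\<bar> \<le> \<epsilon>" if "\<bar>r\<bar> < \<delta>" for r
  proof -
    have "(\<integral>z. h (z + r *\<^sub>R k) * w z \<partial>m) - (\<integral>z. h z * w z \<partial>m) = (\<integral>z. h (z + r *\<^sub>R k) * w z - h z * w z \<partial>m)"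
      by (intro Bochner_Integration.integral_diff[symmetric] integrable_bounded_mult[OF w m1 C(2)]
          integrable_bounded_mult[OF w m2 C(2)])
    also have "\<bar>\<dots>\<bar> \<le> (\<integral>z. \<bar>h (z + r *\<^sub>R k) * w z - h z * w z\<bar> \<partial>m)"
      by (rule integral_abs_bound)
    also have "\<dots> = (\<integral>z. \<bar>h (z + r *\<^sub>R k) - h z\<bar> * \<bar>w z\<bar> \<partial>m)"
      by (simp add: abs_mult[symmetric] left_diff_distrib)
    finally show ?thesis using \<delta>(2)[OF that] by simp
  qed
  show ?thesis
  proof (intro exI[of _ \<delta>] conjI allI impI \<delta>(1))
    fix t assume t: "\<bar>t\<bar> < \<delta>"
    show "\<bar>(\<integral>s. (\<integral>z. h (z + (t * s) *\<^sub>R k) * w z \<partial>m) \<partial>unif) - (\<integral>z. h z * w z \<partial>m)\<bar> \<le> \<epsilon>"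
    proof (rule unif_average_close)
      show "(\<lambda>s. \<integral>z. h (z + (t * s) *\<^sub>R k) * w z \<partial>m) \<in> borel_measurable borel"
        using h w by (intro shift_average_measurable trig_limits_measurable_dual_sigma) auto
      fix s :: real assume s: "0 \<le> s" "s \<le> 1"
      have "\<bar>t * s\<bar> \<le> \<bar>t\<bar> * 1" unfolding abs_mult using s by (intro mult_left_mono) auto
      then show "\<bar>(\<integral>z. h (z + (t * s) *\<^sub>R k) * w z \<partial>m) - (\<integral>z. h z * w z \<partial>m)\<bar> \<le> \<epsilon>"
        using t by (intro close) linarith
    qed
  qed
qed

section \<open>From weak identities to strong approximation of indicators\<close>

lemma trig_L2: "u \<in> trig \<Longrightarrow> u \<in> L2 m"
  by (metis trig_bounded_measurable L2_bounded(1))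

text \<open>For \<open>u \<ge> 0\<close> the map \<open>t \<mapsto> \<integral> u d(\<nu>\<^sub>t)\<^sup>+\<close>, where \<open>\<nu>\<^sub>t\<close> is the shift of \<open>\<nu> = f m\<close>, dominates
  \<open>t \<mapsto> \<integral> u 1\<^bsub>{f > 0}\<^esub> d\<nu>\<^sub>t\<close> with equality at \<open>t = 0\<close>, so that both have the same derivative there.\<close>

lemma ibp_pos_aux:
  assumes f: "ibp f" "f \<in> borel_measurable dual_sigma" and u: "u \<in> trig" "\<And>z. 0 \<le> u z"
  shows "(\<integral>z. dir_deriv k u z * max 0 (f z) \<partial>m) = - (\<integral>z. u z * (\<beta> z * max 0 (f z)) \<partial>m)"
proof -
  have fi: "integrable m f" "integrable m (\<lambda>z. \<beta> z * f z)" using f(1) by (auto simp: ibp_def)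
  define A where "A = {z. 0 < f z}"
  define h where "h z = u z * indicator A z" for z
  define g where "g z = max 0 (f z)" for z
  have gi: "integrable m g"
    unfolding g_def using fi by simp
  have "{z \<in> space dual_sigma. 0 < f z} \<in> sets dual_sigma" using f(2) by measurable
  then have "A \<in> sets dual_sigma" by (simp add: A_def)
  then have h: "h \<in> trig_limits"
    unfolding h_def by (intro trig_alg.mult indicator_trig_limits bdd_limits.base u)
  obtain C where C: "0 < C" "\<And>z. \<bar>h z\<bar> \<le> C" using trig_limits_boundedE[OF h] by blast
  define \<psi> where "\<psi> t = (\<integral>s. (\<integral>z. h (z + (t * s) *\<^sub>R k) * (\<beta> z * f z) \<partial>m) \<partial>unif)" for t
  define \<phi> where "\<phi> t = (\<integral>s. (\<integral>z. dir_deriv k u (z + (t * s) *\<^sub>R k) * g z \<partial>m) \<partial>unif)" for t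
  define a where "a = (\<integral>z. dir_deriv k u z * g z \<partial>m)"
  define c where "c = (\<integral>z. h z * (\<beta> z * f z) \<partial>m)"
  have hg: "h z * (\<beta> z * f z) = u z * (\<beta> z * g z)" "h z * f z = u z * g z" for z
    by (auto simp: h_def g_def A_def indicator_def max_def)
  have le: "- t * \<psi> t \<le> t * \<phi> t" for t
  proof -
    have "- t * \<psi> t = (\<integral>z. h (z + t *\<^sub>R k) * f z \<partial>m) - (\<integral>z. h z * f z \<partial>m)"
      unfolding \<psi>_def shift_formula[OF f(1) h] ..
    also have "\<dots> \<le> (\<integral>z. u (z + t *\<^sub>R k) * g z \<partial>m) - (\<integral>z. u z * g z \<partial>m)"
    proof -
      have "(\<integral>z. h (z + t *\<^sub>R k) * f z \<partial>m) \<le> (\<integral>z. u (z + t *\<^sub>R k) * g z \<partial>m)"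
      proof (rule integral_mono)
        show "integrable m (\<lambda>z. h (z + t *\<^sub>R k) * f z)"
          by (rule integrable_bounded_mult[OF fi(1) trig_limits_m_shift[OF h] C(2)])
        show "integrable m (\<lambda>z. u (z + t *\<^sub>R k) * g z)"
          by (intro trig_integrable_mult trig_shift u gi)
        \<comment> \<open>An indicator value times \<open>f z\<close> is at most
          \<open>max 0 (f z)\<close>, no matter how the set has been shifted; for the unshifted set
          this is an equality.\<close>
        show "h (z + t *\<^sub>R k) * f z \<le> u (z + t *\<^sub>R k) * g z" for z
          using u(2)[of "z + t *\<^sub>R k"]
          by (auto simp: h_def g_def indicator_def intro!: mult_left_mono)
      qed
      then show ?thesis by (simp add: hg)
    qed
    also have "\<dots> = t * \<phi> t"
      unfolding \<phi>_def by (rule trig_shift_increment[OF u(1) gi])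
    finally show ?thesis .
  qed
  have "\<bar>a + c\<bar> \<le> e" if e: "0 < e" for e
  proof -
    obtain \<delta>1 where 1: "0 < \<delta>1" "\<And>t. \<bar>t\<bar> < \<delta>1 \<Longrightarrow> \<bar>\<psi> t - c\<bar> \<le> e / 2"
      using shift_integral_continuous[OF h fi(2), of "e / 2"] e unfolding \<psi>_def c_def by auto
    obtain \<delta>2 where 2: "0 < \<delta>2" "\<And>t. \<bar>t\<bar> < \<delta>2 \<Longrightarrow> \<bar>\<phi> t - a\<bar> \<le> e / 2"
      using shift_integral_continuous[OF bdd_limits.base[OF trig_dir_deriv[OF u(1)]] gi, of "e / 2"] e
      unfolding \<phi>_def a_def by auto
    define t where "t = min \<delta>1 \<delta>2 / 2"
    have t: "0 < t" "\<bar>t\<bar> < \<delta>1" "\<bar>t\<bar> < \<delta>2" "\<bar>- t\<bar> < \<delta>1" "\<bar>- t\<bar> < \<delta>2"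
      using 1(1) 2(1) by (auto simp: t_def)
    \<comment> \<open>\<open>le\<close> at \<open>t\<close> and at \<open>- t\<close> gives opposite
      inequalities, and both sums are within \<open>e\<close> of \<open>a + c\<close>.\<close>
    have "0 \<le> t * (\<phi> t + \<psi> t)" "t * (\<phi> (- t) + \<psi> (- t)) \<le> 0"
      using le[of t] le[of "- t"] by (auto simp: algebra_simps)
    then have "0 \<le> \<phi> t + \<psi> t" "\<phi> (- t) + \<psi> (- t) \<le> 0"
      using t(1) by (auto simp: zero_le_mult_iff mult_le_0_iff)
    then show ?thesis
      using 1(2)[OF t(2)] 1(2)[OF t(4)] 2(2)[OF t(3)] 2(2)[OF t(5)] by linarith
  qed
  then have "\<And>e. 0 < e \<Longrightarrow> \<bar>a + c\<bar> \<le> 0 + e" by simp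
  then have "\<bar>a + c\<bar> \<le> 0" by (rule field_le_epsilon)
  then have "a = - c" by simp
  then show ?thesis by (simp add: a_def c_def hg) (simp add: g_def)
qed

text \<open>A signed test function becomes nonnegative after adding a constant; the constant is
  itself an admissible test function, so its contribution can be subtracted again.\<close>

lemma ibp_pos:
  assumes f: "ibp f" "f \<in> borel_measurable dual_sigma"
  shows "ibp (\<lambda>z. max 0 (f z))"
proof -
  have fi: "integrable m f" "integrable m (\<lambda>z. \<beta> z * f z)" using f(1) by (auto simp: ibp_def)
  have gi: "integrable m (\<lambda>z. max 0 (f z))" using fi by simp
  have \<beta>gi: "integrable m (\<lambda>z. \<beta> z * max 0 (f z))"
  proof (rule Bochner_Integration.integrable_bound[OF fi(2)])
    show "(\<lambda>z. \<beta> z * max 0 (f z)) \<in> borel_measurable m" using gi by measurable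
    have "\<bar>max 0 (f z)\<bar> \<le> \<bar>f z\<bar>" for z by simp
    then show "AE z in m. norm (\<beta> z * max 0 (f z)) \<le> norm (\<beta> z * f z)"
      by (intro AE_I2) (simp add: abs_mult mult_left_mono)
  qed
  have "(\<integral>z. dir_deriv k u z * max 0 (f z) \<partial>m) = - (\<integral>z. u z * (\<beta> z * max 0 (f z)) \<partial>m)"
    if u: "u \<in> trig" for u
  proof -
    obtain C where C: "0 < C" "\<And>z. \<bar>u z\<bar> \<le> C" using trig_limits_boundedE[OF bdd_limits.base[OF u]] by blast
    have uC: "(\<lambda>z. u z + C) \<in> trig" by (intro trig.add u trig_const)
    have "(\<integral>z. dir_deriv k (\<lambda>z. u z + C) z * max 0 (f z) \<partial>m) = - (\<integral>z. (u z + C) * (\<beta> z * max 0 (f z)) \<partial>m)"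
    proof (rule ibp_pos_aux[OF f uC])
      show "0 \<le> u z + C" for z using C(2)[of z] by linarith
    qed
    moreover have "dir_deriv k (\<lambda>z. u z + C) = dir_deriv k u"
      using dir_deriv_add[OF trig_subset_FCb[OF u] FCb_const, of k C] by (simp add: dir_deriv_const)
    moreover have "(\<integral>z. (u z + C) * (\<beta> z * max 0 (f z)) \<partial>m) =
        (\<integral>z. u z * (\<beta> z * max 0 (f z)) \<partial>m) + (\<integral>z. C * (\<beta> z * max 0 (f z)) \<partial>m)"
      using trig_integrable_mult[OF u \<beta>gi] \<beta>gi by (simp add: distrib_right)
    moreover have "(\<integral>z. dir_deriv k (\<lambda>_. C) z * max 0 (f z) \<partial>m) = - (\<integral>z. C * (\<beta> z * max 0 (f z)) \<partial>m)"
      using C(1) by (intro ibp_pos_aux[OF f trig_const]) simp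
    ultimately show ?thesis by (simp add: dir_deriv_const)
  qed
  with gi \<beta>gi show ?thesis by (simp add: ibp_def)
qed

text \<open>With g = max 0 (f - c), the functions min 1 (n g) = 1 - max 0 (1 - n g) converge to the
  indicator and are built from constants, linear combinations and positive parts only.\<close>

lemma ibp_indicator_greater:
  assumes f: "ibp f" "f \<in> borel_measurable dual_sigma"
  shows "ibp (indicator {z. c < f z})"
proof -
  \<comment> \<open>The explicit factors 1 match the shape of \<open>ibp_add\<close>.\<close>
  define g where "g z = max 0 (1 * f z + (- c) * 1)" for z
  have g: "ibp g" "g \<in> borel_measurable dual_sigma"
    using ibp_pos[OF ibp_add[OF f(1) ibp_one, of 1 "- c"]] f(2) unfolding g_def by simp_all
  define q where "q n z = 1 * 1 + (- 1) * max 0 (1 * 1 + (- real n) * g z)" for n z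
  show ?thesis
  proof (rule ibp_limit[of q])
    show "ibp (q n)" for n
      unfolding q_def using g(2) by (intro ibp_add ibp_one ibp_pos g) simp_all
    have g0: "0 \<le> g z" for z by (simp add: g_def)
    show "\<bar>q n z\<bar> \<le> 1" for n z
      using mult_nonneg_nonneg[OF of_nat_0_le_iff[of n] g0[of z]] unfolding q_def by (simp add: max_def)
    show "(\<lambda>n. q n z) \<longlonglongrightarrow> indicator {z. c < f z} z" for z
    proof (cases "c < f z")
      case True
      then have gz: "0 < g z" by (simp add: g_def)
      obtain N where N: "1 < real N * g z" using reals_Archimedean3[OF gz] by blast
      have "q n z = 1" if "N \<le> n" for n
      proof -
        have "real N * g z \<le> real n * g z" using that gz by (intro mult_right_mono) auto
        then show ?thesis using N by (simp add: q_def)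
      qed
      then show ?thesis
        using True by (intro tendsto_eventually eventually_mono[OF eventually_ge_at_top[of N]]) simp
    qed (simp add: q_def g_def)
  qed
qed

text \<open>The Hellinger-type estimate: the flux of the shifted measure \<open>1\<^sub>A m\<close> into the complement of \<open>A\<close>
  is bounded by the square root of the mass that is already there.\<close>

lemma shift_flux:
  assumes A: "A \<in> sets dual_sigma" and ibp: "ibp (indicator A)" and \<epsilon>: "0 < \<epsilon>"
  shows "\<exists>\<delta>>0. \<forall>t. \<bar>t\<bar> < \<delta> \<longrightarrow> (\<integral>z. indicator (- A) (z + t *\<^sub>R k) * indicator A z \<partial>m) \<le> \<epsilon> * t\<^sup>2"
proof -
  define h where "h = (indicator (- A) :: 'a \<Rightarrow> real)"
  have "- A \<in> sets dual_sigma" using sets.compl_sets[OF A] by (simp add: Compl_eq_Diff_UNIV)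
  then have h: "h \<in> trig_limits" unfolding h_def by (rule indicator_trig_limits)
  note hm = trig_limits_m_shift[OF h]
  have Am: "(indicator A :: 'a \<Rightarrow> real) \<in> borel_measurable m"
    using trig_limits_m[OF indicator_trig_limits[OF A]] .
  have Ai: "integrable m (indicator A :: 'a \<Rightarrow> real)" "integrable m (\<lambda>z. \<beta> z * indicator A z)"
    using ibp by (auto simp: ibp_def)
  define \<phi> where "\<phi> t = (\<integral>z. h (z + t *\<^sub>R k) * indicator A z \<partial>m)" for t
  \<comment> \<open>With the weight \<beta>^2: for small shifts, the set on which the indicator
    changes carries less than \<epsilon> of the integral of \<beta>^2.\<close>
  obtain \<delta> where \<delta>: "0 < \<delta>"
    "\<And>t. \<bar>t\<bar> < \<delta> \<Longrightarrow> (\<integral>z. \<bar>h (z + t *\<^sub>R k) - h z\<bar> * \<bar>(\<beta> z)\<^sup>2\<bar> \<partial>m) < \<epsilon>"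
    using shift_continuous_weighted[OF h \<beta>_square \<epsilon>] by blast
  have h01: "0 \<le> h z" "\<bar>h z\<bar> \<le> 1" for z by (auto simp: h_def)
  have i1: "integrable m (\<lambda>z. h (z + r *\<^sub>R k) * indicator A z)" for r
    using integrable_bounded_mult[OF Ai(1) hm h01(2)] .
  have \<phi>01: "0 \<le> \<phi> r" "\<phi> r \<le> 1" for r
  proof -
    show "0 \<le> \<phi> r" unfolding \<phi>_def by (intro integral_nonneg_AE AE_I2) (simp add: h01)
    have "\<phi> r \<le> (\<integral>z. 1 \<partial>m)"
      unfolding \<phi>_def by (intro integral_mono i1) (auto simp: h_def indicator_def)
    then show "\<phi> r \<le> 1" by simp
  qed
  \<comment> \<open>Cauchy-Schwarz in additive form with a free parameter \<open>\<kappa>\<close>,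
    which keeps the bound linear in \<open>\<phi>\<close>.\<close>
  have flux: "\<bar>\<integral>z. h (z + r *\<^sub>R k) * (\<beta> z * indicator A z) \<partial>m\<bar> \<le> (\<phi> r / \<kappa> + \<kappa> * \<epsilon>) / 2"
    if r: "\<bar>r\<bar> < \<delta>" and \<kappa>: "0 < \<kappa>" for r \<kappa>
  proof -
    define X where "X z = h (z + r *\<^sub>R k) * indicator A z" for z
    have X: "X z \<in> {0, 1}" "0 \<le> X z" for z by (auto simp: X_def h_def indicator_def)
    have Xm: "X \<in> borel_measurable m" unfolding X_def using hm Am by measurable
    \<comment> \<open>\<open>X z = 1\<close> means that \<open>z\<close> lies in \<open>A\<close>
      and its shift does not.\<close>
    have XD: "X z \<le> \<bar>h (z + r *\<^sub>R k) - h z\<bar>" for z by (auto simp: X_def h_def indicator_def)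
    have Xb: "\<bar>X z\<bar> \<le> 1" for z using X(1)[of z] by auto
    have iX: "integrable m (\<lambda>z. X z * (\<beta> z)\<^sup>2)"
      by (rule integrable_bounded_mult[OF \<beta>_square Xm Xb])
    have iX1: "integrable m X" using i1[of r] by (simp add: X_def[abs_def])
    have am: "\<bar>x * b\<bar> \<le> (x / \<kappa> + \<kappa> * (x * b\<^sup>2)) / 2" if "x \<in> {0, 1}" for x b
    proof -
      have "0 \<le> (1 - \<kappa> * \<bar>b\<bar>)\<^sup>2 / \<kappa>" using \<kappa> by simp
      also have "\<dots> = 1 / \<kappa> - 2 * \<bar>b\<bar> + \<kappa> * b\<^sup>2"
        using \<kappa> by (simp add: field_simps power2_eq_square)
      finally show ?thesis using that by auto
    qed
    have "\<bar>\<integral>z. h (z + r *\<^sub>R k) * (\<beta> z * indicator A z) \<partial>m\<bar> = \<bar>\<integral>z. X z * \<beta> z \<partial>m\<bar>"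
      by (simp add: X_def ac_simps)
    also have "\<dots> \<le> (\<integral>z. \<bar>X z * \<beta> z\<bar> \<partial>m)" by (rule integral_abs_bound)
    also have "\<dots> \<le> (\<integral>z. (X z / \<kappa> + \<kappa> * (X z * (\<beta> z)\<^sup>2)) / 2 \<partial>m)"
      using iX iX1 by (intro integral_mono am X integrable_abs integrable_bounded_mult[OF \<beta>_integrable Xm Xb]) simp
    also have "\<dots> = ((\<integral>z. X z \<partial>m) / \<kappa> + \<kappa> * (\<integral>z. X z * (\<beta> z)\<^sup>2 \<partial>m)) / 2"
      using iX iX1 by simp
    also have "(\<integral>z. X z \<partial>m) = \<phi> r" by (simp add: X_def \<phi>_def)
    also have "(\<integral>z. X z * (\<beta> z)\<^sup>2 \<partial>m) \<le> \<epsilon>"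
    proof -
      have "(\<integral>z. X z * (\<beta> z)\<^sup>2 \<partial>m) \<le> (\<integral>z. \<bar>h (z + r *\<^sub>R k) - h z\<bar> * \<bar>(\<beta> z)\<^sup>2\<bar> \<partial>m)"
      proof (rule integral_mono[OF iX])
        have b: "\<bar>\<bar>h (z + r *\<^sub>R k) - h z\<bar>\<bar> \<le> 1" for z by (auto simp: h_def indicator_def)
        show "integrable m (\<lambda>z. \<bar>h (z + r *\<^sub>R k) - h z\<bar> * \<bar>(\<beta> z)\<^sup>2\<bar>)"
          using \<beta>_square hm trig_limits_m[OF h] by (intro integrable_bounded_mult[OF _ _ b]) auto
        show "X z * (\<beta> z)\<^sup>2 \<le> \<bar>h (z + r *\<^sub>R k) - h z\<bar> * \<bar>(\<beta> z)\<^sup>2\<bar>" for z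
          using XD by (simp add: mult_right_mono)
      qed
      then show ?thesis using \<delta>(2)[OF r] by linarith
    qed
    finally show ?thesis using \<kappa> by (simp add: mult_left_mono divide_right_mono)
  qed
  have "\<phi> t \<le> \<epsilon> * t\<^sup>2" if t: "\<bar>t\<bar> < \<delta>" for t
  proof (cases "t = 0")
    case True
    have "\<phi> 0 = (\<integral>z. 0 \<partial>m)"
      unfolding \<phi>_def by (intro Bochner_Integration.integral_cong) (auto simp: h_def indicator_def)
    then show ?thesis using True by simp
  next
    case False
    \<comment> \<open>\<open>S\<close> bounds \<open>\<phi>\<close> for all shifts up to size |t|
      and is finite since \<open>\<phi>\<close> is at most 1. The inequality S \<le> (S + \<epsilon>
      t^2) / 2 then absorbs S and gives S \<le> \<epsilon> t^2; it takes the place of solving a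
      differential inequality.\<close>
    define S where "S = (SUP r\<in>{- \<bar>t\<bar>..\<bar>t\<bar>}. \<phi> r)"
    have bdd: "bdd_above (\<phi> ` {- \<bar>t\<bar>..\<bar>t\<bar>})"
      using \<phi>01 by (intro bdd_aboveI[of _ 1]) auto
    have S: "\<phi> r \<le> S" if "\<bar>r\<bar> \<le> \<bar>t\<bar>" for r
      unfolding S_def using that by (intro cSUP_upper bdd) auto
    have "S \<le> (S + \<epsilon> * t\<^sup>2) / 2"
      unfolding S_def
    proof (rule cSUP_least)
      fix r assume "r \<in> {- \<bar>t\<bar>..\<bar>t\<bar>}"
      then have r: "\<bar>r\<bar> \<le> \<bar>t\<bar>" by auto
      have close: "\<bar>(\<integral>s. (\<integral>z. h (z + (r * s) *\<^sub>R k) * (\<beta> z * indicator A z) \<partial>m) \<partial>unif) - 0\<bar> \<le> (S / \<bar>t\<bar> + \<bar>t\<bar> * \<epsilon>) / 2"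
      proof (rule unif_average_close)
        show "(\<lambda>s. \<integral>z. h (z + (r * s) *\<^sub>R k) * (\<beta> z * indicator A z) \<partial>m) \<in> borel_measurable borel"
          using Ai by (intro shift_average_measurable trig_limits_measurable_dual_sigma h) auto
        fix s :: real assume s: "0 \<le> s" "s \<le> 1"
        have "\<bar>r * s\<bar> \<le> \<bar>r\<bar> * 1" unfolding abs_mult using s by (intro mult_left_mono) auto
        then have rs: "\<bar>r * s\<bar> \<le> \<bar>t\<bar>" using r by linarith
        \<comment> \<open>The choice \<kappa> = |t| turns the two terms, once multiplied by |t|,
          into S and \<epsilon> t^2.\<close>
        have "\<bar>\<integral>z. h (z + (r * s) *\<^sub>R k) * (\<beta> z * indicator A z) \<partial>m\<bar> \<le> (\<phi> (r * s) / \<bar>t\<bar> + \<bar>t\<bar> * \<epsilon>) / 2"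
          using rs t False by (intro flux) auto
        also have "\<dots> \<le> (S / \<bar>t\<bar> + \<bar>t\<bar> * \<epsilon>) / 2"
          using S[OF rs] by (simp add: divide_right_mono)
        finally show "\<bar>(\<integral>z. h (z + (r * s) *\<^sub>R k) * (\<beta> z * indicator A z) \<partial>m) - 0\<bar> \<le> (S / \<bar>t\<bar> + \<bar>t\<bar> * \<epsilon>) / 2"
          by simp
      qed
      have zero: "(\<integral>z. h z * indicator A z \<partial>m) = (\<integral>z. 0 \<partial>m)"
        by (intro Bochner_Integration.integral_cong) (auto simp: h_def indicator_def)
      have eq: "\<phi> r - (\<integral>z. h z * indicator A z \<partial>m) =
          - r * (\<integral>s. (\<integral>z. h (z + (r * s) *\<^sub>R k) * (\<beta> z * indicator A z) \<partial>m) \<partial>unif)"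
        unfolding \<phi>_def by (rule shift_formula[OF ibp h])
      have prod: "- r * x \<le> \<bar>r\<bar> * y" if "\<bar>x - 0\<bar> \<le> y" for x y :: real
      proof -
        have "- r * x \<le> \<bar>r\<bar> * \<bar>x\<bar>" by (simp flip: abs_mult)
        also have "\<dots> \<le> \<bar>r\<bar> * y" using that by (intro mult_left_mono) auto
        finally show ?thesis .
      qed
      have "\<phi> r = - r * (\<integral>s. (\<integral>z. h (z + (r * s) *\<^sub>R k) * (\<beta> z * indicator A z) \<partial>m) \<partial>unif)"
        using eq zero by simp
      also have "\<dots> \<le> \<bar>r\<bar> * ((S / \<bar>t\<bar> + \<bar>t\<bar> * \<epsilon>) / 2)"
        by (rule prod[OF close])
      also have "\<dots> \<le> \<bar>t\<bar> * ((S / \<bar>t\<bar> + \<bar>t\<bar> * \<epsilon>) / 2)"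
        using r \<phi>01(1)[of 0] S[of 0] \<epsilon> by (intro mult_right_mono) auto
      also have "\<dots> = (S + \<epsilon> * t\<^sup>2) / 2"
        using False by (simp add: field_simps power2_eq_square abs_mult_self_eq)
      finally show "\<phi> r \<le> ((SUP r\<in>{- \<bar>t\<bar>..\<bar>t\<bar>}. \<phi> r) + \<epsilon> * t\<^sup>2) / 2"
        unfolding S_def .
    qed auto
    then show ?thesis using S[of t] by simp
  qed
  then show ?thesis using \<delta>(1) unfolding \<phi>_def h_def by blast
qed

text \<open>Averaging commutes with bounded limits, and since \<open>t\<close> is fixed the factor 1
  / t in the difference quotients is harmless. One \<open>v\<close> has to serve both estimates,
  hence the joint induction.\<close>

lemma trig_average_approx:
  assumes t: "t \<noteq> 0" and "h \<in> trig_limits"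
  shows "0 < \<epsilon> \<Longrightarrow> \<exists>v\<in>trig. L2_norm m (\<lambda>z. v z - (\<integral>s. h (z + (t * s) *\<^sub>R k) \<partial>unif)) < \<epsilon> \<and>
    L2_norm m (\<lambda>z. dir_deriv k v z - (h (z + t *\<^sub>R k) - h z) / t) < \<epsilon>"
  using assms(2)
proof (induction arbitrary: \<epsilon> rule: bdd_limits.induct)
  case (base u)
  obtain v where v: "v \<in> trig" "\<And>z. v z = (\<integral>s. u (z + (t * s) *\<^sub>R k) \<partial>unif)"
    "\<And>z. dir_deriv k v z = (u (z + t *\<^sub>R k) - u z) / t"
    using trig_average[OF t base(1), of k] by blast
  have "L2_norm m (\<lambda>z. v z - (\<integral>s. u (z + (t * s) *\<^sub>R k) \<partial>unif)) = 0"
    by (simp add: v(2) L2_norm_def)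
  moreover have "L2_norm m (\<lambda>z. dir_deriv k v z - (u (z + t *\<^sub>R k) - u z) / t) = 0"
    by (simp add: v(3) L2_norm_def)
  ultimately show ?case using v(1) base(2) by (intro bexI[of _ v] conjI) simp_all
next
  case (lim h C g)
  define P where "P h z = (\<integral>s. h (z + (t * s) *\<^sub>R k) \<partial>unif)" for h :: "'a \<Rightarrow> real" and z
  define Q where "Q h z = (h (z + t *\<^sub>R k) - h z) / t" for h :: "'a \<Rightarrow> real" and z
  have g: "g \<in> trig_limits" using lim(1-3) by (rule bdd_limits.lim)
  have gb: "\<bar>g z\<bar> \<le> C" for z
    using LIMSEQ_le_const2[OF tendsto_rabs[OF lim(3)[of z]]] lim(2) by blast
  have Pm: "P h \<in> borel_measurable m" and Qm: "Q h \<in> borel_measurable m" if "h \<in> trig_limits" for h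
    unfolding P_def Q_def
    using line_average_measurable[OF trig_limits_measurable_dual_sigma[OF that]]
      trig_limits_m[OF that] trig_limits_m_shift[OF that] by measurable
  note lm = line_measurable[OF trig_limits_measurable_dual_sigma]
  have Pb: "\<bar>P h z\<bar> \<le> C" if "h \<in> trig_limits" "\<And>z. \<bar>h z\<bar> \<le> C" for h z
  proof -
    have "\<bar>P h z - 0\<bar> \<le> C"
      unfolding P_def by (rule unif_average_close[OF lm[OF that(1)]]) (simp add: that(2))
    then show ?thesis by simp
  qed
  have Plim: "(\<lambda>n. P (h n) z) \<longlonglongrightarrow> P g z" for z
  proof -
    have "(\<lambda>n. \<integral>s. h n (z + (t * s) *\<^sub>R k) * 1 \<partial>unif) \<longlonglongrightarrow> (\<integral>s. g (z + (t * s) *\<^sub>R k) * 1 \<partial>unif)"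
      using lim(2,3) lm[OF lim(1)]
      by (intro integral_dominated_limit) (auto simp: measurable_cong_sets[OF sets_unif refl])
    then show ?thesis by (simp add: P_def)
  qed
  have Qb: "\<bar>Q h z\<bar> \<le> 2 * C / \<bar>t\<bar>" if "\<And>z. \<bar>h z\<bar> \<le> C" for h z
  proof -
    have "\<bar>h (z + t *\<^sub>R k) - h z\<bar> \<le> 2 * C" using that[of z] that[of "z + t *\<^sub>R k"] by linarith
    then show ?thesis unfolding Q_def abs_divide by (intro divide_right_mono) auto
  qed
  have Qlim: "(\<lambda>n. Q (h n) z) \<longlonglongrightarrow> Q g z" for z
    unfolding Q_def using t by (intro tendsto_intros lim(3))
  note PL = L2_bounded(1)[OF Pm[OF lim(1)] Pb[OF lim(1) lim(2)]] L2_bounded(1)[OF Pm[OF g] Pb[OF g gb]]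
  note QL = L2_bounded(1)[OF Qm[OF lim(1)] Qb[OF lim(2)]] L2_bounded(1)[OF Qm[OF g] Qb[OF gb]]
  have "(\<lambda>n. L2_norm m (\<lambda>z. P (h n) z - P g z)) \<longlonglongrightarrow> 0"
    by (rule L2_norm_tendsto_bounded[OF Pm[OF lim(1)] Pb[OF lim(1) lim(2)] Plim])
  moreover have "(\<lambda>n. L2_norm m (\<lambda>z. Q (h n) z - Q g z)) \<longlonglongrightarrow> 0"
    by (rule L2_norm_tendsto_bounded[OF Qm[OF lim(1)] Qb[OF lim(2)] Qlim])
  ultimately have "\<forall>\<^sub>F n in sequentially. L2_norm m (\<lambda>z. P (h n) z - P g z) < \<epsilon> / 2 \<and>
      L2_norm m (\<lambda>z. Q (h n) z - Q g z) < \<epsilon> / 2"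
    using \<open>0 < \<epsilon>\<close> by (intro eventually_conj order_tendstoD(2)) auto
  then obtain n where n: "L2_norm m (\<lambda>z. P (h n) z - P g z) < \<epsilon> / 2" "L2_norm m (\<lambda>z. Q (h n) z - Q g z) < \<epsilon> / 2"
    using eventually_happens'[OF sequentially_bot] by blast
  obtain v where v: "v \<in> trig" "L2_norm m (\<lambda>z. v z - P (h n) z) < \<epsilon> / 2"
    "L2_norm m (\<lambda>z. dir_deriv k v z - Q (h n) z) < \<epsilon> / 2"
    using lim(4)[of "\<epsilon> / 2" n] \<open>0 < \<epsilon>\<close> unfolding P_def Q_def by auto
  have "L2_norm m (\<lambda>z. v z - P g z) < \<epsilon>"
    using L2_norm_triangle_diff[OF trig_L2[OF v(1)] PL, of n] v(2) n(1) by linarith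
  moreover have "L2_norm m (\<lambda>z. dir_deriv k v z - Q g z) < \<epsilon>"
    using L2_norm_triangle_diff[OF trig_L2[OF trig_dir_deriv[OF v(1)]] QL, of k n] v(3) n(2) by linarith
  ultimately show ?case using v(1) unfolding P_def Q_def by blast
qed

lemma ibp_indicator_approx:
  assumes A: "A \<in> sets dual_sigma" and ibp: "ibp (indicator A)" and \<epsilon>: "0 < \<epsilon>"
  shows "\<exists>v\<in>trig. L2_norm m (\<lambda>z. v z - indicator A z) < \<epsilon> \<and> L2_norm m (dir_deriv k v) < \<epsilon>"
proof -
  define g where "g = (indicator A :: 'a \<Rightarrow> real)"
  have g: "g \<in> trig_limits" unfolding g_def by (rule indicator_trig_limits[OF A])
  have gm: "g \<in> borel_measurable m" by (rule trig_limits_m[OF g])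
  have gs: "(\<lambda>z. g (z + t *\<^sub>R k)) \<in> borel_measurable m" for t by (rule trig_limits_m_shift[OF g])
  have g01: "g z = 0 \<or> g z = 1" for z by (auto simp: g_def indicator_def)
  have gb: "\<bar>g z\<bar> \<le> 1" for z using g01[of z] by auto
  have A': "- A \<in> sets dual_sigma" using sets.compl_sets[OF A] by (simp add: Compl_eq_Diff_UNIV)
  \<comment> \<open>Points may also enter \<open>A\<close> under the shift. This is the flux for the
    complement, which satisfies the same identity by linearity.\<close>
  have "(\<lambda>z. 1 * 1 + (- 1) * indicator A z) = (indicator (- A) :: 'a \<Rightarrow> real)"
    by (auto simp: indicator_def)
  then have ibp': "ibp (indicator (- A))" using ibp_add[OF ibp_one ibp, of 1 "- 1"] by simp
  \<comment> \<open>Two fluxes of \<epsilon>^2/8 t^2 give the difference quotient a norm of at most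
    \<epsilon>/2; the other \<epsilon>/2 is spent on \<open>v\<close>.\<close>
  obtain \<delta>1 where 1: "0 < \<delta>1"
    "\<And>t. \<bar>t\<bar> < \<delta>1 \<Longrightarrow> (\<integral>z. indicator (- A) (z + t *\<^sub>R k) * indicator A z \<partial>m) \<le> \<epsilon>\<^sup>2 / 8 * t\<^sup>2"
    using shift_flux[OF A ibp, of "\<epsilon>\<^sup>2 / 8"] \<epsilon> by auto
  obtain \<delta>2 where 2: "0 < \<delta>2"
    "\<And>t. \<bar>t\<bar> < \<delta>2 \<Longrightarrow> (\<integral>z. indicator A (z + t *\<^sub>R k) * indicator (- A) z \<partial>m) \<le> \<epsilon>\<^sup>2 / 8 * t\<^sup>2"
    using shift_flux[OF A' ibp', of "\<epsilon>\<^sup>2 / 8"] \<epsilon> by auto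
  have D: "(\<integral>z. (g (z + t *\<^sub>R k) - g z)\<^sup>2 \<partial>m) \<le> \<epsilon>\<^sup>2 / 4 * t\<^sup>2" if "\<bar>t\<bar> < \<delta>1" "\<bar>t\<bar> < \<delta>2" for t
  proof -
    have i: "integrable m (\<lambda>z. indicator (- A) (z + t *\<^sub>R k) * (indicator A z :: real))"
      "integrable m (\<lambda>z. indicator A (z + t *\<^sub>R k) * (indicator (- A) z :: real))"
      using integrable_bounded_mult[OF _ trig_limits_m_shift[OF indicator_trig_limits[OF A'], of t],
          of "indicator A" 1] integrable_bounded_mult[OF _ trig_limits_m_shift[OF indicator_trig_limits[OF A], of t],
          of "indicator (- A)" 1] ibp ibp'
      by (simp_all add: ibp_def)
    have "(\<integral>z. (g (z + t *\<^sub>R k) - g z)\<^sup>2 \<partial>m) =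
        (\<integral>z. indicator (- A) (z + t *\<^sub>R k) * indicator A z + indicator A (z + t *\<^sub>R k) * indicator (- A) z \<partial>m)"
      by (intro Bochner_Integration.integral_cong) (auto simp: g_def indicator_def)
    also have "\<dots> = (\<integral>z. indicator (- A) (z + t *\<^sub>R k) * indicator A z \<partial>m) +
        (\<integral>z. indicator A (z + t *\<^sub>R k) * indicator (- A) z \<partial>m)"
      using i by simp
    finally show ?thesis using 1(2)[OF that(1)] 2(2)[OF that(2)] by linarith
  qed
  \<comment> \<open>The bound 1 serves to replace \<epsilon>^2/4 (t s)^2 by \<epsilon>^2/4.\<close>
  define t where "t = Min {\<delta>1, \<delta>2, 1} / 2"
  have t: "0 < t" "t < \<delta>1" "t < \<delta>2" "t < 1"
    using 1(1) 2(1) by (auto simp: t_def)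
  define P where "P z = (\<integral>s. g (z + (t * s) *\<^sub>R k) \<partial>unif)" for z
  obtain v where v: "v \<in> trig" "L2_norm m (\<lambda>z. v z - P z) < \<epsilon> / 2"
    "L2_norm m (\<lambda>z. dir_deriv k v z - (g (z + t *\<^sub>R k) - g z) / t) < \<epsilon> / 2"
    using trig_average_approx[OF _ g, of t "\<epsilon> / 2"] t(1) \<epsilon> unfolding P_def by auto
  have lm: "(\<lambda>s. g (z + (t * s) *\<^sub>R k)) \<in> borel_measurable borel" for z
    by (rule line_measurable[OF trig_limits_measurable_dual_sigma[OF g]])
  have Pm: "P \<in> borel_measurable m"
    unfolding P_def by (rule line_average_measurable[OF trig_limits_measurable_dual_sigma[OF g]])
  \<comment> \<open>Distance at most 1/2 from 1/2 puts \<open>P\<close> between 0 and 1 in a single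
    application of \<open>unif_average_close\<close>.\<close>
  have P12: "\<bar>P z - 1 / 2\<bar> \<le> 1 / 2" for z
    unfolding P_def
  proof (rule unif_average_close[OF lm])
    show "\<bar>g (z + (t * s) *\<^sub>R k) - 1 / 2\<bar> \<le> 1 / 2" for s using g01[of "z + (t * s) *\<^sub>R k"] by auto
  qed
  have P01: "0 \<le> P z" "P z \<le> 1" for z using P12[of z] by linarith+
  have Pb: "\<bar>P z\<bar> \<le> 1" for z using P01[of z] by simp
  note PL = L2_bounded(1)[OF Pm Pb] and gL = L2_bounded(1)[OF gm gb]
  \<comment> \<open>Since g^2 = g and P^2 \<le> P, the square (P - g)^2 is at most P (1 - 2 g) + g,
    which is affine in \<open>P\<close>. Fubini then expresses the integral of this bound as the
    average over \<open>s\<close> of the squared shift errors.\<close>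
  have Pg: "(\<integral>z. (P z - g z)\<^sup>2 \<partial>m) \<le> \<epsilon>\<^sup>2 / 4"
  proof -
    have f: "integrable m (\<lambda>z. 1 - 2 * g z)" using trig_limits_integrable[OF g] by simp
    have "\<bar>(\<integral>s. (\<integral>z. g (z + (t * s) *\<^sub>R k) * (1 - 2 * g z) \<partial>m) \<partial>unif) - - (\<integral>z. g z \<partial>m)\<bar> \<le> \<epsilon>\<^sup>2 / 4"
    proof (rule unif_average_close)
      show "(\<lambda>s. \<integral>z. g (z + (t * s) *\<^sub>R k) * (1 - 2 * g z) \<partial>m) \<in> borel_measurable borel"
        using f by (intro shift_average_measurable trig_limits_measurable_dual_sigma g) auto
      fix s :: real assume s: "0 \<le> s" "s \<le> 1"
      have ts: "\<bar>t * s\<bar> \<le> t" using t(1) s by (simp add: abs_mult mult_left_le)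
      have "(\<integral>z. g (z + (t * s) *\<^sub>R k) * (1 - 2 * g z) \<partial>m) - - (\<integral>z. g z \<partial>m) =
          (\<integral>z. g (z + (t * s) *\<^sub>R k) * (1 - 2 * g z) + g z \<partial>m)"
        using trig_limits_integrable[OF g] integrable_bounded_mult[OF f gs gb] by simp
      also have "\<dots> = (\<integral>z. (g (z + (t * s) *\<^sub>R k) - g z)\<^sup>2 \<partial>m)"
        by (intro Bochner_Integration.integral_cong) (auto simp: g_def indicator_def)
      finally have eq: "(\<integral>z. g (z + (t * s) *\<^sub>R k) * (1 - 2 * g z) \<partial>m) - - (\<integral>z. g z \<partial>m) =
          (\<integral>z. (g (z + (t * s) *\<^sub>R k) - g z)\<^sup>2 \<partial>m)" .
      have "(\<integral>z. (g (z + (t * s) *\<^sub>R k) - g z)\<^sup>2 \<partial>m) \<le> \<epsilon>\<^sup>2 / 4 * (t * s)\<^sup>2"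
        using ts t by (intro D) auto
      also have "\<dots> \<le> \<epsilon>\<^sup>2 / 4 * 1"
      proof -
        have "\<bar>t * s\<bar> \<le> 1" using ts t(4) by linarith
        then have "(t * s)\<^sup>2 \<le> 1" by (simp only: abs_square_le_1)
        then show ?thesis using \<epsilon> by (intro mult_left_mono) auto
      qed
      finally show "\<bar>(\<integral>z. g (z + (t * s) *\<^sub>R k) * (1 - 2 * g z) \<partial>m) - - (\<integral>z. g z \<partial>m)\<bar> \<le> \<epsilon>\<^sup>2 / 4"
        unfolding eq by simp
    qed
    from abs_le_D1[OF this] have "(\<integral>z. P z * (1 - 2 * g z) \<partial>m) + (\<integral>z. g z \<partial>m) \<le> \<epsilon>\<^sup>2 / 4"
      unfolding P_def shift_Fubini[OF trig_limits_measurable_dual_sigma[OF g] gb f, of t] by linarith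
    moreover have "(\<integral>z. (P z - g z)\<^sup>2 \<partial>m) \<le> (\<integral>z. P z * (1 - 2 * g z) + g z \<partial>m)"
    proof (rule integral_mono)
      show "integrable m (\<lambda>z. (P z - g z)\<^sup>2)"
        using L2_diff[OF PL gL] by (simp add: L2_def)
      show "integrable m (\<lambda>z. P z * (1 - 2 * g z) + g z)"
        using P01 by (intro Bochner_Integration.integrable_add trig_limits_integrable[OF g]
            integrable_bounded_mult[OF f Pm, of 1]) simp
      show "(P z - g z)\<^sup>2 \<le> P z * (1 - 2 * g z) + g z" for z
        using g01[of z] mult_left_le[OF P01(2) P01(1), of z z] by (auto simp: power2_eq_square algebra_simps)
    qed
    moreover have "(\<integral>z. P z * (1 - 2 * g z) + g z \<partial>m) = (\<integral>z. P z * (1 - 2 * g z) \<partial>m) + (\<integral>z. g z \<partial>m)"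
      using P01 by (intro Bochner_Integration.integral_add trig_limits_integrable[OF g]
            integrable_bounded_mult[OF f Pm, of 1]) simp
    ultimately show ?thesis by linarith
  qed
  have half: "L2_norm m f \<le> \<epsilon> / 2" if "(\<integral>z. (f z)\<^sup>2 \<partial>m) \<le> \<epsilon>\<^sup>2 / 4" for f :: "'a \<Rightarrow> real"
    by (rule power2_le_imp_le) (use that \<epsilon> in \<open>simp_all add: L2_norm_square power_divide\<close>)
  have 3: "L2_norm m (\<lambda>z. v z - g z) < \<epsilon>"
    using L2_norm_triangle_diff[OF trig_L2[OF v(1)] PL gL] v(2) half[OF Pg] by linarith
  define q where "q z = (g (z + t *\<^sub>R k) - g z) / t" for z
  have "(\<integral>z. (q z)\<^sup>2 \<partial>m) = (\<integral>z. (g (z + t *\<^sub>R k) - g z)\<^sup>2 \<partial>m) / t\<^sup>2"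
    unfolding q_def power_divide by simp
  also have "\<dots> \<le> \<epsilon>\<^sup>2 / 4"
    using D[of t] t by (simp add: pos_divide_le_eq)
  finally have q: "L2_norm m q \<le> \<epsilon> / 2" by (rule half)
  have "q \<in> L2 m"
  proof (rule L2_bounded(1))
    show "q \<in> borel_measurable m" unfolding q_def using gs gm by measurable
    show "\<bar>q z\<bar> \<le> 1 / t" for z
      unfolding q_def abs_divide using t(1) g01[of z] g01[of "z + t *\<^sub>R k"] by (intro frac_le) auto
  qed
  from L2_norm_triangle[OF L2_diff[OF trig_L2[OF trig_dir_deriv[OF v(1)]] this] this]
  have "L2_norm m (dir_deriv k v) \<le> L2_norm m (\<lambda>z. dir_deriv k v z - q z) + L2_norm m q" by simp
  then have "L2_norm m (dir_deriv k v) < \<epsilon>"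
    using v(3)[folded q_def] q by linarith
  with 3 v(1) show ?thesis unfolding g_def by blast
qed

section \<open>The closure of the directional forms\<close>

lemma FCb_m: "u \<in> FCb \<Longrightarrow> u \<in> borel_measurable m"
  by (intro m_measurable FCb_measurable_dual_sigma)

lemma FCb_integrable_mult:
  assumes "u \<in> FCb" "integrable m f"
  shows "integrable m (\<lambda>z. u z * f z)"
proof -
  obtain C where "\<And>z. \<bar>u z\<bar> \<le> C" using FCb_bounded[OF assms(1)] by blast
  then show ?thesis by (rule integrable_bounded_mult[OF assms(2) FCb_m[OF assms(1)]])
qed

lemma FCb_integrable: "u \<in> FCb \<Longrightarrow> integrable m u"
  using FCb_integrable_mult[of u "\<lambda>_. 1"] by simp

lemma FCb_mult_L2:
  assumes "u \<in> FCb" "f \<in> L2 m"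
  shows "(\<lambda>z. u z * f z) \<in> L2 m"
  using assms FCb_integrable_mult[OF FCb_mult[OF assms(1) assms(1)], of "\<lambda>z. (f z)\<^sup>2"] FCb_m[OF assms(1)]
  by (auto simp: L2_def power2_eq_square ac_simps)

lemma one_L2: "(\<lambda>_. 1) \<in> L2 m"
  by (simp add: L2_def)

lemma FCb_L2: "u \<in> FCb \<Longrightarrow> u \<in> L2 m"
  using FCb_mult_L2[OF _ one_L2] by simp

text \<open>Identifies the adjoint of the derivative on cylinder functions: \<open>v\<close> goes to
  minus (d_k v + \<beta> v), which is in L2 because \<open>v\<close> is bounded. Closability rests
  on this.\<close>

lemma ibp_product:
  assumes u: "u \<in> FCb" and v: "v \<in> FCb"
  shows "(\<integral>z. dir_deriv k u z * v z \<partial>m) = - (\<integral>z. u z * (dir_deriv k v z + v z * \<beta> z) \<partial>m)"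
proof -
  have i: "integrable m (\<lambda>z. dir_deriv k u z * v z)" "integrable m (\<lambda>z. dir_deriv k v z * u z)"
    "integrable m (\<lambda>z. u z * v z * \<beta> z)"
    using FCb_integrable[OF FCb_mult] FCb_integrable_mult[OF FCb_mult[OF u v] \<beta>_integrable] u v
    by (auto intro: FCb_dir_deriv)
  have "(\<integral>z. dir_deriv k u z * v z \<partial>m) + (\<integral>z. dir_deriv k v z * u z \<partial>m) = - (\<integral>z. u z * v z * \<beta> z \<partial>m)"
    using ibp_FCb[OF FCb_mult[OF u v]] i by (simp add: dir_deriv_mult[OF u v])
  moreover have "(\<integral>z. u z * (dir_deriv k v z + v z * \<beta> z) \<partial>m) =
      (\<integral>z. dir_deriv k v z * u z + u z * v z * \<beta> z \<partial>m)"
    by (simp add: algebra_simps)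
  ultimately show ?thesis using i by simp
qed

section \<open>Approximating sequences and closability\<close>

abbreviation approx :: "(nat \<Rightarrow> 'a \<Rightarrow> real) \<Rightarrow> ('a \<Rightarrow> real) \<Rightarrow> bool" where
  "approx \<equiv> approx_seq m FCb (pre_form m k)"

lemma approx_FCb: "approx f u \<Longrightarrow> f n \<in> FCb"
  by (simp add: approx_seq_def)

lemma pre_form_diff:
  "u \<in> FCb \<Longrightarrow> v \<in> FCb \<Longrightarrow> pre_form m k (\<lambda>x. u x - v x) (\<lambda>x. u x - v x) =
    (L2_norm m (\<lambda>x. dir_deriv k u x - dir_deriv k v x))\<^sup>2"
  by (simp add: pre_form_def dir_deriv_diff L2_norm_square) (simp add: power2_eq_square)

lemma approx_Cauchy:
  assumes "approx f u"
  shows "L2_Cauchy m (\<lambda>n. dir_deriv k (f n))"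
  unfolding L2_Cauchy_def
proof (intro conjI allI impI)
  show "dir_deriv k (f n) \<in> L2 m" for n
    by (intro FCb_L2 FCb_dir_deriv approx_FCb[OF assms])
  fix e :: real assume e: "0 < e"
  then obtain N where N: "\<And>i j. N \<le> i \<Longrightarrow> N \<le> j \<Longrightarrow> pre_form m k (\<lambda>x. f i x - f j x) (\<lambda>x. f i x - f j x) < e\<^sup>2"
    using assms unfolding approx_seq_def by (metis zero_less_power)
  show "\<exists>N. \<forall>i\<ge>N. \<forall>j\<ge>N. L2_norm m (\<lambda>x. dir_deriv k (f i) x - dir_deriv k (f j) x) < e"
  proof (intro exI[of _ N] allI impI)
    fix i j assume "N \<le> i" "N \<le> j"
    from N[OF this] have "(L2_norm m (\<lambda>x. dir_deriv k (f i) x - dir_deriv k (f j) x))\<^sup>2 < e\<^sup>2"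
      unfolding pre_form_diff[OF approx_FCb[OF assms] approx_FCb[OF assms]] .
    then show "L2_norm m (\<lambda>x. dir_deriv k (f i) x - dir_deriv k (f j) x) < e"
      using e by (rule power2_less_imp_less[OF _ less_imp_le])
  qed
qed

lemma approxI:
  assumes "\<And>n. f n \<in> FCb" "(\<lambda>n. L2_norm m (\<lambda>x. f n x - u x)) \<longlonglongrightarrow> 0" "L2_Cauchy m (\<lambda>n. dir_deriv k (f n))"
  shows "approx f u"
  unfolding approx_seq_def
proof (intro conjI allI impI assms(1))
  show "(\<lambda>n. \<integral>x. (f n x - u x)\<^sup>2 \<partial>m) \<longlonglongrightarrow> 0"
    using assms(2) unfolding tendsto_L2_norm_iff .
  fix e :: real assume e: "0 < e"
  then obtain N where N: "\<And>i j. N \<le> i \<Longrightarrow> N \<le> j \<Longrightarrow>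
      L2_norm m (\<lambda>x. dir_deriv k (f i) x - dir_deriv k (f j) x) < sqrt e"
    using assms(3) unfolding L2_Cauchy_def by (metis real_sqrt_gt_zero)
  show "\<exists>N. \<forall>i\<ge>N. \<forall>j\<ge>N. pre_form m k (\<lambda>x. f i x - f j x) (\<lambda>x. f i x - f j x) < e"
  proof (intro exI[of _ N] allI impI)
    fix i j assume "N \<le> i" "N \<le> j"
    from power_strict_mono[OF N[OF this] L2_norm_nonneg, of 2]
    show "pre_form m k (\<lambda>x. f i x - f j x) (\<lambda>x. f i x - f j x) < e"
      unfolding pre_form_diff[OF assms(1) assms(1)] using e by simp
  qed
qed

lemma approx_L2_tendsto: "approx f u \<Longrightarrow> (\<lambda>n. L2_norm m (\<lambda>x. f n x - u x)) \<longlonglongrightarrow> 0"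
  unfolding tendsto_L2_norm_iff approx_seq_def by blast

lemma approx_lin:
  assumes f: "approx f u" and g: "approx g v" and u: "u \<in> L2 m" and v: "v \<in> L2 m"
  shows "approx (\<lambda>n x. f n x + c * g n x) (\<lambda>x. u x + c * v x)"
proof (rule approxI)
  note F = approx_FCb[OF f] approx_FCb[OF g]
  show "(\<lambda>x. f n x + c * g n x) \<in> FCb" for n by (intro FCb_add FCb_scale F)
  show "(\<lambda>n. L2_norm m (\<lambda>x. f n x + c * g n x - (u x + c * v x))) \<longlonglongrightarrow> 0"
  proof (rule Lim_null_comparison)
    have "L2_norm m (\<lambda>x. f n x + c * g n x - (u x + c * v x)) \<le>
        L2_norm m (\<lambda>x. f n x - u x) + \<bar>c\<bar> * L2_norm m (\<lambda>x. g n x - v x)" for n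
    proof -
      have "L2_norm m (\<lambda>x. f n x + c * g n x - (u x + c * v x)) =
          L2_norm m (\<lambda>x. (f n x - u x) + c * (g n x - v x))" by (simp add: algebra_simps)
      also have "\<dots> \<le> L2_norm m (\<lambda>x. f n x - u x) + L2_norm m (\<lambda>x. c * (g n x - v x))"
        by (intro L2_norm_triangle L2_scale L2_diff FCb_L2 F u v)
      finally show ?thesis by (simp add: L2_norm_scale)
    qed
    then show "\<forall>\<^sub>F n in sequentially. norm (L2_norm m (\<lambda>x. f n x + c * g n x - (u x + c * v x))) \<le>
        L2_norm m (\<lambda>x. f n x - u x) + \<bar>c\<bar> * L2_norm m (\<lambda>x. g n x - v x)" by simp
    show "(\<lambda>n. L2_norm m (\<lambda>x. f n x - u x) + \<bar>c\<bar> * L2_norm m (\<lambda>x. g n x - v x)) \<longlonglongrightarrow> 0"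
      using tendsto_add[OF approx_L2_tendsto[OF f] tendsto_mult_left[OF approx_L2_tendsto[OF g], of "\<bar>c\<bar>"]] by simp
  qed
  have d: "dir_deriv k (\<lambda>x. f n x + c * g n x) = (\<lambda>x. dir_deriv k (f n) x + c * dir_deriv k (g n) x)" for n
    by (simp add: dir_deriv_add dir_deriv_scale FCb_scale F)
  note L = FCb_L2[OF FCb_dir_deriv[OF F(1)]] FCb_L2[OF FCb_dir_deriv[OF F(2)]]
  show "L2_Cauchy m (\<lambda>n. dir_deriv k (\<lambda>x. f n x + c * g n x))"
    unfolding d L2_Cauchy_def
  proof (intro conjI allI impI L2_lin L)
    fix e :: real assume e: "0 < e"
    obtain N where N: "\<And>i j. N \<le> i \<Longrightarrow> N \<le> j \<Longrightarrow> L2_norm m (\<lambda>x. dir_deriv k (f i) x - dir_deriv k (f j) x) < e / 2"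
      using approx_Cauchy[OF f] e unfolding L2_Cauchy_def by (meson half_gt_zero)
    \<comment> \<open>|c| + 1 in place of |c| admits \<open>c = 0\<close>.\<close>
    obtain N' where N': "\<And>i j. N' \<le> i \<Longrightarrow> N' \<le> j \<Longrightarrow>
        L2_norm m (\<lambda>x. dir_deriv k (g i) x - dir_deriv k (g j) x) < e / (2 * (\<bar>c\<bar> + 1))"
      using approx_Cauchy[OF g] e unfolding L2_Cauchy_def
      by (metis abs_ge_zero add_nonneg_pos divide_pos_pos mult_pos_pos zero_less_numeral zero_less_one)
    show "\<exists>N. \<forall>i\<ge>N. \<forall>j\<ge>N. L2_norm m (\<lambda>x. dir_deriv k (f i) x + c * dir_deriv k (g i) x -
        (dir_deriv k (f j) x + c * dir_deriv k (g j) x)) < e"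
    proof (intro exI[of _ "max N N'"] allI impI)
      fix i j assume ij: "max N N' \<le> i" "max N N' \<le> j"
      have "L2_norm m (\<lambda>x. dir_deriv k (f i) x + c * dir_deriv k (g i) x - (dir_deriv k (f j) x + c * dir_deriv k (g j) x))
          = L2_norm m (\<lambda>x. (dir_deriv k (f i) x - dir_deriv k (f j) x) + c * (dir_deriv k (g i) x - dir_deriv k (g j) x))"
        by (simp add: algebra_simps)
      also have "\<dots> \<le> L2_norm m (\<lambda>x. dir_deriv k (f i) x - dir_deriv k (f j) x) +
          L2_norm m (\<lambda>x. c * (dir_deriv k (g i) x - dir_deriv k (g j) x))"
        by (intro L2_norm_triangle L2_scale L2_diff L)
      also have "\<dots> = L2_norm m (\<lambda>x. dir_deriv k (f i) x - dir_deriv k (f j) x) +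
          \<bar>c\<bar> * L2_norm m (\<lambda>x. dir_deriv k (g i) x - dir_deriv k (g j) x)"
        by (simp add: L2_norm_scale)
      also have "\<dots> < e / 2 + (\<bar>c\<bar> + 1) * (e / (2 * (\<bar>c\<bar> + 1)))"
      proof (rule add_less_le_mono)
        show "L2_norm m (\<lambda>x. dir_deriv k (f i) x - dir_deriv k (f j) x) < e / 2" using N ij by simp
        show "\<bar>c\<bar> * L2_norm m (\<lambda>x. dir_deriv k (g i) x - dir_deriv k (g j) x) \<le> (\<bar>c\<bar> + 1) * (e / (2 * (\<bar>c\<bar> + 1)))"
          using N'[of i j] ij by (intro mult_mono) auto
      qed
      also have "\<dots> = e"
      proof -
        have "\<bar>c\<bar> + 1 \<noteq> 0" by linarith
        then show ?thesis by (simp add: divide_simps) (simp add: algebra_simps)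
      qed
      finally show "L2_norm m (\<lambda>x. dir_deriv k (f i) x + c * dir_deriv k (g i) x -
        (dir_deriv k (f j) x + c * dir_deriv k (g j) x)) < e" .
    qed
  qed
qed

text \<open>Closability. Completeness of \<open>L\<^sup>2\<close> is avoided by comparing with a fixed member \<open>h\<^sub>N\<close> of the sequence,
  for which \<open>\<integral> \<partial>h\<^sub>n \<partial>h\<^sub>N dm\<close> can be integrated by parts.\<close>

lemma approx_zero:
  assumes h: "approx h (\<lambda>_. 0)"
  shows "(\<lambda>n. L2_norm m (dir_deriv k (h n))) \<longlonglongrightarrow> 0"
  unfolding tendsto_L2_norm_iff
proof (rule LIMSEQ_I)
  fix e :: real assume e: "0 < e"
  note F = approx_FCb[OF h]
  note L = FCb_L2[OF FCb_dir_deriv[OF F]]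
  obtain N where N: "\<And>n. N \<le> n \<Longrightarrow> L2_norm m (\<lambda>x. dir_deriv k (h n) x - dir_deriv k (h N) x) < sqrt (e / 2)"
    using approx_Cauchy[OF h] e unfolding L2_Cauchy_def by (metis half_gt_zero order_refl real_sqrt_gt_zero)
  define w where "w z = dir_deriv k (dir_deriv k (h N)) z + dir_deriv k (h N) z * \<beta> z" for z
  have w: "w \<in> L2 m"
    unfolding w_def by (intro L2_add FCb_L2 FCb_mult_L2 FCb_dir_deriv F \<beta>_L2)
  have "(\<lambda>n. L2_norm m (h n) * L2_norm m w) \<longlonglongrightarrow> 0"
    using tendsto_mult_left_zero[of "\<lambda>n. L2_norm m (h n)"] approx_L2_tendsto[OF h] by simp
  then have "\<forall>\<^sub>F n in sequentially. L2_norm m (h n) * L2_norm m w < e / 4"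
    using order_tendstoD(2)[of _ 0 sequentially "e / 4"] e by simp
  then obtain N' where N': "\<And>n. N' \<le> n \<Longrightarrow> L2_norm m (h n) * L2_norm m w < e / 4"
    unfolding eventually_sequentially by blast
  show "\<exists>no. \<forall>n\<ge>no. norm ((\<integral>x. (dir_deriv k (h n) x)\<^sup>2 \<partial>m) - 0) < e"
  proof (intro exI[of _ "max N N'"] allI impI)
    fix n assume n: "max N N' \<le> n"
    have i: "integrable m (\<lambda>x. (dir_deriv k (h n) x - dir_deriv k (h N) x)\<^sup>2)"
      "integrable m (\<lambda>x. dir_deriv k (h n) x * dir_deriv k (h N) x)"
      "integrable m (\<lambda>x. (dir_deriv k (h n) x)\<^sup>2)"
      using L2_diff[OF L L] L2_mult_integrable[OF L L] L by (auto simp: L2_def)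
    \<comment> \<open>a^2 \<le> (a - b)^2 + 2 a b with \<open>b\<close> the fixed derivative: the
      first term is small by the Cauchy property, the second by integration by parts.\<close>
    have "(\<integral>x. (dir_deriv k (h n) x)\<^sup>2 \<partial>m) \<le>
        (\<integral>x. (dir_deriv k (h n) x - dir_deriv k (h N) x)\<^sup>2 + 2 * (dir_deriv k (h n) x * dir_deriv k (h N) x) \<partial>m)"
    proof (rule integral_mono)
      show "(dir_deriv k (h n) x)\<^sup>2 \<le>
          (dir_deriv k (h n) x - dir_deriv k (h N) x)\<^sup>2 + 2 * (dir_deriv k (h n) x * dir_deriv k (h N) x)" for x
        by (simp add: power2_diff)
    qed (use i in auto)
    also have "\<dots> = (\<integral>x. (dir_deriv k (h n) x - dir_deriv k (h N) x)\<^sup>2 \<partial>m)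
        + 2 * (\<integral>x. dir_deriv k (h n) x * dir_deriv k (h N) x \<partial>m)"
      using i by simp
    also have "(\<integral>x. (dir_deriv k (h n) x - dir_deriv k (h N) x)\<^sup>2 \<partial>m) < e / 2"
      using power_strict_mono[OF N[of n] L2_norm_nonneg, of 2] n e by (simp add: L2_norm_square)
    also have "(\<integral>x. dir_deriv k (h n) x * dir_deriv k (h N) x \<partial>m) = - (\<integral>x. h n x * w x \<partial>m)"
      unfolding w_def by (intro ibp_product F FCb_dir_deriv)
    also have "2 * - (\<integral>x. h n x * w x \<partial>m) \<le> e / 2"
      using L2_Cauchy_Schwarz[OF FCb_L2[OF F[of n]] w] N'[of n] n by simp
    finally show "norm ((\<integral>x. (dir_deriv k (h n) x)\<^sup>2 \<partial>m) - 0) < e" by simp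
  qed
qed

lemma partial_domE:
  assumes "u \<in> partial_dom m k"
  obtains f where "u \<in> L2 m" "approx f u"
  using assms by (auto simp: partial_dom_def closure_dom_def)

text \<open>By closability the limit does not depend on the two approximating sequences, so the
  definite description in \<open>closure_form\<close> has a value and any convenient pair of
  sequences computes it.\<close>

lemma partial_form_tendsto:
  assumes u: "u \<in> L2 m" "approx f u" and v: "v \<in> L2 m" "approx g v"
  shows "(\<lambda>n. \<integral>x. dir_deriv k (f n) x * dir_deriv k (g n) x \<partial>m) \<longlonglongrightarrow> partial_form m k u v"
proof -
  define Q where "Q f g = (\<lambda>n::nat. pre_form m k (f n) (g n))" for f g
  have Q: "Q f g = (\<lambda>n. \<integral>x. dir_deriv k (f n) x * dir_deriv k (g n) x \<partial>m)" for f g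
    by (simp add: Q_def pre_form_def)
  obtain c where c: "Q f g \<longlonglongrightarrow> c"
    using L2_Cauchy_inner_convergent[OF approx_Cauchy[OF u(2)] approx_Cauchy[OF v(2)]]
    unfolding Q by (auto simp: convergent_def)
  have zero: "(\<lambda>n. L2_norm m (\<lambda>x. dir_deriv k (p n) x - dir_deriv k (q n) x)) \<longlonglongrightarrow> 0"
    if "approx p w" "approx q w" "w \<in> L2 m" for p q w
  proof -
    have "approx (\<lambda>n x. p n x - q n x) (\<lambda>_. 0)"
      using approx_lin[OF that(1,2,3,3), of "- 1"] by simp
    from approx_zero[OF this] show ?thesis
      by (simp add: dir_deriv_diff approx_FCb[OF that(1)] approx_FCb[OF that(2)])
  qed
  have lim: "Q f' g' \<longlonglongrightarrow> c" if f': "approx f' u" and g': "approx g' v" for f' g'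
  proof -
    note L = L2_CauchyD[OF approx_Cauchy[OF u(2)]] L2_CauchyD[OF approx_Cauchy[OF v(2)]]
      L2_CauchyD[OF approx_Cauchy[OF f']] L2_CauchyD[OF approx_Cauchy[OF g']]
    have 1: "(\<lambda>n. \<integral>x. dir_deriv k (g' n) x * (dir_deriv k (f' n) x - dir_deriv k (f n) x) \<partial>m) \<longlonglongrightarrow> 0"
      by (intro L2_Cauchy_inner_tendsto_0 approx_Cauchy[OF g'] L2_diff L zero[OF f' u(2,1)])
    have 2: "(\<lambda>n. \<integral>x. dir_deriv k (f n) x * (dir_deriv k (g' n) x - dir_deriv k (g n) x) \<partial>m) \<longlonglongrightarrow> 0"
      by (intro L2_Cauchy_inner_tendsto_0 approx_Cauchy[OF u(2)] L2_diff L zero[OF g' v(2,1)])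
    \<comment> \<open>f' g' - f g = g' (f' - f) + f (g' - g), applied to the derivatives.\<close>
    have "Q f' g' n = Q f g n + (\<integral>x. dir_deriv k (g' n) x * (dir_deriv k (f' n) x - dir_deriv k (f n) x) \<partial>m)
        + (\<integral>x. dir_deriv k (f n) x * (dir_deriv k (g' n) x - dir_deriv k (g n) x) \<partial>m)" for n
      using L2_mult_integrable[OF L(1)[of n] L(2)[of n]] L2_mult_integrable[OF L(3)[of n] L(4)[of n]]
        L2_mult_integrable[OF L(1)[of n] L(4)[of n]]
      by (simp add: Q algebra_simps)
    moreover have "(\<lambda>n. Q f g n + (\<integral>x. dir_deriv k (g' n) x * (dir_deriv k (f' n) x - dir_deriv k (f n) x) \<partial>m)
        + (\<integral>x. dir_deriv k (f n) x * (dir_deriv k (g' n) x - dir_deriv k (g n) x) \<partial>m)) \<longlonglongrightarrow> c"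
      using tendsto_add[OF tendsto_add[OF c 1] 2] by simp
    ultimately show ?thesis by presburger
  qed
  have "partial_form m k u v = c"
    unfolding partial_form_def closure_form_def
  proof (rule the_equality)
    show "\<forall>f g. approx f u \<longrightarrow> approx g v \<longrightarrow> (\<lambda>n. pre_form m k (f n) (g n)) \<longlonglongrightarrow> c"
      using lim unfolding Q_def by blast
    fix c' assume "\<forall>f g. approx f u \<longrightarrow> approx g v \<longrightarrow> (\<lambda>n. pre_form m k (f n) (g n)) \<longlonglongrightarrow> c'"
    then have "Q f g \<longlonglongrightarrow> c'" using u(2) v(2) unfolding Q_def by blast
    then show "c' = c" using c by (rule LIMSEQ_unique)
  qed
  then show ?thesis using c by (simp add: Q)
qed

lemma partial_form_nonneg:
  assumes "u \<in> partial_dom m k"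
  shows "0 \<le> partial_form m k u u"
proof -
  obtain f where f: "u \<in> L2 m" "approx f u" using partial_domE[OF assms] by blast
  show ?thesis by (rule LIMSEQ_le_const[OF partial_form_tendsto[OF f f]]) simp
qed

lemma partial_dom_lin:
  assumes "u \<in> partial_dom m k" "v \<in> partial_dom m k"
  shows "(\<lambda>x. u x + c * v x) \<in> partial_dom m k"
proof -
  obtain f where f: "u \<in> L2 m" "approx f u" using partial_domE[OF assms(1)] by blast
  obtain g where g: "v \<in> L2 m" "approx g v" using partial_domE[OF assms(2)] by blast
  show ?thesis
    using approx_lin[OF f(2) g(2) f(1) g(1)] L2_lin[OF f(1) g(1)]
    by (auto simp: partial_dom_def closure_dom_def)
qed

lemma partial_form_lin:
  assumes "w \<in> partial_dom m k" "u \<in> partial_dom m k" "v \<in> partial_dom m k"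
  shows "partial_form m k w (\<lambda>x. u x + c * v x) = partial_form m k w u + c * partial_form m k w v"
proof -
  obtain f where f: "u \<in> L2 m" "approx f u" using partial_domE[OF assms(2)] by blast
  obtain g where g: "v \<in> L2 m" "approx g v" using partial_domE[OF assms(3)] by blast
  obtain h where h: "w \<in> L2 m" "approx h w" using partial_domE[OF assms(1)] by blast
  note fg = approx_lin[OF f(2) g(2) f(1) g(1), of c]
  note L = L2_CauchyD[OF approx_Cauchy[OF f(2)]] L2_CauchyD[OF approx_Cauchy[OF g(2)]]
    L2_CauchyD[OF approx_Cauchy[OF h(2)]]
  have "(\<integral>x. dir_deriv k (h n) x * dir_deriv k (\<lambda>x. f n x + c * g n x) x \<partial>m) =
      (\<integral>x. dir_deriv k (h n) x * dir_deriv k (f n) x \<partial>m) + c * (\<integral>x. dir_deriv k (h n) x * dir_deriv k (g n) x \<partial>m)" for n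
  proof -
    have "(\<integral>x. dir_deriv k (h n) x * dir_deriv k (\<lambda>x. f n x + c * g n x) x \<partial>m) =
      (\<integral>x. dir_deriv k (h n) x * dir_deriv k (f n) x + c * (dir_deriv k (h n) x * dir_deriv k (g n) x) \<partial>m)"
      by (simp add: dir_deriv_add dir_deriv_scale FCb_scale approx_FCb[OF f(2)] approx_FCb[OF g(2)] algebra_simps)
    then show ?thesis
      using L2_mult_integrable[OF L(3)[of n] L(1)[of n]] L2_mult_integrable[OF L(3)[of n] L(2)[of n]] by simp
  qed
  with partial_form_tendsto[OF h L2_lin[OF f(1) g(1), of c] fg]
  have "(\<lambda>n. (\<integral>x. dir_deriv k (h n) x * dir_deriv k (f n) x \<partial>m) + c * (\<integral>x. dir_deriv k (h n) x * dir_deriv k (g n) x \<partial>m))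
      \<longlonglongrightarrow> partial_form m k w (\<lambda>x. u x + c * v x)" by simp
  moreover have "(\<lambda>n. (\<integral>x. dir_deriv k (h n) x * dir_deriv k (f n) x \<partial>m) + c * (\<integral>x. dir_deriv k (h n) x * dir_deriv k (g n) x \<partial>m))
      \<longlonglongrightarrow> partial_form m k w u + c * partial_form m k w v"
    by (intro tendsto_intros partial_form_tendsto f g h)
  ultimately show ?thesis by (rule LIMSEQ_unique)
qed

lemma zero_energy_approx:
  assumes u: "u \<in> L2 m" "approx f u" and "partial_form m k u u = 0"
  shows "(\<lambda>n. L2_norm m (dir_deriv k (f n))) \<longlonglongrightarrow> 0"
  unfolding tendsto_L2_norm_iff
  using partial_form_tendsto[OF u u] assms(3) by (simp add: power2_eq_square)

text \<open>At zero energy the derivatives of an approximating sequence tend to 0 in L2, so by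
  Cauchy-Schwarz the function lies in the kernel of the form.\<close>

lemma partial_form_zero_right:
  assumes "w \<in> partial_dom m k" "u \<in> partial_dom m k" "partial_form m k u u = 0"
  shows "partial_form m k w u = 0"
proof -
  obtain f where f: "u \<in> L2 m" "approx f u" using partial_domE[OF assms(2)] by blast
  obtain h where h: "w \<in> L2 m" "approx h w" using partial_domE[OF assms(1)] by blast
  have "(\<lambda>n. \<integral>x. dir_deriv k (h n) x * dir_deriv k (f n) x \<partial>m) \<longlonglongrightarrow> 0"
    by (rule L2_Cauchy_inner_tendsto_0[OF approx_Cauchy[OF h(2)] L2_CauchyD[OF approx_Cauchy[OF f(2)]]
        zero_energy_approx[OF f assms(3)]])
  with partial_form_tendsto[OF h f] show ?thesis by (rule LIMSEQ_unique)
qed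

text \<open>Limit of \<open>ibp_product\<close>: the term with the derivative of \<open>u\<close>
  disappears, so \<open>u\<close> times \<open>m\<close> inherits the identity of \<open>m\<close>.
  This leads from zero energy back to Gibbs states.\<close>

lemma zero_energy_ibp:
  assumes "u \<in> partial_dom m k" "partial_form m k u u = 0" and v: "v \<in> FCb"
  shows "(\<integral>x. dir_deriv k v x * u x \<partial>m) = - (\<integral>x. v x * \<beta> x * u x \<partial>m)"
proof -
  obtain f where f: "u \<in> L2 m" "approx f u" using partial_domE[OF assms(1)] by blast
  note F = approx_FCb[OF f(2)]
  have conv: "(\<lambda>n. \<integral>x. w x * f n x \<partial>m) \<longlonglongrightarrow> (\<integral>x. w x * u x \<partial>m)" if w: "w \<in> L2 m" for w
  proof (rule LIM_zero_cancel)
    show "(\<lambda>n. (\<integral>x. w x * f n x \<partial>m) - (\<integral>x. w x * u x \<partial>m)) \<longlonglongrightarrow> 0"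
    proof (rule Lim_null_comparison)
      have "\<bar>(\<integral>x. w x * f n x \<partial>m) - (\<integral>x. w x * u x \<partial>m)\<bar> \<le> L2_norm m w * L2_norm m (\<lambda>x. f n x - u x)" for n
        using L2_Cauchy_Schwarz[OF w L2_diff[OF FCb_L2[OF F[of n]] f(1)]]
          L2_mult_integrable[OF w FCb_L2[OF F[of n]]] L2_mult_integrable[OF w f(1)]
        by (simp add: right_diff_distrib)
      then show "\<forall>\<^sub>F n in sequentially. norm ((\<integral>x. w x * f n x \<partial>m) - (\<integral>x. w x * u x \<partial>m)) \<le>
          L2_norm m w * L2_norm m (\<lambda>x. f n x - u x)" by simp
      show "(\<lambda>n. L2_norm m w * L2_norm m (\<lambda>x. f n x - u x)) \<longlonglongrightarrow> 0"
        using tendsto_mult_right_zero[OF approx_L2_tendsto[OF f(2)]] .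
    qed
  qed
  have v\<beta>: "(\<lambda>x. v x * \<beta> x) \<in> L2 m" by (intro FCb_mult_L2 v \<beta>_L2)
  have vC: "L2_Cauchy m (\<lambda>_. v)"
    using FCb_L2[OF v] by (auto simp: L2_Cauchy_def L2_norm_def)
  have 1: "(\<lambda>n. \<integral>x. v x * dir_deriv k (f n) x \<partial>m) \<longlonglongrightarrow> 0"
    by (rule L2_Cauchy_inner_tendsto_0[OF vC L2_CauchyD[OF approx_Cauchy[OF f(2)]] zero_energy_approx[OF f assms(2)]])
  have "(\<integral>x. dir_deriv k v x * f n x \<partial>m) = - ((\<integral>x. v x * dir_deriv k (f n) x \<partial>m) + (\<integral>x. v x * \<beta> x * f n x \<partial>m))" for n
  proof -
    have "(\<integral>x. v x * (dir_deriv k (f n) x + f n x * \<beta> x) \<partial>m) =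
        (\<integral>x. v x * dir_deriv k (f n) x + v x * \<beta> x * f n x \<partial>m)" by (simp add: algebra_simps)
    also have "\<dots> = (\<integral>x. v x * dir_deriv k (f n) x \<partial>m) + (\<integral>x. v x * \<beta> x * f n x \<partial>m)"
      by (intro Bochner_Integration.integral_add L2_mult_integrable v\<beta> FCb_L2 F v FCb_dir_deriv)
    finally show ?thesis using ibp_product[OF v F[of n]] by simp
  qed
  moreover have "(\<lambda>n. - ((\<integral>x. v x * dir_deriv k (f n) x \<partial>m) + (\<integral>x. v x * \<beta> x * f n x \<partial>m))) \<longlonglongrightarrow>
      - (0 + (\<integral>x. v x * \<beta> x * u x \<partial>m))"
    by (intro tendsto_intros 1 conv v\<beta>)
  ultimately have "(\<lambda>n. \<integral>x. dir_deriv k v x * f n x \<partial>m) \<longlonglongrightarrow> - (\<integral>x. v x * \<beta> x * u x \<partial>m)"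
    by simp
  with conv[OF FCb_L2[OF FCb_dir_deriv[OF v]]] show ?thesis by (rule LIMSEQ_unique)
qed

text \<open>Tolerances 1 / (n + 1) give an approximating sequence whose derivatives tend to 0 and
  are therefore Cauchy. The estimates for segment averages enter the form here.\<close>

lemma zero_energyI:
  assumes u: "u \<in> L2 m"
    and ex: "\<And>\<epsilon>. 0 < \<epsilon> \<Longrightarrow> \<exists>v\<in>FCb. L2_norm m (\<lambda>z. v z - u z) < \<epsilon> \<and> L2_norm m (dir_deriv k v) < \<epsilon>"
  shows "u \<in> partial_dom m k" "partial_form m k u u = 0"
proof -
  have "\<forall>n. \<exists>v\<in>FCb. L2_norm m (\<lambda>z. v z - u z) < inverse (Suc n) \<and> L2_norm m (dir_deriv k v) < inverse (Suc n)"
    using ex by simp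
  then obtain f where f: "\<And>n. f n \<in> FCb" "\<And>n. L2_norm m (\<lambda>z. f n z - u z) < inverse (Suc n)"
    "\<And>n. L2_norm m (dir_deriv k (f n)) < inverse (Suc n)" by metis
  have lim: "(\<lambda>n. a n) \<longlonglongrightarrow> 0" if "\<And>n. 0 \<le> a n" "\<And>n. a n < inverse (real (Suc n))" for a
    using that by (intro tendsto_sandwich[OF _ _ tendsto_const LIMSEQ_inverse_real_of_nat])
      (auto intro: less_imp_le always_eventually)
  have d0: "(\<lambda>n. L2_norm m (dir_deriv k (f n))) \<longlonglongrightarrow> 0" by (rule lim[OF L2_norm_nonneg f(3)])
  have L: "dir_deriv k (f n) \<in> L2 m" for n by (intro FCb_L2 FCb_dir_deriv f)
  have C: "L2_Cauchy m (\<lambda>n. dir_deriv k (f n))"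
    unfolding L2_Cauchy_def
  proof (intro conjI allI impI L)
    fix e :: real assume e: "0 < e"
    obtain N where N: "\<And>n. N \<le> n \<Longrightarrow> L2_norm m (dir_deriv k (f n)) < e / 2"
      using order_tendstoD(2)[OF d0, of "e / 2"] e unfolding eventually_sequentially by auto
    show "\<exists>N. \<forall>i\<ge>N. \<forall>j\<ge>N. L2_norm m (\<lambda>x. dir_deriv k (f i) x - dir_deriv k (f j) x) < e"
    proof (intro exI[of _ N] allI impI)
      fix i j assume ij: "N \<le> i" "N \<le> j"
      have neg: "(\<lambda>x. - dir_deriv k (f j) x) \<in> L2 m" using L[of j] by (simp add: L2_def)
      have "L2_norm m (\<lambda>x. - dir_deriv k (f j) x) = L2_norm m (dir_deriv k (f j))" by (simp add: L2_norm_def)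
      then show "L2_norm m (\<lambda>x. dir_deriv k (f i) x - dir_deriv k (f j) x) < e"
        using L2_norm_triangle[OF L[of i] neg] N[OF ij(1)] N[OF ij(2)] by simp
    qed
  qed
  have ap: "approx f u"
    by (rule approxI[OF f(1) lim[OF L2_norm_nonneg f(2)] C])
  then show "u \<in> partial_dom m k" using u by (auto simp: partial_dom_def closure_dom_def)
  have "(\<lambda>n. \<integral>x. dir_deriv k (f n) x * dir_deriv k (f n) x \<partial>m) \<longlonglongrightarrow> 0"
    using d0 unfolding tendsto_L2_norm_iff by (simp add: power2_eq_square)
  with partial_form_tendsto[OF u ap u ap] show "partial_form m k u u = 0" by (rule LIMSEQ_unique)
qed

end

text \<open>Exchanging the two sequences turns one defining condition into the other, so the two
  definite descriptions agree, whether or not they denote a limit.\<close>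

lemma partial_form_commute: "partial_form m k u v = partial_form m k v u"
proof -
  define Q where "Q f g c \<longleftrightarrow> (\<lambda>n. pre_form m k (f n) (g n)) \<longlonglongrightarrow> c"
    for f g :: "nat \<Rightarrow> 'a \<Rightarrow> real" and c :: real
  have Q: "Q f g c \<longleftrightarrow> Q g f c" for f g c
    by (simp add: Q_def pre_form_def mult.commute)
  have *: "(\<forall>f g. A f \<longrightarrow> B g \<longrightarrow> Q f g c) \<longleftrightarrow> (\<forall>f g. B f \<longrightarrow> A g \<longrightarrow> Q f g c)" for A B c
    using Q[of _ _ c] by blast
  show ?thesis
    unfolding partial_form_def closure_form_def Q_def[symmetric] by (intro arg_cong[where f = The] ext *)
qed

section \<open>Invariant sets and Gibbs states\<close>

text \<open>Stated direction by direction: the estimates are obtained for each \<open>k\<close>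
  separately, and the value 0 of \<open>dirichlet_form\<close> alone would be ambiguous, because an
  infinite sum that fails to converge is 0 by convention.\<close>

definition zero_energy :: "'a::locally_convex_space set \<Rightarrow> 'a measure \<Rightarrow> ('a \<Rightarrow> real) \<Rightarrow> bool" where
  "zero_energy K m u \<longleftrightarrow> u \<in> L2 m \<and> (\<forall>k\<in>K. u \<in> partial_dom m k \<and> partial_form m k u u = 0)"

lemma indicator_L2:
  assumes "finite_measure M" "A \<in> sets M"
  shows "indicator A \<in> L2 M"
proof -
  interpret finite_measure M by fact
  have "(\<lambda>x. (indicator A x)\<^sup>2) = (indicator A :: 'a \<Rightarrow> real)" by (auto simp: indicator_def)
  then show ?thesis using assms(2) by (simp add: L2_def emeasure_eq_measure)
qed

lemma gibbsD:
  assumes "m \<in> gibbs K b"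
  shows "prob_space m" "sets m = sets borel" "space m = UNIV"
    "\<And>k. k \<in> K \<Longrightarrow> log_deriv m k (b k)"
proof -
  show 1: "prob_space m" and 2: "sets m = sets borel" using assms by (auto simp: gibbs_def)
  show "space m = UNIV" using sets_eq_imp_space_eq[OF 2] by simp
  show "log_deriv m k (b k)" if "k \<in> K" for k
    using assms that by (auto simp: gibbs_def log_deriv_def log_deriv_axioms_def)
qed

text \<open>Together with \<open>zero_energy_invariant\<close> this yields conservativity: \<alpha>
  times the total mass of \<open>U \<alpha> x\<close> is 1 for almost every
  \<open>x\<close>.\<close>

lemma zero_energy_one:
  assumes m: "m \<in> gibbs K b"
  shows "zero_energy K m (indicator UNIV)"
proof -
  interpret prob_space m using gibbsD(1)[OF m] .
  have L2: "indicator UNIV \<in> L2 m"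
    using gibbsD(2)[OF m] by (intro indicator_L2 finite_measure_axioms) simp
  have "indicator UNIV \<in> partial_dom m k \<and> partial_form m k (indicator UNIV) (indicator UNIV) = 0" if "k \<in> K" for k
  proof -
    interpret log_deriv m k "b k" using gibbsD(4)[OF m that] .
    have "\<exists>v\<in>FCb. L2_norm m (\<lambda>z. v z - indicator UNIV z) < \<epsilon> \<and> L2_norm m (dir_deriv k v) < \<epsilon>" if "0 < \<epsilon>" for \<epsilon>
      using that by (intro bexI[of _ "\<lambda>_. 1"] FCb_const) (simp add: dir_deriv_const L2_norm_def)
    then show ?thesis using zero_energyI[OF L2] by blast
  qed
  with L2 show ?thesis by (simp add: zero_energy_def)
qed

section \<open>Zero energy and invariant sets of the resolvent\<close>

locale dirichlet_resolvent =
  fixes K :: "'a::locally_convex_space set" and b :: "'a \<Rightarrow> 'a \<Rightarrow> real" and m :: "'a measure"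
    and U :: "real \<Rightarrow> 'a \<Rightarrow> 'a measure"
  assumes m_gibbs: "m \<in> gibbs K b" and realizes: "realizes_dirichlet_resolvent K m U"
begin

sublocale prob_space m using gibbsD(1)[OF m_gibbs] .

lemma sets_m [measurable_cong]: "sets m = sets borel" using gibbsD(2)[OF m_gibbs] .

lemma space_m [simp]: "space m = UNIV" using gibbsD(3)[OF m_gibbs] .

lemma prob_UNIV [simp]: "prob UNIV = 1" using prob_space by simp

lemma Compl_sets: "A \<in> sets m \<Longrightarrow> - A \<in> sets m"
  using sets.compl_sets[of A m] by (simp add: Compl_eq_Diff_UNIV)

lemma log_deriv: "k \<in> K \<Longrightarrow> log_deriv m k (b k)" using gibbsD(4)[OF m_gibbs] .

lemma indicator_in_L2: "A \<in> sets m \<Longrightarrow> indicator A \<in> L2 m"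
  by (rule indicator_L2[OF finite_measure_axioms])

lemma
  assumes "0 < \<alpha>"
  shows sets_U [measurable_cong]: "sets (U \<alpha> x) = sets borel"
    and space_U: "space (U \<alpha> x) = UNIV"
    and finite_U: "finite_measure (U \<alpha> x)"
proof -
  show 1: "sets (U \<alpha> x) = sets borel"
    using realizes assms by (auto simp: realizes_dirichlet_resolvent_def submarkov_resolvent_def)
  then show 2: "space (U \<alpha> x) = UNIV" using sets_eq_imp_space_eq by fastforce
  have "ennreal \<alpha> * emeasure (U \<alpha> x) UNIV \<le> 1"
    using realizes assms by (auto simp: realizes_dirichlet_resolvent_def submarkov_resolvent_def)
  then have "emeasure (U \<alpha> x) UNIV \<noteq> \<top>"
    using assms by (auto simp: ennreal_mult_top top_unique)
  then show "finite_measure (U \<alpha> x)" by (intro finite_measureI) (simp add: 2)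
qed

lemma integral_indicator_U: "0 < \<alpha> \<Longrightarrow> (\<integral>y. indicator A y \<partial>U \<alpha> x) = measure (U \<alpha> x) A"
  by (simp add: space_U)

lemma measure_U_antimono:
  assumes "0 < \<alpha>" "\<alpha> \<le> \<beta>" "A \<in> sets borel"
  shows "measure (U \<beta> x) A \<le> measure (U \<alpha> x) A"
proof -
  have "measure (U \<alpha> x) A - measure (U \<beta> x) A = (\<beta> - \<alpha>) * (\<integral>y. measure (U \<beta> y) A \<partial>U \<alpha> x)"
    using realizes assms by (auto simp: realizes_dirichlet_resolvent_def submarkov_resolvent_def)
  moreover have "0 \<le> (\<beta> - \<alpha>) * (\<integral>y. measure (U \<beta> y) A \<partial>U \<alpha> x)"
    using assms by (intro mult_nonneg_nonneg integral_nonneg_AE) auto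
  ultimately show ?thesis by linarith
qed

lemma resolvent_dom:
  assumes "0 < \<alpha>" "f \<in> L2 m"
  shows "(\<lambda>x. \<integral>y. f y \<partial>U \<alpha> x) \<in> dirichlet_dom K m"
  using realizes assms unfolding realizes_dirichlet_resolvent_def L2_resolvent_of_form_def by blast

lemma resolvent_eq:
  assumes "0 < \<alpha>" "f \<in> L2 m" "v \<in> dirichlet_dom K m"
  shows "dirichlet_form K m (\<lambda>x. \<integral>y. f y \<partial>U \<alpha> x) v + \<alpha> * (\<integral>x. (\<integral>y. f y \<partial>U \<alpha> x) * v x \<partial>m) = (\<integral>x. f x * v x \<partial>m)"
  using realizes assms unfolding realizes_dirichlet_resolvent_def L2_resolvent_of_form_def by blast

text \<open>Let G be the resolvent applied to 1_A and w = G - 1_A / \<alpha>. The indicator is in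
  the kernel of the form, so the energy of (G, w) equals that of (G, G) and is nonnegative. The
  resolvent equation tested with \<open>w\<close> then makes the integral of w^2 at most 0.\<close>

lemma zero_energy_invariant:
  assumes A: "A \<in> sets m" and zero: "zero_energy K m (indicator A)" and \<alpha>: "0 < \<alpha>"
  shows "AE x in m. measure (U \<alpha> x) A = indicator A x / \<alpha>"
proof -
  define G :: "'a \<Rightarrow> real" where "G x = (\<integral>y. indicator A y \<partial>U \<alpha> x)" for x
  define w where "w x = G x + (- 1 / \<alpha>) * indicator A x" for x
  have AL2: "indicator A \<in> L2 m" by (rule indicator_in_L2[OF A])
  have G: "G \<in> dirichlet_dom K m" unfolding G_def by (rule resolvent_dom[OF \<alpha> AL2])
  have GL2: "G \<in> L2 m" using G by (simp add: dirichlet_dom_def)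
  have wL2: "w \<in> L2 m" unfolding w_def by (rule L2_lin[OF GL2 AL2])
  have k: "w \<in> partial_dom m k \<and> partial_form m k G w = partial_form m k G G \<and>
      partial_form m k w w = partial_form m k G G \<and> 0 \<le> partial_form m k G G" if "k \<in> K" for k
  proof -
    interpret k: log_deriv m k "b k" using log_deriv[OF that] .
    have d: "G \<in> partial_dom m k" "indicator A \<in> partial_dom m k" "partial_form m k (indicator A) (indicator A) = 0"
      using G zero that by (auto simp: dirichlet_dom_def zero_energy_def)
    have wd: "w \<in> partial_dom m k" unfolding w_def by (rule k.partial_dom_lin[OF d(1,2)])
    have z: "partial_form m k x (indicator A) = 0" if "x \<in> partial_dom m k" for x
      by (rule k.partial_form_zero_right[OF that d(2,3)])
    have lin: "partial_form m k x w = partial_form m k x G" if "x \<in> partial_dom m k" for x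
      unfolding w_def k.partial_form_lin[OF that d(1,2)] z[OF that] by simp
    show ?thesis
      using wd lin[OF d(1)] lin[OF wd] partial_form_commute[of m k w G] k.partial_form_nonneg[OF d(1)] by simp
  qed
  \<comment> \<open>\<open>w\<close> and \<open>G\<close> have the same partial energies, so
    \<open>w\<close> inherits summability and is an admissible test function.\<close>
  have "(\<lambda>k. partial_form m k w w) summable_on K \<longleftrightarrow> (\<lambda>k. partial_form m k G G) summable_on K"
    by (rule summable_on_cong) (use k in blast)
  then have w: "w \<in> dirichlet_dom K m"
    using G wL2 k by (simp add: dirichlet_dom_def)
  have "0 \<le> dirichlet_form K m G w"
    unfolding dirichlet_form_def using k by (intro mult_nonneg_nonneg infsum_nonneg) auto
  then have le: "\<alpha> * (\<integral>x. G x * w x \<partial>m) \<le> (\<integral>x. indicator A x * w x \<partial>m)"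
    using resolvent_eq[OF \<alpha> AL2 w] unfolding G_def[symmetric] by linarith
  have "(\<integral>x. (w x)\<^sup>2 \<partial>m) = (\<integral>x. G x * w x + (- 1 / \<alpha>) * (indicator A x * w x) \<partial>m)"
    by (intro Bochner_Integration.integral_cong) (auto simp: w_def power2_eq_square algebra_simps)
  also have "\<dots> = (\<integral>x. G x * w x \<partial>m) + (- 1 / \<alpha>) * (\<integral>x. indicator A x * w x \<partial>m)"
    using L2_mult_integrable[OF GL2 wL2] L2_mult_integrable[OF AL2 wL2] by simp
  also have "\<dots> \<le> 0"
    using le \<alpha> by (simp add: field_simps)
  finally have "(\<integral>x. (w x)\<^sup>2 \<partial>m) \<le> 0" .
  moreover have "0 \<le> (\<integral>x. (w x)\<^sup>2 \<partial>m)" by simp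
  ultimately have "(\<integral>x. (w x)\<^sup>2 \<partial>m) = 0" by linarith
  moreover have "integrable m (\<lambda>x. (w x)\<^sup>2)" using wL2 by (simp add: L2_def)
  ultimately have "AE x in m. (w x)\<^sup>2 = 0"
    by (subst (asm) integral_nonneg_eq_0_iff_AE) auto
  then show ?thesis
    by eventually_elim (simp add: w_def G_def space_U[OF \<alpha>])
qed

text \<open>The potential is a supremum over uncountably many \<alpha>. One null set serves all
  \<alpha> = 1 / (n + 1), and monotonicity in \<alpha> covers the rest.\<close>

lemma zero_energy_potential:
  assumes A: "A \<in> sets m" and zero: "zero_energy K m (indicator A)"
  shows "AE x in m. x \<notin> A \<longrightarrow> potential_kernel U x A = 0"
proof -
  have "AE x in m. \<forall>n. measure (U (inverse (Suc n)) x) A = indicator A x / inverse (real (Suc n))"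
    unfolding AE_all_countable by (intro allI zero_energy_invariant[OF assms]) simp
  then show ?thesis
  proof eventually_elim
    case (elim x)
    have "emeasure (U \<alpha> x) A = 0" if x: "x \<notin> A" and \<alpha>: "0 < \<alpha>" for \<alpha>
    proof -
      interpret finite_measure "U \<alpha> x" by (rule finite_U[OF \<alpha>])
      obtain n where n: "inverse (real (Suc n)) < \<alpha>" using reals_Archimedean[OF \<alpha>] by blast
      have "measure (U \<alpha> x) A \<le> measure (U (inverse (real (Suc n))) x) A"
        using n A sets_m by (intro measure_U_antimono) auto
      also have "\<dots> = 0" using elim x by simp
      finally show ?thesis by (simp add: emeasure_eq_measure measure_le_0_iff)
    qed
    then show ?case by (auto simp: potential_kernel_def intro!: SUP_eq_const[THEN trans])
  qed
qed

text \<open>The kernel does not lead out of \<open>A\<close>; symmetry of the form forbids the way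
  back, and conservativity then makes the 1-resolvent of 1_A equal to 1_A almost everywhere. The
  witness is this resolvent, which is in the domain by definition.\<close>

lemma potential_zero_energy:
  assumes A: "A \<in> sets m" and pot: "AE x in m. x \<in> A \<longrightarrow> potential_kernel U x (- A) = 0"
  shows "\<exists>h. zero_energy K m h \<and> (AE x in m. h x = indicator A x)"
proof -
  define g :: "'a set \<Rightarrow> 'a \<Rightarrow> real" where "g B x = (\<integral>y. indicator B y \<partial>U 1 x)" for B x
  have gm: "g B x = measure (U 1 x) B" for B x unfolding g_def by (rule integral_indicator_U) simp
  have A': "- A \<in> sets m" by (rule Compl_sets[OF A])
  note L2 = indicator_in_L2[OF A] indicator_in_L2[OF A']
  have dom: "g B \<in> dirichlet_dom K m" if "B \<in> sets m" for B
    unfolding g_def by (rule resolvent_dom[OF zero_less_one indicator_in_L2[OF that]])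
  have eq: "dirichlet_form K m (g B) v + (\<integral>x. g B x * v x \<partial>m) = (\<integral>x. indicator B x * v x \<partial>m)"
    if "B \<in> sets m" "v \<in> dirichlet_dom K m" for B v
    using resolvent_eq[OF zero_less_one indicator_in_L2[OF that(1)] that(2)] unfolding g_def[symmetric] by simp
  have gL2: "g B \<in> L2 m" if "B \<in> sets m" for B using dom[OF that] by (simp add: dirichlet_dom_def)
  \<comment> \<open>The resolvent equations for \<open>A\<close> tested with \<open>g (- A)\<close>
    and for \<open>- A\<close> tested with \<open>g A\<close> have the same left side.\<close>
  have sym: "(\<integral>x. indicator (- A) x * g A x \<partial>m) = (\<integral>x. indicator A x * g (- A) x \<partial>m)"
  proof -
    have "dirichlet_form K m (g A) (g (- A)) = dirichlet_form K m (g (- A)) (g A)"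
      unfolding dirichlet_form_def by (subst partial_form_commute) (rule refl)
    then show ?thesis
      using eq[OF A dom[OF A']] eq[OF A' dom[OF A]] by (simp add: mult.commute)
  qed
  have zeroA: "AE x in m. indicator A x * g (- A) x = 0"
    using pot
  proof eventually_elim
    case (elim x)
    have "g (- A) x = 0" if "x \<in> A"
    proof -
      have "emeasure (U 1 x) (- A) \<le> potential_kernel U x (- A)"
        unfolding potential_kernel_def by (intro SUP_upper) simp
      then show ?thesis using elim that by (simp add: gm measure_def)
    qed
    then show ?case by (auto simp: indicator_def)
  qed
  then have "(\<integral>x. indicator A x * g (- A) x \<partial>m) = 0"
    by (rule integral_eq_zero_AE)
  then have "(\<integral>x. indicator (- A) x * g A x \<partial>m) = 0" using sym by simp
  then have zeroA': "AE x in m. indicator (- A) x * g A x = 0"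
    using L2_mult_integrable[OF L2(2) gL2[OF A]] by (subst (asm) integral_nonneg_eq_0_iff_AE) (auto simp: gm)
  have "AE x in m. measure (U 1 x) UNIV = 1"
    using zero_energy_invariant[OF _ zero_energy_one[OF m_gibbs], of 1] sets_m by simp
  with zeroA zeroA' have gA: "AE x in m. g A x = indicator A x"
  proof eventually_elim
    case (elim x)
    interpret finite_measure "U 1 x" by (rule finite_U) simp
    have "measure (U 1 x) (- A) = measure (U 1 x) UNIV - measure (U 1 x) A"
      using finite_measure_compl[of A] A by (simp add: sets_U sets_m space_U Compl_eq_Diff_UNIV)
    then show ?case using elim by (auto simp: gm indicator_def split: if_splits)
  qed
  \<comment> \<open>Testing the resolvent equation for 1_A with \<open>g A\<close> itself, the
    energy is the integral of (1_A - g A) g A.\<close>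
  have "dirichlet_form K m (g A) (g A) = 0"
  proof -
    have "(\<integral>x. g A x * g A x \<partial>m) = (\<integral>x. indicator A x * g A x \<partial>m)"
      using gA gL2[OF A] L2(1) by (intro integral_cong_AE) (auto simp: L2_def intro: borel_measurable_times elim: eventually_mono)
    then show ?thesis using eq[OF A dom[OF A]] by linarith
  qed
  then have inf0: "(\<Sum>\<^sub>\<infinity>k\<in>K. partial_form m k (g A) (g A)) \<le> 0" by (simp add: dirichlet_form_def)
  have "g A \<in> partial_dom m k \<and> partial_form m k (g A) (g A) = 0" if "k \<in> K" for k
  proof
    show "g A \<in> partial_dom m k" using dom[OF A] that by (simp add: dirichlet_dom_def)
    show "partial_form m k (g A) (g A) = 0"
    proof (rule nonneg_infsum_le_0D[OF inf0 _ _ that])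
      show "(\<lambda>k. partial_form m k (g A) (g A)) summable_on K" using dom[OF A] by (simp add: dirichlet_dom_def)
      show "0 \<le> partial_form m k (g A) (g A)" if "k \<in> K" for k
        using log_deriv.partial_form_nonneg[OF log_deriv[OF that]] dom[OF A] that by (simp add: dirichlet_dom_def)
    qed
  qed
  with gL2[OF A] gA show ?thesis unfolding zero_energy_def by blast
qed

section \<open>Normalized restrictions as Gibbs states\<close>

definition conditional :: "'a set \<Rightarrow> 'a measure" where
  "conditional A = density m (\<lambda>x. ennreal (indicator A x / prob A))"

lemma integral_conditional:
  fixes f :: "'a \<Rightarrow> real"
  assumes "A \<in> sets m" "f \<in> borel_measurable m"
  shows "(\<integral>x. f x \<partial>conditional A) = (\<integral>x. f x * indicator A x \<partial>m) / prob A"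
proof -
  have "(\<integral>x. f x \<partial>conditional A) = (\<integral>x. (indicator A x / prob A) *\<^sub>R f x \<partial>m)"
    unfolding conditional_def using assms by (intro integral_density) auto
  also have "\<dots> = (\<integral>x. (f x * indicator A x) / prob A \<partial>m)"
    by (simp add: ac_simps)
  finally show ?thesis by simp
qed

lemma measure_conditional:
  assumes "A \<in> sets m" "B \<in> sets m"
  shows "measure (conditional A) B = prob (A \<inter> B) / prob A"
proof -
  have "measure (conditional A) B = (\<integral>x. indicator B x \<partial>conditional A)"
    using assms by (simp add: conditional_def)
  also have "\<dots> = (\<integral>x. indicator B x * indicator A x \<partial>m) / prob A"
    using assms by (intro integral_conditional) auto
  also have "(\<lambda>x. indicator B x * indicator A x :: real) = indicator (A \<inter> B)"
    by (auto simp: indicator_def)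
  finally show ?thesis using assms by simp
qed

text \<open>Zero energy removes the derivative that the product rule would put on the indicator, so
  the identity for \<open>m\<close> restricts to \<open>A\<close> with the same \<open>b k\<close>.
  The version \<open>h\<close> of the indicator is what \<open>potential_zero_energy\<close>
  supplies.\<close>

lemma conditional_gibbs:
  assumes A: "A \<in> sets m" "0 < prob A"
    and zero: "zero_energy K m h" "AE x in m. h x = indicator A x"
  shows "conditional A \<in> gibbs_ac K b m"
proof -
  have dens: "(\<lambda>x. ennreal (indicator A x / prob A)) \<in> borel_measurable m" using A by measurable
  have ac: "absolutely_continuous m (conditional A)"
    unfolding conditional_def by (rule absolutely_continuousI_density[OF dens])
  have setsc: "sets (conditional A) = sets borel" by (simp add: conditional_def sets_m)
  have prob: "prob_space (conditional A)"
  proof (rule prob_spaceI)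
    have "emeasure (conditional A) (space (conditional A)) = (\<integral>\<^sup>+ x. ennreal (indicator A x / prob A) \<partial>m)"
      using dens unfolding conditional_def by (subst emeasure_density) (auto intro!: nn_integral_cong)
    also have "\<dots> = ennreal (\<integral>x. indicator A x / prob A \<partial>m)"
      using A by (intro nn_integral_eq_integral) (auto simp: emeasure_eq_measure)
    also have "\<dots> = 1" using A by simp
    finally show "emeasure (conditional A) (space (conditional A)) = 1" .
  qed
  have "b k \<in> L2 (conditional A) \<and> (\<forall>u\<in>FCb. (\<integral>z. dir_deriv k u z \<partial>conditional A) = - (\<integral>z. u z * b k z \<partial>conditional A))"
    if k: "k \<in> K" for k
  proof -
    interpret k: log_deriv m k "b k" using log_deriv[OF k] .
    have "integrable m (\<lambda>x. indicator A x * (b k x)\<^sup>2)"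
      using A(1) by (intro integrable_bounded_mult[OF k.\<beta>_square, where C = 1]) (auto simp: indicator_def)
    then have "integrable m (\<lambda>x. (indicator A x / prob A) *\<^sub>R (b k x)\<^sup>2)"
      using integrable_divide_zero[of "prob A" m "\<lambda>x. indicator A x * (b k x)\<^sup>2"] by simp
    then have L2: "b k \<in> L2 (conditional A)"
      using A unfolding L2_def conditional_def by (auto simp: integrable_density)
    have "(\<integral>z. dir_deriv k u z \<partial>conditional A) = - (\<integral>z. u z * b k z \<partial>conditional A)" if u: "u \<in> FCb" for u
    proof -
      have m1: "dir_deriv k u \<in> borel_measurable m" "(\<lambda>z. u z * b k z) \<in> borel_measurable m"
        using k.FCb_m[OF u] k.FCb_m[OF FCb_dir_deriv[OF u]] by (auto intro: borel_measurable_times)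
      have hm: "h \<in> borel_measurable m" using zero(1) by (simp add: zero_energy_def L2_def)
      have c: "(\<integral>x. f x * indicator A x \<partial>m) = (\<integral>x. f x * h x \<partial>m)" if "f \<in> borel_measurable m" for f :: "'a \<Rightarrow> real"
        using zero(2) that hm A(1) by (intro integral_cong_AE) (auto intro: borel_measurable_times elim: eventually_mono)
      have "(\<integral>x. dir_deriv k u x * h x \<partial>m) = - (\<integral>x. u x * b k x * h x \<partial>m)"
        using zero(1) k by (intro k.zero_energy_ibp u) (auto simp: zero_energy_def)
      then show ?thesis
        by (simp add: integral_conditional[OF A(1)] m1 c)
    qed
    with L2 show ?thesis by blast
  qed
  with ac setsc prob show ?thesis by (simp add: gibbs_ac_def gibbs_def)
qed

section \<open>Densities of absolutely continuous Gibbs states\<close>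

lemma FCb_dense:
  assumes k: "k \<in> K" and f: "f \<in> L2 m" and e: "0 < e"
  shows "\<exists>u\<in>FCb. L2_norm m (\<lambda>x. u x - f x) < e"
proof -
  interpret k: log_deriv m k "b k" using log_deriv[OF k] .
  \<comment> \<open>By strong continuity \<open>f\<close> is close to \<alpha> times its resolvent
    for large \<alpha>, and the resolvent is in the closure of cylinder functions for direction
    \<open>k\<close>.\<close>
  have "((\<lambda>\<alpha>. \<integral>x. (\<alpha> * (\<integral>y. f y \<partial>U \<alpha> x) - f x)\<^sup>2 \<partial>m) \<longlongrightarrow> 0) at_top"
    using realizes f unfolding realizes_dirichlet_resolvent_def L2_resolvent_of_form_def by blast
  from tendsto_real_sqrt[OF this]
  have "\<forall>\<^sub>F \<alpha> in at_top. L2_norm m (\<lambda>x. \<alpha> * (\<integral>y. f y \<partial>U \<alpha> x) - f x) < e / 2 \<and> (0::real) < \<alpha>"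
    using e unfolding L2_norm_def by (intro eventually_conj order_tendstoD(2) eventually_gt_at_top) auto
  then obtain \<alpha> where \<alpha>: "L2_norm m (\<lambda>x. \<alpha> * (\<integral>y. f y \<partial>U \<alpha> x) - f x) < e / 2" "0 < \<alpha>"
    using eventually_happens'[OF trivial_limit_at_top_linorder] by blast
  define G where "G x = (\<integral>y. f y \<partial>U \<alpha> x)" for x
  have "G \<in> partial_dom m k"
    using resolvent_dom[OF \<alpha>(2) f] k unfolding G_def dirichlet_dom_def by blast
  then obtain g where g: "G \<in> L2 m" "k.approx g G" using k.partial_domE by blast
  have "\<forall>\<^sub>F n in sequentially. L2_norm m (\<lambda>x. g n x - G x) < e / (2 * \<alpha>)"
    using e \<alpha>(2) by (intro order_tendstoD(2)[OF k.approx_L2_tendsto[OF g(2)]]) auto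
  then obtain n where n: "L2_norm m (\<lambda>x. g n x - G x) < e / (2 * \<alpha>)"
    using eventually_happens'[OF sequentially_bot] by blast
  have gF: "(\<lambda>x. \<alpha> * g n x) \<in> FCb" by (intro FCb_scale k.approx_FCb[OF g(2)])
  have "L2_norm m (\<lambda>x. \<alpha> * g n x - \<alpha> * G x) = \<alpha> * L2_norm m (\<lambda>x. g n x - G x)"
    using \<alpha>(2) L2_norm_scale[of m \<alpha> "\<lambda>x. g n x - G x"] by (simp add: right_diff_distrib)
  also have "\<dots> < e / 2" using n \<alpha>(2) by (simp add: field_simps)
  finally have "L2_norm m (\<lambda>x. \<alpha> * g n x - f x) < e"
    using L2_norm_triangle_diff[OF k.FCb_L2[OF gF] L2_scale[OF g(1), of \<alpha>] f] \<alpha>(1)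
    unfolding G_def[symmetric] by linarith
  with gF show ?thesis by (intro bexI[of _ "\<lambda>x. \<alpha> * g n x"])
qed

text \<open>Shifts are handled on \<open>dual_sigma\<close>, whereas a density is merely Borel.
  Along a subsequence \<open>f\<close> is an almost everywhere limit of cylinder functions, and
  \<open>lim\<close> is a measurable total function even where the sequence diverges.\<close>

lemma dual_sigma_version:
  assumes k: "k \<in> K" and f: "f \<in> L2 m"
  shows "\<exists>f'\<in>borel_measurable dual_sigma. AE x in m. f x = f' x"
proof -
  interpret k: log_deriv m k "b k" using log_deriv[OF k] .
  have "\<forall>n. \<exists>u\<in>FCb. L2_norm m (\<lambda>x. u x - f x) < inverse (real (Suc n))"
    using FCb_dense[OF k f] by simp
  then obtain u where u: "\<And>n. u n \<in> FCb" "\<And>n. L2_norm m (\<lambda>x. u n x - f x) < inverse (real (Suc n))" by metis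
  have "(\<lambda>n. L2_norm m (\<lambda>x. u n x - f x)) \<longlonglongrightarrow> 0"
    using u(2) by (intro tendsto_sandwich[OF _ _ tendsto_const LIMSEQ_inverse_real_of_nat])
      (auto intro!: always_eventually less_imp_le)
  then have "(\<lambda>n. \<integral>x. norm ((u n x - f x)\<^sup>2) \<partial>m) \<longlonglongrightarrow> 0"
    unfolding tendsto_L2_norm_iff by simp
  moreover have "integrable m (\<lambda>x. (u n x - f x)\<^sup>2)" for n
    using L2_diff[OF k.FCb_L2[OF u(1)] f] by (simp add: L2_def)
  ultimately obtain r :: "nat \<Rightarrow> nat" where r: "AE x in m. (\<lambda>n. (u (r n) x - f x)\<^sup>2) \<longlonglongrightarrow> 0"
    using tendsto_L1_AE_subseq[of m "\<lambda>n x. (u n x - f x)\<^sup>2"] by blast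
  show ?thesis
  proof (intro bexI)
    show "(\<lambda>x. lim (\<lambda>n. u (r n) x)) \<in> borel_measurable dual_sigma"
      by (intro borel_measurable_lim_metric FCb_measurable_dual_sigma u)
    show "AE x in m. f x = lim (\<lambda>n. u (r n) x)"
      using r
    proof eventually_elim
      case (elim x)
      from tendsto_real_sqrt[OF elim] have "(\<lambda>n. u (r n) x - f x) \<longlonglongrightarrow> 0"
        by (simp add: tendsto_rabs_zero_iff)
      then have "(\<lambda>n. u (r n) x) \<longlonglongrightarrow> f x" by (rule LIM_zero_cancel)
      then show ?case by (rule limI[symmetric])
    qed
  qed
qed

lemma gibbs_ac_density:
  assumes \<mu>: "\<mu> \<in> gibbs_ac K b m"
  shows "\<exists>\<rho>\<in>borel_measurable m. (\<forall>x. 0 \<le> \<rho> x) \<and> \<mu> = density m (\<lambda>x. ennreal (\<rho> x)) \<and>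
    (\<forall>c. zero_energy K m (indicator {x. c < \<rho> x}))"
proof -
  have \<mu>g: "\<mu> \<in> gibbs K b" and ac: "absolutely_continuous m \<mu>" using \<mu> by (auto simp: gibbs_ac_def)
  interpret \<mu>: prob_space \<mu> using gibbsD(1)[OF \<mu>g] .
  have sets: "sets \<mu> = sets m" using gibbsD(2)[OF \<mu>g] sets_m by simp
  obtain D where D: "D \<in> borel_measurable m" "AE x in m. RN_deriv m \<mu> x = ennreal (D x)" "\<And>x. 0 \<le> D x"
    using real_RN_deriv[OF \<mu>.finite_measure_axioms ac sets] by blast
  have \<mu>D: "\<mu> = density m (\<lambda>x. ennreal (D x))"
  proof -
    have "density m (RN_deriv m \<mu>) = density m (\<lambda>x. ennreal (D x))"
      using D(1,2) by (intro density_cong) auto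
    then show ?thesis using density_RN_deriv[OF ac sets] by simp
  qed
  show ?thesis
  \<comment> \<open>For empty \<open>K\<close> zero energy reduces to membership in L2; otherwise
    some direction is available for the approximation by cylinder functions.\<close>
  proof (cases "K = {}")
    case True
    have "zero_energy K m (indicator {x. c < D x})" for c
    proof -
      have "{x \<in> space m. c < D x} \<in> sets m" using D(1) by measurable
      then show ?thesis using True by (simp add: zero_energy_def indicator_in_L2)
    qed
    then show ?thesis using D(1,3) \<mu>D by blast
  next
    case False
    then obtain k0 where k0: "k0 \<in> K" by blast
    \<comment> \<open>A density is only in L1; its bounded transform is in L2 and can be inverted
      afterwards.\<close>
    define f where "f x = D x / (1 + D x)" for x
    have f01: "0 \<le> f x" "f x < 1" for x using D(3)[of x] by (auto simp: f_def)
    have fm: "f \<in> borel_measurable m" unfolding f_def using D(1) by measurable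
    have "f \<in> L2 m"
    proof -
      have "\<bar>(f x)\<^sup>2\<bar> \<le> 1" for x using f01[of x] by (simp add: power_le_one)
      then have "integrable m (\<lambda>x. (f x)\<^sup>2)" using fm by (intro integrable_const_bound[of _ 1]) auto
      then show ?thesis using fm by (simp add: L2_def)
    qed
    then obtain f' where f': "f' \<in> borel_measurable dual_sigma" "AE x in m. f x = f' x"
      using dual_sigma_version[OF k0] by blast
    \<comment> \<open>The version \<open>f'\<close> may leave the range of the transform on a null
      set; the value 0 is used there.\<close>
    define \<rho> where "\<rho> x = (if 0 \<le> f' x \<and> f' x < 1 then f' x / (1 - f' x) else 0)" for x
    have \<rho>s: "\<rho> \<in> borel_measurable dual_sigma" unfolding \<rho>_def using f'(1) by measurable
    have \<rho>0: "0 \<le> \<rho> x" for x by (simp add: \<rho>_def)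
    have \<rho>D: "AE x in m. D x = \<rho> x"
      using f'(2)
    proof eventually_elim
      case (elim x)
      have "D x = f x / (1 - f x)" using D(3)[of x] by (simp add: f_def field_simps add_nonneg_eq_0_iff)
      then show ?case using elim f01[of x] by (simp add: \<rho>_def)
    qed
    have \<rho>m: "\<rho> \<in> borel_measurable m" using dual_sigma_imp_borel[OF \<rho>s] by (simp add: measurable_cong_sets[OF sets_m refl])
    have \<mu>\<rho>: "\<mu> = density m (\<lambda>x. ennreal (\<rho> x))"
      unfolding \<mu>D using \<rho>D D(1) \<rho>m by (intro density_cong) (auto elim: eventually_mono)
    have int: "(\<integral>x. g x \<partial>\<mu>) = (\<integral>x. \<rho> x * g x \<partial>m)" "integrable \<mu> g \<longleftrightarrow> integrable m (\<lambda>x. \<rho> x * g x)"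
      if "g \<in> borel_measurable m" for g :: "'a \<Rightarrow> real"
      unfolding \<mu>\<rho> using that \<rho>m \<rho>0 by (auto simp: integral_density integrable_density)
    have "zero_energy K m (indicator {x. c < \<rho> x})" for c
    proof -
      have "{x \<in> space dual_sigma. c < \<rho> x} \<in> sets dual_sigma" using \<rho>s by measurable
      then have As: "{x. c < \<rho> x} \<in> sets dual_sigma" by simp
      then have "{x. c < \<rho> x} \<in> sets m" using sets_dual_sigma_imp_borel sets_m by blast
      then have AL2: "indicator {x. c < \<rho> x} \<in> L2 m" by (rule indicator_in_L2)
      have "indicator {x. c < \<rho> x} \<in> partial_dom m k \<and>
          partial_form m k (indicator {x. c < \<rho> x}) (indicator {x. c < \<rho> x}) = 0" if k: "k \<in> K" for k
      proof -
        interpret k: log_deriv m k "b k" using log_deriv[OF k] .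
        interpret \<mu>k: log_deriv \<mu> k "b k" using gibbsD(4)[OF \<mu>g k] .
        \<comment> \<open>The Gibbs identity of \<mu>, read as an integral against \<open>m\<close>,
          says that the density has weak derivative 0; integrability of \<open>b k\<close> with
          respect to \<mu> gives the second condition.\<close>
        have "k.ibp \<rho>"
          unfolding k.ibp_def
        proof (intro conjI ballI)
          show "integrable m \<rho>" using int(2)[of "\<lambda>_. 1"] by simp
          show "integrable m (\<lambda>z. b k z * \<rho> z)"
            using \<mu>k.\<beta>_integrable int(2)[OF k.\<beta>_measurable] by (simp add: mult.commute)
          fix u :: "'a \<Rightarrow> real" assume "u \<in> trig"
          then have u: "u \<in> FCb" by (rule trig_subset_FCb)
          have m1: "dir_deriv k u \<in> borel_measurable m" "(\<lambda>z. u z * b k z) \<in> borel_measurable m"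
            using k.FCb_m[OF u] k.FCb_m[OF FCb_dir_deriv[OF u]] by (auto intro: borel_measurable_times)
          show "(\<integral>z. dir_deriv k u z * \<rho> z \<partial>m) = - (\<integral>z. u z * (b k z * \<rho> z) \<partial>m)"
            using \<mu>k.ibp_FCb[OF u] int(1)[OF m1(1)] int(1)[OF m1(2)] by (simp add: ac_simps)
        qed
        then have "k.ibp (indicator {x. c < \<rho> x})" by (rule k.ibp_indicator_greater[OF _ \<rho>s])
        from k.ibp_indicator_approx[OF As this]
        have "\<exists>v\<in>FCb. L2_norm m (\<lambda>z. v z - indicator {x. c < \<rho> x} z) < \<epsilon> \<and> L2_norm m (dir_deriv k v) < \<epsilon>"
          if "0 < \<epsilon>" for \<epsilon>
          using that trig_subset_FCb by meson
        then show ?thesis using k.zero_energyI[OF AL2] by blast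
      qed
      with AL2 show ?thesis by (simp add: zero_energy_def)
    qed
    then show ?thesis using \<rho>m \<rho>0 \<mu>\<rho> by blast
  qed
qed

text \<open>Each superlevel set of the density is null or conull. For \<open>c < 1\<close> it cannot
  be null, because the density has mean 1; so the density is at least 1 almost everywhere, and the
  mean forces equality.\<close>

lemma gibbs_ac_unique:
  assumes triv: "\<And>A. A \<in> sets m \<Longrightarrow> zero_energy K m (indicator A) \<Longrightarrow> prob A = 0 \<or> prob (- A) = 0"
    and \<mu>: "\<mu> \<in> gibbs_ac K b m"
  shows "\<mu> = m"
proof -
  obtain \<rho> where \<rho>: "\<rho> \<in> borel_measurable m" "\<And>x. 0 \<le> \<rho> x" "\<mu> = density m (\<lambda>x. ennreal (\<rho> x))"
    "\<And>c. zero_energy K m (indicator {x. c < \<rho> x})"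
    using gibbs_ac_density[OF \<mu>] by blast
  interpret \<mu>: prob_space \<mu> using \<mu> by (auto simp: gibbs_ac_def gibbs_def)
  have "integrable \<mu> (\<lambda>_. 1 :: real)" by simp
  then have i: "integrable m \<rho>" unfolding \<rho>(3) using \<rho>(1,2) by (simp add: integrable_density)
  have "(\<integral>x. 1 \<partial>\<mu>) = (\<integral>x. \<rho> x \<partial>m)"
    unfolding \<rho>(3) using \<rho>(1,2) by (subst integral_density) auto
  then have one: "(\<integral>x. \<rho> x \<partial>m) = 1" using \<mu>.prob_space by simp
  have lower: "AE x in m. c < \<rho> x" if "c < 1" for c
  proof -
    have "{x \<in> space m. c < \<rho> x} \<in> sets m" using \<rho>(1) by measurable
    then have A: "{x. c < \<rho> x} \<in> sets m" by simp
    have A': "- {x. c < \<rho> x} \<in> sets m" by (rule Compl_sets[OF A])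
    from triv[OF A \<rho>(4)] show ?thesis
    proof
      assume "prob {x. c < \<rho> x} = 0"
      then have "{x. c < \<rho> x} \<in> null_sets m" using A by (simp add: null_sets_def emeasure_eq_measure)
      then have "AE x in m. \<rho> x \<le> c" by (rule AE_I'[OF _]) auto
      then have "(\<integral>x. \<rho> x \<partial>m) \<le> (\<integral>x. c \<partial>m)" using i by (intro integral_mono_AE) auto
      then show ?thesis using one that by simp
    next
      assume "prob (- {x. c < \<rho> x}) = 0"
      then have "- {x. c < \<rho> x} \<in> null_sets m" using A' by (simp add: null_sets_def emeasure_eq_measure)
      then show ?thesis by (rule AE_I'[OF _]) auto
    qed
  qed
  have "AE x in m. \<forall>n. 1 - inverse (real (Suc n)) < \<rho> x"
    unfolding AE_all_countable by (intro allI lower) simp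
  then have ge: "AE x in m. 0 \<le> \<rho> x - 1"
  proof eventually_elim
    case (elim x)
    show ?case
    proof (rule ccontr)
      assume "\<not> 0 \<le> \<rho> x - 1"
      then obtain n where "inverse (real (Suc n)) < 1 - \<rho> x" using reals_Archimedean[of "1 - \<rho> x"] by auto
      then show False using elim[rule_format, of n] by linarith
    qed
  qed
  have "(\<integral>x. \<rho> x - 1 \<partial>m) = 0" using i one by simp
  then have "AE x in m. \<rho> x - 1 = 0"
    using ge i by (subst (asm) integral_nonneg_eq_0_iff_AE) auto
  then have "\<mu> = density m (\<lambda>x. 1)"
    unfolding \<rho>(3) using \<rho>(1) by (intro density_cong) (auto elim: eventually_mono)
  then show ?thesis by (simp add: density_1)
qed

section \<open>The implications between the four assertions\<close>

lemma m_gibbs_ac: "m \<in> gibbs_ac K b m"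
  using m_gibbs by (simp add: gibbs_ac_def absolutely_continuous_def)

lemma irreducible_imp_unique:
  assumes irr: "irreducible_resolvent m U"
  shows "gibbs_ac K b m = {m}"
proof -
  have "prob A = 0 \<or> prob (- A) = 0" if A: "A \<in> sets m" "zero_energy K m (indicator A)" for A
  proof -
    have A': "- A \<in> sets m" using A(1) by (rule Compl_sets)
    \<comment> \<open>The potential charges no part of \<open>A\<close> from outside, so
      irreducibility is applied to the complement.\<close>
    have "AE x in m. x \<in> - A \<longrightarrow> potential_kernel U x (space m - - A) = 0"
      using zero_energy_potential[OF A] by eventually_elim simp
    then have "emeasure m (- A) = 0 \<or> emeasure m (space m - - A) = 0"
      using irr A' unfolding irreducible_resolvent_def by blast
    then show ?thesis by (auto simp: measure_def)
  qed
  then show ?thesis using gibbs_ac_unique m_gibbs_ac by blast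
qed

lemma unique_imp_irreducible:
  assumes uni: "gibbs_ac K b m = {m}"
  shows "irreducible_resolvent m U"
  unfolding irreducible_resolvent_def
proof (intro ballI impI)
  fix A assume A: "A \<in> sets m" and pot: "AE x in m. x \<in> A \<longrightarrow> potential_kernel U x (space m - A) = 0"
  show "emeasure m A = 0 \<or> emeasure m (space m - A) = 0"
  proof (cases "prob A = 0")
    case False
    then have pos: "0 < prob A" by (simp add: zero_less_measure_iff)
    obtain h where "zero_energy K m h" "AE x in m. h x = indicator A x"
      using potential_zero_energy[OF A] pot by (auto simp: Compl_eq_Diff_UNIV)
    then have "conditional A = m" using conditional_gibbs[OF A pos] uni by blast
    \<comment> \<open>The measure conditioned on \<open>A\<close> does not charge the complement,
      and by uniqueness it is \<open>m\<close>.\<close>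
    then have "prob (space m - A) = prob (A \<inter> (space m - A)) / prob A"
      using measure_conditional[OF A, of "space m - A"] A by auto
    then show ?thesis by (simp add: emeasure_eq_measure)
  qed (simp add: emeasure_eq_measure)
qed

text \<open>A zero-energy set of measure strictly between 0 and 1 would split \<open>m\<close> into
  its two normalized restrictions, both Gibbs states, with weights \<open>prob A\<close> and
  \<open>prob (- A)\<close>.\<close>

lemma extremal_imp_unique:
  assumes ext: "extremal_in m (gibbs_ac K b m)"
  shows "gibbs_ac K b m = {m}"
proof -
  have "prob A = 0 \<or> prob (- A) = 0" if A: "A \<in> sets m" "zero_energy K m (indicator A)" for A
  proof (rule ccontr)
    assume "\<not> (prob A = 0 \<or> prob (- A) = 0)"
    then have pos: "0 < prob A" "0 < prob (- A)" by (auto simp: zero_less_measure_iff)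
    have A': "- A \<in> sets m" using A(1) by (rule Compl_sets)
    have compl: "prob (- A) = 1 - prob A" using prob_compl[OF A(1)] by (simp add: Compl_eq_Diff_UNIV)
    \<comment> \<open>The indicator of the complement, written so that linearity of the partial
      forms applies.\<close>
    have zero': "zero_energy K m (\<lambda>x. indicator UNIV x + (- 1) * indicator A x)"
      unfolding zero_energy_def
    proof (intro conjI ballI)
      show "(\<lambda>x. indicator UNIV x + (- 1) * indicator A x) \<in> L2 m"
        using sets_m by (intro L2_lin indicator_in_L2 A(1)) simp
      fix k assume k: "k \<in> K"
      interpret k: log_deriv m k "b k" using log_deriv[OF k] .
      have d: "indicator UNIV \<in> partial_dom m k" "partial_form m k (indicator UNIV) (indicator UNIV) = 0"
        "indicator A \<in> partial_dom m k" "partial_form m k (indicator A) (indicator A) = 0"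
        using zero_energy_one[OF m_gibbs] A(2) k by (auto simp: zero_energy_def)
      show dom: "(\<lambda>x. indicator UNIV x + (- 1) * indicator A x) \<in> partial_dom m k"
        by (rule k.partial_dom_lin[OF d(1,3)])
      show "partial_form m k (\<lambda>x. indicator UNIV x + (- 1) * indicator A x) (\<lambda>x. indicator UNIV x + (- 1) * indicator A x) = 0"
        unfolding k.partial_form_lin[OF dom d(1,3)] k.partial_form_zero_right[OF dom d(1,2)]
          k.partial_form_zero_right[OF dom d(3,4)] by simp
    qed
    have c1: "conditional A \<in> gibbs_ac K b m"
      using A pos(1) by (intro conditional_gibbs[of A "indicator A"]) auto
    have c2: "conditional (- A) \<in> gibbs_ac K b m"
      by (rule conditional_gibbs[OF A' pos(2) zero']) (auto simp: indicator_def)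
    have "prob B = prob A * measure (conditional A) B + (1 - prob A) * measure (conditional (- A)) B" if "B \<in> sets m" for B
    proof -
      have "prob B = prob (A \<inter> B) + prob (- A \<inter> B)"
        using finite_measure_Union[of "A \<inter> B" "- A \<inter> B"] A(1) A' that
        by (simp add: Int_Un_distrib2[symmetric] disjoint_iff)
      then show ?thesis
        using pos unfolding compl[symmetric] measure_conditional[OF A(1) that] measure_conditional[OF A' that] by simp
    qed
    then have "conditional A = m"
      using ext c1 c2 pos compl unfolding extremal_in_def by (metis diff_gt_0_iff_gt)
    then have "prob (- A) = prob (A \<inter> - A) / prob A" using measure_conditional[OF A(1) A'] by simp
    then show False using pos by simp
  qed
  then show ?thesis using gibbs_ac_unique m_gibbs_ac by blast
qed

text \<open>With both weights positive, the two components of a decomposition of \<open>m\<close>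
  vanish on null sets of \<open>m\<close>, so a decomposition in \<open>gibbs K b\<close> is already
  one in \<open>gibbs_ac K b m\<close>.\<close>

lemma extremal_gibbs_ac_iff: "extremal_in m (gibbs_ac K b m) \<longleftrightarrow> extremal_in m (gibbs K b)"
proof
  assume ext: "extremal_in m (gibbs_ac K b m)"
  show "extremal_in m (gibbs K b)"
    unfolding extremal_in_def
  proof (intro conjI ballI allI impI m_gibbs)
    fix m1 m2 and t :: real
    assume m12: "m1 \<in> gibbs K b" "m2 \<in> gibbs K b"
      and t: "0 < t \<and> t < 1 \<and> (\<forall>A\<in>sets m. prob A = t * measure m1 A + (1 - t) * measure m2 A)"
    have ac: "absolutely_continuous m \<nu>"
      if \<nu>: "\<nu> \<in> gibbs K b" and le: "\<And>A. A \<in> sets m \<Longrightarrow> prob A = 0 \<Longrightarrow> measure \<nu> A = 0" for \<nu>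
      unfolding absolutely_continuous_def
    proof
      interpret \<nu>: prob_space \<nu> using gibbsD(1)[OF \<nu>] .
      fix N assume "N \<in> null_sets m"
      then have N: "N \<in> sets m" "prob N = 0" by (auto simp: null_sets_def measure_def)
      then show "N \<in> null_sets \<nu>"
        using le[OF N] gibbsD(2)[OF \<nu>] sets_m by (simp add: null_sets_def \<nu>.emeasure_eq_measure)
    qed
    have "measure m1 A = 0" "measure m2 A = 0" if "A \<in> sets m" "prob A = 0" for A
    proof -
      have s: "t * measure m1 A + (1 - t) * measure m2 A = 0" using t that by simp
      have nn: "0 \<le> t * measure m1 A" "0 \<le> (1 - t) * measure m2 A" using t by auto
      have "t * measure m1 A = 0" "(1 - t) * measure m2 A = 0" using s nn by linarith+
      then show "measure m1 A = 0" "measure m2 A = 0" using t by auto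
    qed
    then have "m1 \<in> gibbs_ac K b m" "m2 \<in> gibbs_ac K b m" using ac m12 by (auto simp: gibbs_ac_def)
    then show "m1 = m" "m2 = m" using ext t unfolding extremal_in_def by blast+
  qed
next
  assume "extremal_in m (gibbs K b)"
  then show "extremal_in m (gibbs_ac K b m)"
    using m_gibbs_ac unfolding extremal_in_def gibbs_ac_def by blast
qed

end

theorem theorem5p7:
  fixes K :: "'a::locally_convex_space set"
    and b :: "'a \<Rightarrow> 'a \<Rightarrow> real"
    and m :: "'a measure"
    and U :: "real \<Rightarrow> 'a \<Rightarrow> 'a measure"
  assumes "lusin_measurable (borel :: 'a measure)"
    and "countable K"
    and "\<And>l. l \<in> top_dual \<Longrightarrow> (\<lambda>k. \<bar>l k\<bar>\<^sup>2) summable_on K"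
    and "\<And>k. k \<in> K \<Longrightarrow> b k \<in> borel_measurable borel"
    and "m \<in> gibbs K b"
    and "realizes_dirichlet_resolvent K m U"
  shows "(irreducible_resolvent m U \<longleftrightarrow> gibbs_ac K b m = {m}) \<and>
    (gibbs_ac K b m = {m} \<longleftrightarrow> extremal_in m (gibbs_ac K b m)) \<and>
    (extremal_in m (gibbs_ac K b m) \<longleftrightarrow> extremal_in m (gibbs K b))"
proof -
  interpret dirichlet_resolvent K b m U using assms(5,6) by unfold_locales
  \<comment> \<open>Within a singleton only the trivial decomposition exists.\<close>
  have "extremal_in m (gibbs_ac K b m)" if "gibbs_ac K b m = {m}"
    using that by (simp add: extremal_in_def)
  then show ?thesis
    using irreducible_imp_unique unique_imp_irreducible extremal_imp_unique extremal_gibbs_ac_iff by blast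
qed

end
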